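(* Let $(\xi,\eta),(\xi_1,\eta_1),(\xi_2,\eta_2),\ldots$ be i.i.d. $\mathbb{R}^2$-valued random vectors, with no condition on the dependence between $\xi$ and $\eta$, and let $S_0:=0$, $S_n:=\xi_1+\ldots+\xi_n$ for $n\in\mathbb{N}$. Let $\alpha\in(0,2)$, let $\ell$ be slowly varying at $\infty$, and let $c_1,c_2\ge 0$ with $c_1+c_2=1$. Suppose that, as $x\to\infty$, $$\mathbb{P}\{|\xi|>x\}\sim x^{-\alpha}\ell(x),\qquad \mathbb{P}\{\xi>x\}\sim c_1\mathbb{P}\{|\xi|>x\},\qquad \mathbb{P}\{-\xi>x\}\sim c_2\mathbb{P}\{|\xi|>x\},$$ that $\mathbb{E}\xi=0$ if $\alpha\in(1,2)$, and that the distribution of $\xi$ is symmetric if $\alpha=1$. Suppose further that $$\lim_{x\to\infty}\frac{\mathbb{P}\{\eta>x\}}{\mathbb{P}\{|\xi|>x\}}=\infty$$ and that $x\mapsto\mathbb{P}\{\eta>x\}$ is regularly varying at $\infty$ of index $-\beta$, where $\beta\in(0,\alpha]$. Let $b(x)$ be a positive function which satisfies $\lim_{x\to\infty}x\,\mathbb{P}\{\eta>b(x)\}=1$. Then, as $n\to\infty$, $$\frac{\max_{0\le k\le[n\,\cdot]}(S_k+\eta_{k+1})}{b(n)}\ \Rightarrow\ \sup_{\theta_k\le\cdot}j_k$$ weakly on $D=D[0,\infty)$ equipped with the $J_1$-topology, where $(\theta_k,j_k)$ are the atoms of a Poisson random measure on $[0,\infty)\times(0,\infty]$ with mean measure $\mathbb{LEB}\times\mu$,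 and $\mu$ is the measure on $(0,\infty]$ defined by $\mu((x,\infty])=x^{-\beta}$, $x>0$.
   Context: $D=D[0,\infty)$ is the Skorokhod space of real-valued right-continuous functions on $[0,\infty)$ with finite left limits at each positive point; $J_1$ is the usual Skorokhod topology on it. $[\cdot]$ is the integer part, $\mathbb{LEB}$ is Lebesgue measure on $[0,\infty)$, and the supremum over the empty set equals zero. *)

theory Defs
  imports "HOL-Probability.Probability"
begin

section \<open>The Skorokhod space\<close>

text \<open>
  A function on \<open>[0,\<infinity>)\<close> is represented by a function on the reals that is \<open>undefined\<close>
  on the negative half-line, so that equality in \<open>skorokhod_space\<close> is equality on \<open>[0,\<infinity>)\<close>.
\<close>

definition skorokhod_space :: "(real \<Rightarrow> real) set" where
  "skorokhod_space =
     {x \<in> extensional {0..}.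
        (\<forall>t\<ge>0. (x \<longlongrightarrow> x t) (at_right t)) \<and>
        (\<forall>t>0. \<exists>l. (x \<longlongrightarrow> l) (at_left t))}"

text \<open>An increasing bijection of \<open>[0,\<infinity>)\<close> is automatically a homeomorphism fixing 0.\<close>

definition time_changes :: "(real \<Rightarrow> real) set" where
  "time_changes = {\<tau>. bij_betw \<tau> {0..} {0..} \<and> strict_mono_on {0..} \<tau>}"

definition J1_converges :: "(nat \<Rightarrow> real \<Rightarrow> real) \<Rightarrow> (real \<Rightarrow> real) \<Rightarrow> bool" where
  "J1_converges xs x \<longleftrightarrow>
     (\<exists>\<tau>. (\<forall>n. \<tau> n \<in> time_changes) \<and>
          uniform_limit {0..} \<tau> (\<lambda>t. t) sequentially \<and>
          (\<forall>T\<ge>0. uniform_limit {0..T} (\<lambda>n t. xs n (\<tau> n t)) x sequentially))"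

text \<open>
  The \<open>J\<^sub>1\<close>-topology on \<open>D[0,\<infinity>)\<close> is the metrizable topology whose convergent sequences are those
  of \<open>J1_converges\<close> (Jacod and Shiryaev, Limit Theorems for Stochastic Processes, Theorem VI.1.14).
  Being metrizable, it consists of the sequentially open sets.
\<close>

definition skorokhod_J1 :: "(real \<Rightarrow> real) topology" where
  "skorokhod_J1 = topology (\<lambda>U. U \<subseteq> skorokhod_space \<and>
     (\<forall>x\<in>U. \<forall>xs. (\<forall>n. xs n \<in> skorokhod_space) \<and> J1_converges xs x \<longrightarrow>
        (\<forall>\<^sub>F n in sequentially. xs n \<in> U)))"

lemma openin_skorokhod_J1:
  "openin skorokhod_J1 U \<longleftrightarrow> U \<subseteq> skorokhod_space \<and>
     (\<forall>x\<in>U. \<forall>xs. (\<forall>n. xs n \<in> skorokhod_space) \<and> J1_converges xs x \<longrightarrow>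
        (\<forall>\<^sub>F n in sequentially. xs n \<in> U))"
proof -
  let ?P = "\<lambda>U. U \<subseteq> skorokhod_space \<and>
     (\<forall>x\<in>U. \<forall>xs. (\<forall>n. xs n \<in> skorokhod_space) \<and> J1_converges xs x \<longrightarrow>
        (\<forall>\<^sub>F n in sequentially. xs n \<in> U))"
  have "istopology ?P"
    unfolding istopology_def
  proof (intro conjI allI impI)
    fix S T assume S: "?P S" and T: "?P T"
    show "S \<inter> T \<subseteq> skorokhod_space" using S by blast
    show "\<forall>x\<in>S \<inter> T. \<forall>xs. (\<forall>n. xs n \<in> skorokhod_space) \<and> J1_converges xs x \<longrightarrow>
        (\<forall>\<^sub>F n in sequentially. xs n \<in> S \<inter> T)"
      using S T by (auto intro: eventually_conj)
  next
    fix K assume K: "\<forall>S\<in>K. ?P S"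
    show "\<Union>K \<subseteq> skorokhod_space" using K by blast
    show "\<forall>x\<in>\<Union>K. \<forall>xs. (\<forall>n. xs n \<in> skorokhod_space) \<and> J1_converges xs x \<longrightarrow>
        (\<forall>\<^sub>F n in sequentially. xs n \<in> \<Union>K)"
    proof (intro ballI allI impI)
      fix x xs assume x: "x \<in> \<Union>K" and xs: "(\<forall>n. xs n \<in> skorokhod_space) \<and> J1_converges xs x"
      then obtain S where S: "S \<in> K" "x \<in> S" by blast
      then have "\<forall>\<^sub>F n in sequentially. xs n \<in> S" using K xs by blast
      then show "\<forall>\<^sub>F n in sequentially. xs n \<in> \<Union>K"
        by (rule eventually_mono) (use S in blast)
    qed
  qed
  then show ?thesis
    unfolding skorokhod_J1_def by (subst topology_inverse') auto
qed

lemma topspace_skorokhod_J1: "topspace skorokhod_J1 = skorokhod_space"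
proof
  show "topspace skorokhod_J1 \<subseteq> skorokhod_space"
    using openin_skorokhod_J1 openin_topspace by blast
  have "openin skorokhod_J1 skorokhod_space"
    by (auto simp: openin_skorokhod_J1)
  then show "skorokhod_space \<subseteq> topspace skorokhod_J1"
    by (rule openin_subset)
qed


section \<open>Weak convergence of random elements of a topological space\<close>

definition borel_algebra_of :: "'a topology \<Rightarrow> 'a measure" where
  "borel_algebra_of T = sigma (topspace T) {U. openin T U}"

definition converges_in_distribution ::
    "'s topology \<Rightarrow> 'a measure \<Rightarrow> (nat \<Rightarrow> 'a \<Rightarrow> 's) \<Rightarrow> 'b measure \<Rightarrow> ('b \<Rightarrow> 's) \<Rightarrow> bool" where
  "converges_in_distribution T M X Q Y \<longleftrightarrow>
     (\<forall>n. X n \<in> measurable M (borel_algebra_of T)) \<and>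
     Y \<in> measurable Q (borel_algebra_of T) \<and>
     (\<forall>F. continuous_map T euclideanreal F \<and> bounded (F ` topspace T) \<longrightarrow>
        (\<lambda>n. \<integral>\<omega>. F (X n \<omega>) \<partial>M) \<longlonglongrightarrow> (\<integral>\<omega>. F (Y \<omega>) \<partial>Q))"


section \<open>Regular variation at infinity\<close>

definition regularly_varying :: "(real \<Rightarrow> real) \<Rightarrow> real \<Rightarrow> bool" where
  "regularly_varying f \<rho> \<longleftrightarrow>
     (\<exists>a. f \<in> borel_measurable (restrict_space borel {a..}) \<and> (\<forall>x\<ge>a. f x > 0)) \<and>
     (\<forall>c>0. ((\<lambda>x. f (c * x) / f x) \<longlongrightarrow> c powr \<rho>) at_top)"

abbreviation slowly_varying :: "(real \<Rightarrow> real) \<Rightarrow> bool" where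
  "slowly_varying f \<equiv> regularly_varying f 0"


section \<open>Poisson random measures\<close>

text \<open>
  The push-forward of the counting measure on a countable index set \<open>I\<close> under \<open>z\<close> is the sum of the
  Dirac measures at the points \<open>z i\<close>, \<open>i \<in> I\<close>, counted with multiplicity.
  The measurable space underlying \<open>N\<close> is that of \<open>m\<close>.
\<close>

definition point_measure_on :: "'a::topological_space measure \<Rightarrow> 'a measure \<Rightarrow> bool" where
  "point_measure_on m N \<longleftrightarrow>
     (\<exists>(I::nat set) z. z \<in> I \<rightarrow> space m \<and> N = distr (count_space I) m z) \<and>
     (\<forall>K. compact K \<and> K \<subseteq> space m \<longrightarrow> emeasure N K < \<infinity>)"

text \<open>
  \<open>N\<close> is a Poisson random measure with mean measure \<open>m\<close>, defined on the probability space \<open>Q\<close>.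
  On sets of infinite mean measure, \<open>N\<close> is infinite almost surely.
\<close>

definition poisson_random_measure ::
    "'b measure \<Rightarrow> ('b \<Rightarrow> 'a::topological_space measure) \<Rightarrow> 'a measure \<Rightarrow> bool" where
  "poisson_random_measure Q N m \<longleftrightarrow>
     prob_space Q \<and>
     (\<forall>\<omega>\<in>space Q. point_measure_on m (N \<omega>)) \<and>
     (\<forall>A\<in>sets m. (\<lambda>\<omega>. emeasure (N \<omega>) A) \<in> borel_measurable Q) \<and>
     (\<forall>A\<in>sets m. emeasure m A < \<infinity> \<longrightarrow>
        (\<forall>k::nat. \<P>(\<omega> in Q. emeasure (N \<omega>) A = of_nat k)
                    = exp (- measure m A) * measure m A ^ k / fact k)) \<and>
     (\<forall>A\<in>sets m. emeasure m A = \<infinity> \<longrightarrow> (AE \<omega> in Q. emeasure (N \<omega>) A = \<infinity>)) \<and>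
     (\<forall>(n::nat) A. (\<forall>i<n. A i \<in> sets m) \<and> disjoint_family_on A {..<n} \<longrightarrow>
        prob_space.indep_vars Q (\<lambda>_. borel) (\<lambda>i \<omega>. emeasure (N \<omega>) (A i)) {..<n})"

definition atoms :: "'a measure \<Rightarrow> 'a set" where
  "atoms N = {z \<in> space N. emeasure N {z} \<noteq> 0}"


section \<open>The two processes\<close>

definition perturbed_walk_max ::
    "(nat \<Rightarrow> 'a \<Rightarrow> real) \<Rightarrow> (nat \<Rightarrow> 'a \<Rightarrow> real) \<Rightarrow> (real \<Rightarrow> real) \<Rightarrow> nat \<Rightarrow> 'a \<Rightarrow> real \<Rightarrow> real" where
  "perturbed_walk_max \<xi> \<eta> b n \<omega> =
     (\<lambda>t\<in>{0..}. Max ((\<lambda>k. (\<Sum>i=1..k. \<xi> i \<omega>) + \<eta> (Suc k) \<omega>) ` {0..nat \<lfloor>real n * t\<rfloor>}) / b (real n))"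

text \<open>
  Atoms have positive second coordinate, so inserting 0 only implements the convention that the
  supremum over the empty set is 0. For \<open>N\<close> with mean measure \<open>LEB \<times> \<mu>\<close> the supremum is almost surely
  finite for all \<open>t\<close>, because \<open>\<mu> {\<infinity>} = 0\<close>; \<open>real_of_ereal\<close> is only a coercion outside a null set.
\<close>

definition extremal_process :: "('b \<Rightarrow> (real \<times> ereal) measure) \<Rightarrow> 'b \<Rightarrow> real \<Rightarrow> real" where
  "extremal_process N \<omega> =
     (\<lambda>t\<in>{0..}. real_of_ereal (Sup (insert 0 {j. \<exists>\<theta>\<le>t. (\<theta>, j) \<in> atoms (N \<omega>)})))"

end

theory Submission
  imports Defs
begin

text \<open>
  The limit comes from the \<open>\<eta>\<close>-maxima alone.  The norming \<open>b n\<close> is chosen for the tail of \<open>\<eta>\<close>, which is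
  heavier than that of \<open>\<xi>\<close>, so that \<open>n P(\<bar>\<xi>\<bar> > b n) \<rightarrow> 0\<close>.  After truncation at \<open>b n\<close>, bounds of
  Karamata type for the truncated moments and a maximal inequality give
  \<open>max \<bar>S\<^sub>k\<bar> / b n \<rightarrow> 0\<close> in probability over \<open>k \<le> n T\<close>, whatever the dependence between \<open>\<xi>\<close> and \<open>\<eta>\<close>
  (lemma \<open>maximal_partial_sum_negligible\<close>).  Hence the process differs little from the positive part
  of the running maximum of \<open>\<eta>\<^sub>1, \<eta>\<^sub>2, \<dots>\<close>, divided by \<open>b n\<close>.

  For these running maxima there is an explicit coupling on the space of the Poisson random measure.
  Cut time into strips of length \<open>1 / n\<close>.  The largest heights of points in the strips are independent
  with distribution function \<open>exp (- y\<^sup>-\<^sup>\<beta> / n)\<close>.  A nondecreasing map \<open>H\<^sub>n\<close> (\<open>transport\<close>)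
  carries this law to the law of \<open>\<eta>\<close>, so that the transported strip maxima are a copy of \<open>\<eta>\<^sub>1, \<eta>\<^sub>2, \<dots>\<close>
  (\<open>copy_independent\<close>, \<open>copy_distribution\<close>).  Since \<open>H\<^sub>n\<close> is nondecreasing it commutes with maxima: the
  running maximum of the copies at time \<open>t\<close> is \<open>H\<^sub>n\<close> of the extremal process at the right end point of
  the strip of \<open>t\<close>.  Regular variation and the choice of \<open>b\<close> make \<open>H\<^sub>n / b n\<close> tend to the identity, and moving
  time to the end of the strip costs a small time change.  So the copies of the scaled maxima converge
  to the extremal process in the \<open>J\<^sub>1\<close>-sense, almost surely (\<open>copy_paths_J1_converge\<close>).

  Weak convergence follows by transferring this to the original space
  (\<open>step_paths_integral_tendsto\<close>).  The test functional \<open>F\<close> is only continuous, so the small difference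
  between the process and the scaled maxima has to be handled through the event that \<open>F\<close> reacts
  strongly to a small perturbation of the scaled maxima.  This is an open condition on the maxima;
  its probability may therefore be computed for the copies, where it tends to zero.

  The \<open>J\<^sub>1\<close>-arguments rest on the passage times of nondecreasing paths through finitely many levels: if
  these are matched by a time change then the paths are uniformly close (\<open>level_paths_matched\<close>).  The
  same criterion shows that the extremal process is measurable: countably many events about passage
  times determine the path up to \<open>J\<^sub>1\<close>-convergence (\<open>measurable_skorokhod_J1I\<close>,
  \<open>level_paths_measurable\<close>).
\<close>

section \<open>Time changes and convergence in the Skorokhod space\<close>

lemma diagonal_sequence:
  fixes P :: "nat \<Rightarrow> nat \<Rightarrow> bool"
  assumes "\<And>k. \<forall>\<^sub>F n in sequentially. P k n"
  obtains \<kappa> where "filterlim \<kappa> at_top sequentially" "\<forall>\<^sub>F n in sequentially. P (\<kappa> n) n"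
proof -
  \<comment> \<open>The largest \<open>k \<le> n\<close> that is good from \<open>n\<close> on; each \<open>k\<close> becomes admissible eventually.\<close>
  let ?S = "\<lambda>n. insert 0 {k. k \<le> n \<and> (\<forall>m\<ge>n. P k m)}"
  define \<kappa> where "\<kappa> n = Max (?S n)" for n
  have fin: "finite (?S n)" for n by simp
  have large: "\<forall>\<^sub>F n in sequentially. k \<le> \<kappa> n" for k
  proof -
    obtain n0 where n0: "\<And>m. m \<ge> n0 \<Longrightarrow> P k m"
      using assms[of k] by (auto simp: eventually_sequentially)
    show ?thesis
      unfolding \<kappa>_def
      by (rule eventually_sequentiallyI[of "max n0 k"], rule Max_ge[OF fin]) (auto intro: n0)
  qed
  have "\<forall>\<^sub>F n in sequentially. P (\<kappa> n) n"
    using large[of 1]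
  proof eventually_elim
    case (elim n)
    have "\<kappa> n \<in> ?S n" unfolding \<kappa>_def by (rule Max_in[OF fin]) simp
    then show ?case using elim by auto
  qed
  moreover have "filterlim \<kappa> at_top sequentially"
    using large by (simp add: filterlim_at_top)
  ultimately show thesis using that by blast
qed

text \<open>
  Piecewise linear interpolation through the points \<open>(p, \<phi> p)\<close>, continued with slope one.  On each
  linear piece the displacement \<open>\<sigma> t - t\<close> is a convex combination of the displacements at the two
  ends, so it never exceeds \<open>\<delta>\<close>.
\<close>
lemma piecewise_linear_interpolation:
  fixes \<phi> :: "real \<Rightarrow> real"
  assumes "finite P" "P \<subseteq> {0<..}" "strict_mono_on P \<phi>"
    "\<forall>p\<in>P. 0 < \<phi> p \<and> \<bar>\<phi> p - p\<bar> \<le> \<delta>" "0 \<le> \<delta>"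
  shows "\<exists>\<sigma>. continuous_on {0..} \<sigma> \<and> strict_mono_on {0..} \<sigma> \<and> \<sigma> 0 = 0 \<and>
              (\<forall>p\<in>P. \<sigma> p = \<phi> p) \<and> (\<forall>t\<ge>0. \<bar>\<sigma> t - t\<bar> \<le> \<delta>)"
  using assms
proof (induction P rule: finite_linorder_max_induct)
  case empty
  show ?case
    by (rule exI[of _ "\<lambda>t. t"]) (simp add: empty.prems strict_mono_on_def)
next
  case (insert p P)
  have mono': "strict_mono_on P \<phi>"
    using insert.prems(2) by (rule monotone_on_subset) auto
  have "P \<subseteq> {0<..}" "\<forall>p\<in>P. 0 < \<phi> p \<and> \<bar>\<phi> p - p\<bar> \<le> \<delta>"
    using insert.prems(1,3) by auto
  from insert.IH[OF this(1) mono' this(2) insert.prems(4)]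
  obtain \<sigma> where \<sigma>: "continuous_on {0..} \<sigma>" "strict_mono_on {0..} \<sigma>" "\<sigma> 0 = 0"
      "\<forall>p\<in>P. \<sigma> p = \<phi> p" "\<forall>t\<ge>0. \<bar>\<sigma> t - t\<bar> \<le> \<delta>"
    by (elim exE conjE) (rule that)
  define q where "q = Max (insert 0 P)"
  have q_in: "q \<in> insert 0 P"
    unfolding q_def by (rule Max_in) (use insert.hyps in auto)
  have q_ub: "x \<le> q" if "x \<in> P" for x
    unfolding q_def using that insert.hyps by simp
  have q0: "0 \<le> q" unfolding q_def using insert.hyps by simp
  have qp: "q < p" using q_in insert.hyps(2) insert.prems(1) by auto
  have lq: "\<sigma> q < \<phi> p"
    using q_in
  proof
    assume "q = 0"
    then show ?thesis using \<sigma>(3) insert.prems by simp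
  next
    assume "q \<in> P"
    then show ?thesis using \<sigma>(4) insert.prems(2) qp by (auto simp: strict_mono_on_def)
  qed
  define s where "s = (\<phi> p - \<sigma> q) / (p - q)"
  have s0: "0 < s" unfolding s_def using lq qp by simp
  \<comment> \<open>Slope \<open>s\<close> up to the new node \<open>p\<close> and slope one after it.\<close>
  define g where "g t = \<sigma> q + s * (min t p - q) + max 0 (t - p)" for t
  have g_mono: "g x < g y" if "x < y" for x y
  proof -
    consider "y \<le> p" | "x \<le> p" "p < y" | "p < x" using that by linarith
    then show ?thesis
    proof cases
      case 1
      then show ?thesis using that s0 by (auto simp: g_def)
    next
      case 2
      have "s * (x - q) \<le> s * (p - q)" using s0 2 by simp
      then show ?thesis using 2 by (auto simp: g_def)
    next
      case 3
      then show ?thesis using that by (auto simp: g_def)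
    qed
  qed
  have gq: "g q = \<sigma> q" using qp by (simp add: g_def)
  have gp: "g p = \<phi> p" using qp by (simp add: g_def s_def)
  define \<mu> where "\<mu> t = (if t \<le> q then \<sigma> t else g t)" for t
  have cont: "continuous_on {0..} \<mu>"
  proof -
    have "continuous_on ({0..q} \<union> {q..}) \<mu>"
      unfolding \<mu>_def
    proof (rule continuous_on_cases)
      show "continuous_on {0..q} \<sigma>" using \<sigma>(1) by (rule continuous_on_subset) auto
      show "continuous_on {q..} g" unfolding g_def by (intro continuous_intros)
    qed (use gq in \<open>auto intro: closed_atLeast\<close>)
    moreover have "{0..q} \<union> {q..} = {0..}" using q0 by auto
    ultimately show ?thesis by simp
  qed
  have mono: "strict_mono_on {0..} \<mu>"
  proof (rule strict_mono_onI)
    fix x y :: real assume xy: "x \<in> {0..}" "y \<in> {0..}" "x < y"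
    consider "y \<le> q" | "x \<le> q" "q < y" | "q < x" using xy by linarith
    then show "\<mu> x < \<mu> y"
    proof cases
      case 1
      then show ?thesis using xy \<sigma>(2) by (auto simp: \<mu>_def strict_mono_on_def)
    next
      case 2
      have "\<sigma> x \<le> \<sigma> q"
        using 2 xy \<sigma>(2) q0 by (cases "x = q") (auto simp: strict_mono_on_def less_imp_le)
      then show ?thesis using 2 g_mono[of q y] gq by (auto simp: \<mu>_def)
    next
      case 3
      then show ?thesis using xy g_mono by (auto simp: \<mu>_def)
    qed
  qed
  have disp: "\<bar>\<mu> t - t\<bar> \<le> \<delta>" if "0 \<le> t" for t
  proof -
    have lq': "\<bar>\<sigma> q - q\<bar> \<le> \<delta>" and lp': "\<bar>\<phi> p - p\<bar> \<le> \<delta>"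
      using \<sigma>(5) q0 insert.prems(3) by auto
    consider "t \<le> q" | "q < t" "t \<le> p" | "p < t" by linarith
    then show ?thesis
    proof cases
      case 1
      then show ?thesis using \<sigma>(5) that by (simp add: \<mu>_def)
    next
      case 2
      define a where "a = (t - q) / (p - q)"
      have a: "0 \<le> a" "a \<le> 1" using 2 by (auto simp: a_def)
      have "t = q + a * (p - q)" using qp by (simp add: a_def)
      moreover have "\<mu> t = \<sigma> q + a * (\<phi> p - \<sigma> q)"
        using 2 by (simp add: \<mu>_def g_def s_def a_def mult.commute)
      ultimately have "\<mu> t - t = (1 - a) * (\<sigma> q - q) + a * (\<phi> p - p)"
        by (simp add: algebra_simps)
      also have "\<bar>\<dots>\<bar> \<le> (1 - a) * \<bar>\<sigma> q - q\<bar> + a * \<bar>\<phi> p - p\<bar>"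
        using a by (intro order_trans[OF abs_triangle_ineq]) (simp add: abs_mult)
      also have "\<dots> \<le> (1 - a) * \<delta> + a * \<delta>"
        using a lq' lp' by (intro add_mono mult_left_mono) auto
      finally show ?thesis by (simp add: algebra_simps)
    next
      case 3
      have "\<mu> t - t = g p - p" using 3 qp by (simp add: \<mu>_def g_def)
      then show ?thesis using lp' gp by simp
    qed
  qed
  have start: "\<mu> 0 = 0" using q0 \<sigma>(3) by (simp add: \<mu>_def)
  have match: "\<forall>x\<in>insert p P. \<mu> x = \<phi> x"
    using \<sigma>(4) q_ub qp gp by (auto simp: \<mu>_def)
  have disp': "\<forall>t\<ge>0. \<bar>\<mu> t - t\<bar> \<le> \<delta>" using disp by simp
  show ?case
    by (rule exI[of _ \<mu>], intro conjI; fact)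
qed

lemma time_change_matching:
  fixes \<phi> :: "real \<Rightarrow> real"
  assumes "finite P" "P \<subseteq> {0<..}" "strict_mono_on P \<phi>"
    "\<forall>p\<in>P. 0 < \<phi> p \<and> \<bar>\<phi> p - p\<bar> \<le> \<delta>" "0 \<le> \<delta>"
  obtains \<sigma> where "\<sigma> \<in> time_changes" "\<sigma> 0 = 0" "\<And>p. p \<in> P \<Longrightarrow> \<sigma> p = \<phi> p"
    "\<And>t. 0 \<le> t \<Longrightarrow> \<bar>\<sigma> t - t\<bar> \<le> \<delta>"
proof -
  obtain \<sigma> where \<sigma>: "continuous_on {0..} \<sigma>" "strict_mono_on {0..} \<sigma>" "\<sigma> 0 = 0"
      "\<forall>p\<in>P. \<sigma> p = \<phi> p" "\<forall>t\<ge>0. \<bar>\<sigma> t - t\<bar> \<le> \<delta>"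
    using piecewise_linear_interpolation[OF assms] by blast
  have "\<sigma> \<in> time_changes"
    unfolding time_changes_def bij_betw_def mem_Collect_eq
  proof (intro conjI \<sigma>(2) equalityI subsetI)
    show "inj_on \<sigma> {0..}" using \<sigma>(2) by (rule strict_mono_on_imp_inj_on)
    fix s assume "s \<in> \<sigma> ` {0..}"
    then obtain t where t: "t \<in> {0..}" and s: "s = \<sigma> t" by blast
    show "s \<in> {0..}"
      unfolding s using t \<sigma>(2,3) strict_mono_onD[OF \<sigma>(2), of 0 t] by (cases "t = 0") auto
  next
    fix t :: real assume t: "t \<in> {0..}"
    have "\<bar>\<sigma> (t + \<delta>) - (t + \<delta>)\<bar> \<le> \<delta>" using \<sigma>(5) t assms(5) by auto
    then have "t \<le> \<sigma> (t + \<delta>)" by linarith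
    moreover have "continuous_on {0..t + \<delta>} \<sigma>" using \<sigma>(1) by (rule continuous_on_subset) auto
    ultimately obtain s where "0 \<le> s" "\<sigma> s = t"
      using IVT'[of \<sigma> 0 t "t + \<delta>"] t \<sigma>(3) assms(5) by auto
    then show "t \<in> \<sigma> ` {0..}" by force
  qed
  with \<sigma> show thesis using that by blast
qed

lemma id_in_time_changes: "(\<lambda>t. t) \<in> time_changes"
  by (auto simp: time_changes_def strict_mono_on_def bij_betw_def inj_on_def)

lemma time_change_nonneg: "\<sigma> \<in> time_changes \<Longrightarrow> 0 \<le> t \<Longrightarrow> 0 \<le> \<sigma> t"
  by (auto simp: time_changes_def bij_betw_def)

lemma time_change_le_iff:
  "\<sigma> \<in> time_changes \<Longrightarrow> 0 \<le> s \<Longrightarrow> 0 \<le> t \<Longrightarrow> \<sigma> s \<le> \<sigma> t \<longleftrightarrow> s \<le> t"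
  using strict_mono_on_less_eq[of "{0..}" \<sigma> s t] by (auto simp: time_changes_def)

text \<open>
  The time changes may be chosen separately for each accuracy and each horizon: a diagonal choice
  merges them into a single sequence.
\<close>
lemma J1_convergesI:
  assumes "\<And>\<epsilon> T. 0 < \<epsilon> \<Longrightarrow> 0 \<le> T \<Longrightarrow>
     \<forall>\<^sub>F n in sequentially. \<exists>\<sigma>\<in>time_changes. (\<forall>t\<ge>0. \<bar>\<sigma> t - t\<bar> \<le> \<epsilon>) \<and>
        (\<forall>t\<in>{0..T}. \<bar>xs n (\<sigma> t) - x t\<bar> \<le> \<epsilon>)"
  shows "J1_converges xs x"
proof -
  define good where "good k n \<sigma> \<longleftrightarrow> \<sigma> \<in> time_changes \<and> (\<forall>t\<ge>0. \<bar>\<sigma> t - t\<bar> \<le> 1 / Suc k) \<and>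
        (\<forall>t\<in>{0..real k}. \<bar>xs n (\<sigma> t) - x t\<bar> \<le> 1 / Suc k)" for k n :: nat and \<sigma>
  have "\<forall>\<^sub>F n in sequentially. \<exists>\<sigma>. good k n \<sigma>" for k
    using assms[of "1 / Suc k" "real k"] by (simp add: good_def Bex_def)
  then obtain \<kappa> where \<kappa>: "filterlim \<kappa> at_top sequentially"
      and ev: "\<forall>\<^sub>F n in sequentially. \<exists>\<sigma>. good (\<kappa> n) n \<sigma>"
    by (rule diagonal_sequence)
  define \<tau> where "\<tau> n = (if \<exists>\<sigma>. good (\<kappa> n) n \<sigma> then SOME \<sigma>. good (\<kappa> n) n \<sigma> else (\<lambda>t. t))" for n
  have ev': "\<forall>\<^sub>F n in sequentially. good (\<kappa> n) n (\<tau> n)"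
    using ev by eventually_elim (simp add: \<tau>_def someI_ex)
  have small: "\<forall>\<^sub>F n in sequentially. 1 / Suc (\<kappa> n) < \<epsilon>" if \<epsilon>: "0 < \<epsilon>" for \<epsilon> :: real
  proof -
    obtain k where k: "1 / Suc k < \<epsilon>" using reals_Archimedean[OF \<epsilon>] by (auto simp: inverse_eq_divide)
    have "\<forall>\<^sub>F n in sequentially. k \<le> \<kappa> n" using \<kappa> by (simp add: filterlim_at_top)
    then show ?thesis
    proof eventually_elim
      case (elim n)
      have "1 / real (Suc (\<kappa> n)) \<le> 1 / real (Suc k)" using elim by (simp add: frac_le)
      then show ?case using k by linarith
    qed
  qed
  show ?thesis
    unfolding J1_converges_def
  proof (intro exI[of _ \<tau>] conjI allI impI)
    fix n
    show "\<tau> n \<in> time_changes"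
    proof (cases "\<exists>\<sigma>. good (\<kappa> n) n \<sigma>")
      case True
      then have "good (\<kappa> n) n (\<tau> n)" by (simp add: \<tau>_def someI_ex)
      then show ?thesis by (simp add: good_def)
    qed (simp add: \<tau>_def id_in_time_changes)
  next
    show "uniform_limit {0..} \<tau> (\<lambda>t. t) sequentially"
    proof (rule uniform_limitI)
      fix e :: real assume "0 < e"
      from ev' small[OF this]
      show "\<forall>\<^sub>F n in sequentially. \<forall>t\<in>{0..}. dist (\<tau> n t) t < e"
        by eventually_elim (force simp: good_def dist_real_def)
    qed
  next
    fix T :: real assume T: "0 \<le> T"
    show "uniform_limit {0..T} (\<lambda>n t. xs n (\<tau> n t)) x sequentially"
    proof (rule uniform_limitI)
      fix e :: real assume e: "0 < e"
      have "\<forall>\<^sub>F n in sequentially. nat \<lceil>T\<rceil> \<le> \<kappa> n"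
        using \<kappa> by (auto simp only: filterlim_at_top)
      from ev' small[OF e] this
      show "\<forall>\<^sub>F n in sequentially. \<forall>t\<in>{0..T}. dist (xs n (\<tau> n t)) (x t) < e"
      proof eventually_elim
        case (elim n)
        have "T \<le> real (\<kappa> n)" using elim(3) by linarith
        then show ?case using elim(1,2) by (force simp: good_def dist_real_def)
      qed
    qed
  qed
qed

lemma J1_convergesD:
  assumes "J1_converges xs x" "0 < \<epsilon>" "0 \<le> T"
  shows "\<forall>\<^sub>F n in sequentially. \<exists>\<sigma>\<in>time_changes. (\<forall>t\<ge>0. \<bar>\<sigma> t - t\<bar> \<le> \<epsilon>) \<and>
        (\<forall>t\<in>{0..T}. \<bar>xs n (\<sigma> t) - x t\<bar> \<le> \<epsilon>)"
proof -
  obtain \<tau> where \<tau>: "\<And>n. \<tau> n \<in> time_changes" "uniform_limit {0..} \<tau> (\<lambda>t. t) sequentially"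
     "uniform_limit {0..T} (\<lambda>n t. xs n (\<tau> n t)) x sequentially"
    using assms by (auto simp: J1_converges_def)
  from uniform_limitD[OF \<tau>(2) assms(2)] uniform_limitD[OF \<tau>(3) assms(2)]
  show ?thesis
  proof eventually_elim
    case (elim n)
    then show ?case
      by (intro bexI[of _ "\<tau> n"] \<tau>(1)) (auto simp: dist_real_def less_imp_le)
  qed
qed

lemma J1_converges_perturbation:
  assumes conv: "J1_converges xs x"
    and close: "\<And>\<epsilon> T. 0 < \<epsilon> \<Longrightarrow> 0 \<le> T \<Longrightarrow> \<forall>\<^sub>F n in sequentially. \<forall>t\<in>{0..T}. \<bar>ys n t - xs n t\<bar> \<le> \<epsilon>"
  shows "J1_converges ys x"
proof (rule J1_convergesI)
  fix \<epsilon> T :: real assume \<epsilon>: "0 < \<epsilon>" and T: "0 \<le> T"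
  have "0 < \<epsilon> / 2" "0 \<le> T + \<epsilon>" using \<epsilon> T by auto
  from J1_convergesD[OF conv this(1) T] close[OF this]
  show "\<forall>\<^sub>F n in sequentially. \<exists>\<sigma>\<in>time_changes. (\<forall>t\<ge>0. \<bar>\<sigma> t - t\<bar> \<le> \<epsilon>) \<and>
        (\<forall>t\<in>{0..T}. \<bar>ys n (\<sigma> t) - x t\<bar> \<le> \<epsilon>)"
  proof eventually_elim
    case (elim n)
    from elim(1) obtain \<sigma> where \<sigma>: "\<sigma> \<in> time_changes" "\<forall>t\<ge>0. \<bar>\<sigma> t - t\<bar> \<le> \<epsilon> / 2"
      "\<forall>t\<in>{0..T}. \<bar>xs n (\<sigma> t) - x t\<bar> \<le> \<epsilon> / 2" by blast
    show ?case
    proof (intro bexI[of _ \<sigma>] conjI ballI allI impI \<sigma>(1))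
      fix t :: real assume "0 \<le> t"
      then have "\<bar>\<sigma> t - t\<bar> \<le> \<epsilon> / 2" using \<sigma>(2) by blast
      then show "\<bar>\<sigma> t - t\<bar> \<le> \<epsilon>" using \<epsilon> by linarith
    next
      fix t assume t: "t \<in> {0..T}"
      then have "\<bar>\<sigma> t - t\<bar> \<le> \<epsilon> / 2" using \<sigma>(2) by auto
      moreover have "0 \<le> t" "t \<le> T" using t by auto
      ultimately have "\<sigma> t \<in> {0..T + \<epsilon>}"
        using time_change_nonneg[OF \<sigma>(1) \<open>0 \<le> t\<close>] \<epsilon> unfolding atLeastAtMost_iff by linarith
      then have "\<bar>ys n (\<sigma> t) - xs n (\<sigma> t)\<bar> \<le> \<epsilon> / 2" using elim(2) by blast
      moreover have "\<bar>xs n (\<sigma> t) - x t\<bar> \<le> \<epsilon> / 2" using \<sigma>(3) t by blast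
      ultimately show "\<bar>ys n (\<sigma> t) - x t\<bar> \<le> \<epsilon>" by linarith
    qed
  qed
qed

lemma J1_converges_locally_uniform:
  assumes "\<And>\<epsilon> T. 0 < \<epsilon> \<Longrightarrow> 0 \<le> T \<Longrightarrow> \<forall>\<^sub>F n in sequentially. \<forall>t\<in>{0..T}. \<bar>xs n t - x t\<bar> \<le> \<epsilon>"
  shows "J1_converges xs x"
proof (rule J1_convergesI)
  fix \<epsilon> T :: real assume \<epsilon>: "0 < \<epsilon>" and T: "0 \<le> T"
  from assms[OF this]
  show "\<forall>\<^sub>F n in sequentially. \<exists>\<sigma>\<in>time_changes. (\<forall>t\<ge>0. \<bar>\<sigma> t - t\<bar> \<le> \<epsilon>) \<and>
        (\<forall>t\<in>{0..T}. \<bar>xs n (\<sigma> t) - x t\<bar> \<le> \<epsilon>)"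
  proof eventually_elim
    case (elim n)
    have "\<forall>t\<ge>0. \<bar>t - t\<bar> \<le> \<epsilon>" using \<epsilon> by simp
    with elim show ?case by (intro bexI[OF _ id_in_time_changes] conjI)
  qed
qed

lemma continuous_map_skorokhod_J1_sequentially:
  fixes F :: "(real \<Rightarrow> real) \<Rightarrow> real"
  assumes F: "continuous_map skorokhod_J1 euclideanreal F"
    and xs: "\<And>n. xs n \<in> skorokhod_space" and x: "x \<in> skorokhod_space"
    and conv: "J1_converges xs x"
  shows "(\<lambda>n. F (xs n)) \<longlonglongrightarrow> F x"
proof (rule topological_tendstoI)
  fix S :: "real set" assume S: "open S" "F x \<in> S"
  let ?U = "{y \<in> topspace skorokhod_J1. F y \<in> S}"
  have eS: "openin euclideanreal S" using S(1) open_openin by blast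
  have U: "openin skorokhod_J1 ?U"
    by (rule openin_continuous_map_preimage[OF F eS])
  have xU: "x \<in> ?U"
    by (rule CollectI, rule conjI, subst topspace_skorokhod_J1, rule x, rule S(2))
  have "\<forall>\<^sub>F n in sequentially. xs n \<in> ?U"
    by (rule mp[OF spec[OF bspec[OF conjunct2[OF iffD1[OF openin_skorokhod_J1 U]] xU], of xs]
          conjI[OF allI[OF xs] conv]])
  then show "\<forall>\<^sub>F n in sequentially. F (xs n) \<in> S"
    by (rule eventually_mono) simp
qed

section \<open>Nondecreasing paths described by their passage times\<close>

text \<open>
  The paths to come are \<open>[0,\<infinity>]\<close>-valued, nondecreasing and right-continuous.  All of this is encoded
  by saying that the set where a level \<open>y > 0\<close> has been reached is empty or of the form \<open>[s,\<infinity>)\<close>;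
  the last condition says that there is no explosion before the value \<open>\<infinity>\<close> is actually attained.
\<close>

definition passes_at :: "(real \<Rightarrow> ereal) \<Rightarrow> ereal \<Rightarrow> real \<Rightarrow> bool" where
  "passes_at z y s \<longleftrightarrow> 0 \<le> s \<and> (\<forall>t\<ge>0. y \<le> z t \<longleftrightarrow> s \<le> t)"

definition level_path :: "(real \<Rightarrow> ereal) \<Rightarrow> bool" where
  "level_path z \<longleftrightarrow> (\<forall>t\<ge>0. 0 \<le> z t) \<and>
     (\<forall>y>0. (\<forall>t\<ge>0. z t < y) \<or> (\<exists>s. passes_at z y s)) \<and>
     (\<forall>T. \<exists>K::nat. \<forall>t\<in>{0..T}. z t \<noteq> \<infinity> \<longrightarrow> z t \<le> ereal K)"

definition real_path :: "(real \<Rightarrow> ereal) \<Rightarrow> real \<Rightarrow> real" where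
  "real_path z = (\<lambda>t\<in>{0..}. real_of_ereal (z t))"

lemma passes_at_unique: "passes_at z y s \<Longrightarrow> passes_at z y s' \<Longrightarrow> s = s'"
  unfolding passes_at_def by (metis order_antisym order_refl)

lemma level_path_nonneg: "level_path z \<Longrightarrow> 0 \<le> t \<Longrightarrow> 0 \<le> z t"
  by (simp add: level_path_def)

lemma level_path_cases:
  assumes "level_path z" "0 < y"
  obtains "\<forall>t\<ge>0. z t < y" | s where "passes_at z y s"
  using assms by (auto simp: level_path_def)

lemma level_path_mono:
  assumes "level_path z" "0 \<le> s" "s \<le> t"
  shows "z s \<le> z t"
proof (cases "z s = 0")
  case True
  then show ?thesis using assms level_path_nonneg[OF assms(1), of t] by simp
next
  case False
  then have "0 < z s" using level_path_nonneg[OF assms(1,2)] by simp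
  with assms(1) show ?thesis
  proof (cases rule: level_path_cases)
    case 1
    then show ?thesis using assms(2) by blast
  next
    case (2 r)
    then have "r \<le> s" using assms(2) unfolding passes_at_def by blast
    then have "r \<le> t" "0 \<le> t" using assms by auto
    then show ?thesis using 2 unfolding passes_at_def by blast
  qed
qed

lemma level_path_bounded:
  assumes "level_path z"
  obtains K :: nat where "\<And>t. 0 \<le> t \<Longrightarrow> t \<le> T \<Longrightarrow> z t \<noteq> \<infinity> \<Longrightarrow> z t < ereal K"
proof -
  obtain K :: nat where K: "\<forall>t\<in>{0..T}. z t \<noteq> \<infinity> \<longrightarrow> z t \<le> ereal K"
    using assms unfolding level_path_def by blast
  show thesis
  proof (rule that[of "Suc K"])
    fix t assume t: "0 \<le> t" "t \<le> T" "z t \<noteq> \<infinity>"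
    then have "z t \<le> ereal K" using K by auto
    also have "\<dots> < ereal (Suc K)" by simp
    finally show "z t < ereal (Suc K)" .
  qed
qed

lemma level_path_eventually_below_right:
  assumes z: "level_path z" and t: "0 \<le> t" and y: "z t < y"
  shows "\<forall>\<^sub>F s in at_right t. z s < y"
proof -
  have "0 < y" using y level_path_nonneg[OF z t] by simp
  with z show ?thesis
  proof (cases rule: level_path_cases)
    case 1
    have "\<forall>\<^sub>F s in at_right t. t < s" by (rule eventually_at_right_less)
    then show ?thesis by (rule eventually_mono) (use 1 t in auto)
  next
    case (2 r)
    then have "t < r" using y t unfolding passes_at_def by (meson leD leI)
    then have "\<forall>\<^sub>F s in at_right t. s < r" "\<forall>\<^sub>F s in at_right t. t < s"
      by (auto intro: eventually_at_right_less simp: eventually_at_right_field)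
    then show ?thesis
    proof eventually_elim
      case (elim s)
      then have "\<not> r \<le> s" "0 \<le> s" using t by auto
      then show ?case using 2 unfolding passes_at_def by (meson leI)
    qed
  qed
qed

lemma real_path_in_skorokhod_space:
  assumes z: "level_path z"
  shows "real_path z \<in> skorokhod_space"
  unfolding skorokhod_space_def mem_Collect_eq
proof (intro conjI allI impI)
  show "real_path z \<in> extensional {0..}" by (simp add: real_path_def)
next
  fix t :: real assume t: "0 \<le> t"
  have right: "\<forall>\<^sub>F s in at_right t. t < s" by (rule eventually_at_right_less)
  show "(real_path z \<longlongrightarrow> real_path z t) (at_right t)"
  proof (cases "z t = \<infinity>")
    case True
    have "\<forall>\<^sub>F s in at_right t. real_path z s = real_path z t"
      using right
    proof eventually_elim
      case (elim s)
      then have "z s = \<infinity>" using level_path_mono[OF z t, of s] True by simp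
      then show ?case using elim t True by (simp add: real_path_def)
    qed
    then show ?thesis by (rule tendsto_eventually)
  next
    case False
    then obtain v where v: "z t = ereal v"
      using level_path_nonneg[OF z t] by (cases "z t") auto
    show ?thesis
    proof (rule tendstoI)
      fix e :: real assume e: "0 < e"
      have "z t < ereal (v + e)" using v e by simp
      from level_path_eventually_below_right[OF z t this] right
      show "\<forall>\<^sub>F s in at_right t. dist (real_path z s) (real_path z t) < e"
      proof eventually_elim
        case (elim s)
        have "ereal v \<le> z s" using level_path_mono[OF z t, of s] elim v by simp
        then obtain w where "z s = ereal w" "v \<le> w" "w < v + e"
          using elim by (cases "z s") auto
        then show ?case using elim t v by (simp add: real_path_def dist_real_def)
      qed
    qed
  qed
next
  fix t :: real assume t: "0 < t"
  have left: "\<forall>\<^sub>F s in at_left t. s < t" by (simp add: eventually_at_left_field lt_ex)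
  show "\<exists>l. (real_path z \<longlongrightarrow> l) (at_left t)"
  \<comment> \<open>After an explosion the real path is zero, since \<open>real_of_ereal \<infinity> = 0\<close>.\<close>
  proof (cases "\<exists>r. 0 \<le> r \<and> r < t \<and> z r = \<infinity>")
    case True
    then obtain r where r: "0 \<le> r" "r < t" "z r = \<infinity>" by blast
    have "\<forall>\<^sub>F s in at_left t. r < s" using r by (auto simp: eventually_at_left_field)
    then have "\<forall>\<^sub>F s in at_left t. real_path z s = 0"
    proof eventually_elim
      case (elim s)
      then have "z s = \<infinity>" using level_path_mono[OF z r(1), of s] r by simp
      then show ?case using elim r by (simp add: real_path_def)
    qed
    then show ?thesis by (intro exI) (rule tendsto_eventually)
  next
    case False
    obtain K :: nat where K: "\<And>s. 0 \<le> s \<Longrightarrow> s \<le> t \<Longrightarrow> z s \<noteq> \<infinity> \<Longrightarrow> z s < ereal K"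
      using level_path_bounded[OF z] by metis
    have val: "z s = ereal (real_path z s)" "real_path z s \<le> K" if "0 \<le> s" "s < t" for s
    proof -
      have fin: "z s \<noteq> \<infinity>" using False that by blast
      then show eq: "z s = ereal (real_path z s)"
        using level_path_nonneg[OF z that(1)] that(1) by (cases "z s") (auto simp: real_path_def)
      show "real_path z s \<le> K" using K[OF that(1) _ fin] that(2) eq by (metis ereal_less_eq(3) less_imp_le)
    qed
    have mono: "real_path z s \<le> real_path z s'" if "0 \<le> s" "s \<le> s'" "s' < t" for s s'
      using level_path_mono[OF z that(1,2)] val(1)[of s] val(1)[of s'] that
      by (metis ereal_less_eq(3) order.strict_trans1 order_trans)
    define l where "l = Sup (real_path z ` {0..<t})"
    have bdd: "bdd_above (real_path z ` {0..<t})"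
      by (rule bdd_aboveI[of _ "real K"]) (use val(2) in auto)
    have "(real_path z \<longlongrightarrow> l) (at_left t)"
    proof (rule increasing_tendsto)
      have "\<forall>\<^sub>F s in at_left t. 0 < s" using t by (auto simp: eventually_at_left_field)
      with left show "\<forall>\<^sub>F s in at_left t. real_path z s \<le> l"
        by eventually_elim (auto simp: l_def intro!: cSup_upper bdd)
    next
      fix x assume "x < l"
      then obtain s where s: "0 \<le> s" "s < t" "x < real_path z s"
        unfolding l_def using t by (subst (asm) less_cSup_iff) (auto intro: bdd)
      have "\<forall>\<^sub>F r in at_left t. s < r" using s by (auto simp: eventually_at_left_field)
      with left show "\<forall>\<^sub>F r in at_left t. x < real_path z r"
      proof eventually_elim
        case (elim r)
        then show ?case using mono[of s r] s by simp
      qed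
    qed
    then show ?thesis by blast
  qed
qed

text \<open>
  A time change that carries the passage times \<open>p y\<close> of one path to the passage times \<open>q y\<close> of the
  other makes the two paths reach every level of \<open>Y\<close> simultaneously.  Equal passage times must stay
  equal, since a time change cannot split a jump into two.
\<close>
lemma passage_times_matched:
  fixes p q :: "ereal \<Rightarrow> real"
  assumes finY: "finite Y" and RY: "R \<subseteq> Y" and \<epsilon>: "0 < \<epsilon>"
    and p: "\<And>y. y \<in> R \<Longrightarrow> passes_at z y (p y)"
    and q: "\<And>y. y \<in> R \<Longrightarrow> passes_at w y (q y)" "\<And>y. y \<in> R \<Longrightarrow> \<bar>q y - p y\<bar> \<le> \<epsilon>"
    and less: "\<And>y y'. y \<in> R \<Longrightarrow> y' \<in> R \<Longrightarrow> p y < p y' \<Longrightarrow> q y < q y'"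
    and eq: "\<And>y y'. y \<in> R \<Longrightarrow> y' \<in> R \<Longrightarrow> p y = p y' \<Longrightarrow> q y = q y'"
    and zero: "\<And>y. y \<in> R \<Longrightarrow> p y = 0 \<longleftrightarrow> q y = 0"
    and never: "\<And>y t. y \<in> Y - R \<Longrightarrow> 0 \<le> t \<Longrightarrow> z t < y"
      "\<And>y t. y \<in> Y - R \<Longrightarrow> 0 \<le> t \<Longrightarrow> t \<le> T + \<epsilon> \<Longrightarrow> w t < y"
  obtains \<sigma> where "\<sigma> \<in> time_changes" "\<And>t. 0 \<le> t \<Longrightarrow> \<bar>\<sigma> t - t\<bar> \<le> \<epsilon>"
    "\<And>t y. 0 \<le> t \<Longrightarrow> t \<le> T \<Longrightarrow> y \<in> Y \<Longrightarrow> y \<le> z t \<longleftrightarrow> y \<le> w (\<sigma> t)"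
proof -
  have p0: "0 \<le> p y" if "y \<in> R" for y using p[OF that] by (simp add: passes_at_def)
  have q0: "0 \<le> q y" if "y \<in> R" for y using q(1)[OF that] by (simp add: passes_at_def)
  define P where "P = p ` R - {0}"
  have finP: "finite P" using finY RY by (auto simp: P_def intro: finite_subset)
  have P_pos: "P \<subseteq> {0<..}" using p0 by (force simp: P_def)
  \<comment> \<open>The node map \<open>p y \<mapsto> q y\<close>; it is well defined because equal \<open>p y\<close> have equal \<open>q y\<close>.\<close>
  define \<phi> where "\<phi> s = q (SOME y. y \<in> R \<and> p y = s)" for s
  have \<phi>: "\<phi> (p y) = q y" if y: "y \<in> R" for y
  proof -
    have "(SOME y'. y' \<in> R \<and> p y' = p y) \<in> R \<and> p (SOME y'. y' \<in> R \<and> p y' = p y) = p y"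
      by (rule someI[of _ y]) (use y in simp)
    then show ?thesis unfolding \<phi>_def using eq y by blast
  qed
  have "strict_mono_on P \<phi>"
  proof (rule strict_mono_onI)
    fix r s assume "r \<in> P" "s \<in> P" "r < s"
    moreover from this obtain y y' where "y \<in> R" "r = p y" "y' \<in> R" "s = p y'"
      unfolding P_def by blast
    ultimately show "\<phi> r < \<phi> s" using less \<phi> by simp
  qed
  moreover have "\<forall>s\<in>P. 0 < \<phi> s \<and> \<bar>\<phi> s - s\<bar> \<le> \<epsilon>"
  proof
    fix s assume "s \<in> P"
    then obtain y where y: "y \<in> R" "s = p y" "p y \<noteq> 0" unfolding P_def by blast
    then have "q y \<noteq> 0" using zero by simp
    then have "0 < q y" using q0[OF y(1)] by simp
    then show "0 < \<phi> s \<and> \<bar>\<phi> s - s\<bar> \<le> \<epsilon>" using y \<phi> q(2) by simp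
  qed
  ultimately obtain \<sigma> where \<sigma>: "\<sigma> \<in> time_changes" "\<sigma> 0 = 0" "\<And>s. s \<in> P \<Longrightarrow> \<sigma> s = \<phi> s"
      "\<And>t. 0 \<le> t \<Longrightarrow> \<bar>\<sigma> t - t\<bar> \<le> \<epsilon>"
    using time_change_matching[OF finP P_pos] \<epsilon> by (metis less_imp_le)
  have \<sigma>p: "\<sigma> (p y) = q y" if y: "y \<in> R" for y
  proof (cases "p y = 0")
    case True
    then show ?thesis using zero[OF y] \<sigma>(2) by simp
  next
    case False
    then have "p y \<in> P" using y by (simp add: P_def)
    then show ?thesis using \<sigma>(3) \<phi>[OF y] by simp
  qed
  show thesis
  proof (rule that[OF \<sigma>(1,4)])
    fix t y assume t: "0 \<le> t" "t \<le> T" and y: "y \<in> Y"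
    have \<sigma>t: "0 \<le> \<sigma> t" by (rule time_change_nonneg[OF \<sigma>(1) t(1)])
    show "y \<le> z t \<longleftrightarrow> y \<le> w (\<sigma> t)"
    proof (cases "y \<in> R")
      case True
      have "y \<le> z t \<longleftrightarrow> p y \<le> t" using p[OF True] t(1) by (simp add: passes_at_def)
      also have "\<dots> \<longleftrightarrow> \<sigma> (p y) \<le> \<sigma> t" using time_change_le_iff[OF \<sigma>(1) p0[OF True] t(1)] by simp
      also have "\<dots> \<longleftrightarrow> y \<le> w (\<sigma> t)"
        using q(1)[OF True] \<sigma>t unfolding \<sigma>p[OF True] by (simp add: passes_at_def)
      finally show ?thesis .
    next
      case False
      have "\<sigma> t \<le> T + \<epsilon>" using \<sigma>(4)[OF t(1)] t(2) by linarith
      then have "w (\<sigma> t) < y" "z t < y" using never y False t(1) \<sigma>t by auto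
      then show ?thesis by auto
    qed
  qed
qed

lemma same_cell_close:
  fixes a b :: ereal
  assumes a: "0 \<le> a" and b: "0 \<le> b" and K: "a \<noteq> \<infinity> \<Longrightarrow> a < ereal (real K)" and k: "0 < k"
    and inf: "\<infinity> \<le> a \<longleftrightarrow> \<infinity> \<le> b"
    and cell: "\<And>i::nat. 1 \<le> i \<Longrightarrow> i \<le> K * k \<Longrightarrow> ereal (real i / real k) \<le> a \<longleftrightarrow> ereal (real i / real k) \<le> b"
  shows "\<bar>real_of_ereal b - real_of_ereal a\<bar> \<le> 1 / real k"
proof (cases "a = \<infinity>")
  case True
  then show ?thesis using inf by simp
next
  case False
  then have "b \<noteq> \<infinity>" using inf by auto
  then obtain x y where xy: "a = ereal x" "b = ereal y" "0 \<le> x" "0 \<le> y"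
    using a b False by (cases a; cases b) auto
  have xK: "x < K" using K[OF False] xy by simp
  define i where "i = nat \<lfloor>x * k\<rfloor>"
  have "0 \<le> x * k" using xy(3) by simp
  then have i: "real i \<le> x * k" "x * k < real (i + 1)"
    unfolding i_def by linarith+
  have k': "0 < real k" using k by simp
  have "x * k < real K * k" by (rule mult_strict_right_mono[OF xK k'])
  also have "\<dots> = real (K * k)" by simp
  finally have iK: "i + 1 \<le> K * k" using i(1) by linarith
  have bounds: "real i / k \<le> x" "x < real (i + 1) / k"
    using i k' by (simp_all only: pos_divide_le_eq pos_less_divide_eq)
  have lower: "real i / k \<le> y"
  proof (cases "i = 0")
    case False
    then have "ereal (real i / k) \<le> a \<longleftrightarrow> ereal (real i / k) \<le> b" using cell iK by simp
    then show ?thesis using bounds(1) unfolding xy(1,2) ereal_less_eq(3) by blast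
  qed (use xy in simp)
  have "ereal (real (i + 1) / k) \<le> a \<longleftrightarrow> ereal (real (i + 1) / k) \<le> b" 
    by (rule cell) (use iK in simp_all)
  then have upper: "y < real (i + 1) / k"
    using bounds(2) unfolding xy(1,2) ereal_less_eq(3) by linarith
  have "real (i + 1) / k = real i / k + 1 / k" by (simp add: add_divide_distrib)
  then have "\<bar>y - x\<bar> \<le> 1 / k" using lower upper bounds by linarith
  then show ?thesis using xy by simp
qed

definition grid_levels :: "ereal set" where
  "grid_levels = insert \<infinity> {ereal (real i / real k) | i k :: nat. 0 < i \<and> 0 < k}"

lemma countable_grid_levels: "countable grid_levels"
proof -
  have "grid_levels \<subseteq> insert \<infinity> ((\<lambda>(i, k). ereal (real i / real k)) ` (UNIV :: (nat \<times> nat) set))"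
    by (auto simp: grid_levels_def)
  then show ?thesis by (rule countable_subset) simp
qed

lemma grid_levels_pos: "y \<in> grid_levels \<Longrightarrow> 0 < y"
  by (auto simp: grid_levels_def)

text \<open>
  Only finitely many levels matter on a bounded time interval and for a given accuracy, so that the
  convergence of each single passage time is enough.
\<close>
lemma level_paths_matched:
  fixes z :: "real \<Rightarrow> ereal" and zs :: "nat \<Rightarrow> real \<Rightarrow> ereal"
  assumes z: "level_path z"
    and zs: "\<And>n t. 0 \<le> t \<Longrightarrow> 0 \<le> zs n t"
    and pass: "\<And>y s e. y \<in> grid_levels \<Longrightarrow> passes_at z y s \<Longrightarrow> 0 < e \<Longrightarrow>
        \<forall>\<^sub>F n in sequentially. \<exists>s'. passes_at (zs n) y s' \<and> \<bar>s' - s\<bar> < e"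
    and start: "\<And>y. y \<in> grid_levels \<Longrightarrow> passes_at z y 0 \<Longrightarrow>
        \<forall>\<^sub>F n in sequentially. passes_at (zs n) y 0"
    and equal: "\<And>y y' s. y \<in> grid_levels \<Longrightarrow> y' \<in> grid_levels \<Longrightarrow>
        passes_at z y s \<Longrightarrow> passes_at z y' s \<Longrightarrow>
        \<forall>\<^sub>F n in sequentially. \<exists>s'. passes_at (zs n) y s' \<and> passes_at (zs n) y' s'"
    and never: "\<And>y T. y \<in> grid_levels \<Longrightarrow> \<forall>t\<ge>0. z t < y \<Longrightarrow>
        \<forall>\<^sub>F n in sequentially. \<forall>t\<in>{0..T}. zs n t < y"
    and \<epsilon>: "0 < \<epsilon>" and T: "0 \<le> T"
  shows "\<forall>\<^sub>F n in sequentially. \<exists>\<sigma>\<in>time_changes. (\<forall>t\<ge>0. \<bar>\<sigma> t - t\<bar> \<le> \<epsilon>) \<and>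
      (\<forall>t\<in>{0..T}. \<bar>real_of_ereal (zs n (\<sigma> t)) - real_of_ereal (z t)\<bar> \<le> \<epsilon>)"
proof -
  obtain k0 where k0: "1 / real (Suc k0) < \<epsilon>"
    using reals_Archimedean[OF \<epsilon>] by (auto simp: inverse_eq_divide)
  define k where "k = Suc k0"
  have k: "0 < k" "1 / real k < \<epsilon>" using k0 by (auto simp: k_def)
  obtain K :: nat where K: "\<And>t. 0 \<le> t \<Longrightarrow> t \<le> T \<Longrightarrow> z t \<noteq> \<infinity> \<Longrightarrow> z t < ereal K"
    using level_path_bounded[OF z] by metis
  \<comment> \<open>Cells of width \<open>1 / k < \<epsilon>\<close> up to a bound \<open>K\<close> for the finite values on \<open>[0,T]\<close>.\<close>
  define Y where "Y = insert \<infinity> ((\<lambda>i. ereal (real i / real k)) ` {1..K * k})"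
  have finY: "finite Y" by (simp add: Y_def)
  have YL: "Y \<subseteq> grid_levels" using k(1) by (force simp: Y_def grid_levels_def)
  have Y_cell: "ereal (real i / real k) \<in> Y" if "1 \<le> i" "i \<le> K * k" for i
    using that by (auto simp: Y_def)
  have Y_inf: "\<infinity> \<in> Y" by (simp add: Y_def)
  define R where "R = {y \<in> Y. \<exists>s. passes_at z y s}"
  define p where "p y = (SOME s. passes_at z y s)" for y
  have p: "passes_at z y (p y)" if "y \<in> R" for y
    using that unfolding R_def p_def by (blast intro: someI)
  have p0: "0 \<le> p y" if "y \<in> R" for y using p[OF that] by (simp add: passes_at_def)
  have RY: "R \<subseteq> Y" and finR: "finite R" using finY by (auto simp: R_def)
  have RL: "y \<in> grid_levels" if "y \<in> R" for y using that RY YL by blast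
  have never': "\<forall>t\<ge>0. z t < y" if "y \<in> Y - R" for y
    using level_path_cases[OF z grid_levels_pos[of y]] that YL unfolding R_def by blast
  have ev1: "\<forall>\<^sub>F n in sequentially. \<forall>y\<in>R. \<exists>s'. passes_at (zs n) y s' \<and> \<bar>s' - p y\<bar> < \<epsilon>"
    by (rule eventually_ball_finite[OF finR]) (rule ballI, rule pass[OF RL p \<epsilon>])
  have ev2: "\<forall>\<^sub>F n in sequentially. \<forall>y\<in>R. \<forall>s'. passes_at (zs n) y s' \<longrightarrow> (p y = 0 \<longleftrightarrow> s' = 0)"
  proof (rule eventually_ball_finite[OF finR], rule ballI)
    fix y assume y: "y \<in> R"
    show "\<forall>\<^sub>F n in sequentially. \<forall>s'. passes_at (zs n) y s' \<longrightarrow> (p y = 0 \<longleftrightarrow> s' = 0)"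
    proof (cases "p y = 0")
      case True
      have "\<forall>\<^sub>F n in sequentially. passes_at (zs n) y 0"
        by (rule start[OF RL[OF y]]) (use p[OF y] True in simp)
      then show ?thesis
        by eventually_elim (use True passes_at_unique in blast)
    next
      case False
      then have "0 < p y" using p0[OF y] by simp
      from pass[OF RL[OF y] p[OF y] this]
      show ?thesis
      proof eventually_elim
        case (elim n)
        then obtain r where r: "passes_at (zs n) y r" "\<bar>r - p y\<bar> < p y" by blast
        then have "r \<noteq> 0" by auto
        then show ?case using r(1) False passes_at_unique by blast
      qed
    qed
  qed
  have ev3: "\<forall>\<^sub>F n in sequentially. \<forall>y\<in>R. \<forall>y'\<in>R. p y < p y' \<longrightarrow>
      (\<forall>s s'. passes_at (zs n) y s \<longrightarrow> passes_at (zs n) y' s' \<longrightarrow> s < s')"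
  proof (intro eventually_ball_finite finR ballI)
    fix y y' assume y: "y \<in> R" "y' \<in> R"
    show "\<forall>\<^sub>F n in sequentially. p y < p y' \<longrightarrow>
      (\<forall>s s'. passes_at (zs n) y s \<longrightarrow> passes_at (zs n) y' s' \<longrightarrow> s < s')"
    proof (cases "p y < p y'")
      case True
      define e where "e = (p y' - p y) / 2"
      have e: "0 < e" "e + e = p y' - p y" using True by (auto simp: e_def)
      from pass[OF RL[OF y(1)] p[OF y(1)] e(1)] pass[OF RL[OF y(2)] p[OF y(2)] e(1)]
      show ?thesis
      proof eventually_elim
        case (elim n)
        then obtain r r' where r: "passes_at (zs n) y r" "\<bar>r - p y\<bar> < e"
            "passes_at (zs n) y' r'" "\<bar>r' - p y'\<bar> < e" by blast
        with e(2) have "r < r'" by linarith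
        then show ?case using r(1,3) passes_at_unique by blast
      qed
    qed simp
  qed
  have ev4: "\<forall>\<^sub>F n in sequentially. \<forall>y\<in>R. \<forall>y'\<in>R. p y = p y' \<longrightarrow>
      (\<exists>s'. passes_at (zs n) y s' \<and> passes_at (zs n) y' s')"
  proof (intro eventually_ball_finite finR ballI)
    fix y y' assume y: "y \<in> R" "y' \<in> R"
    show "\<forall>\<^sub>F n in sequentially. p y = p y' \<longrightarrow> (\<exists>s'. passes_at (zs n) y s' \<and> passes_at (zs n) y' s')"
    proof (cases "p y = p y'")
      case True
      then have "passes_at z y' (p y)" using p[OF y(2)] by simp
      from equal[OF RL[OF y(1)] RL[OF y(2)] p[OF y(1)] this]
      show ?thesis by (rule eventually_mono) simp
    qed simp
  qed
  have ev5: "\<forall>\<^sub>F n in sequentially. \<forall>y\<in>Y - R. \<forall>t\<in>{0..T + \<epsilon>}. zs n t < y"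
    by (rule eventually_ball_finite) (use finY never never' YL in auto)
  from ev1 ev2 ev3 ev4 ev5 show ?thesis
  proof eventually_elim
    case (elim n)
    define q where "q y = (SOME s. passes_at (zs n) y s)" for y
    have q: "passes_at (zs n) y (q y)" if y: "y \<in> R" for y
      unfolding q_def using elim(1) y by (blast intro: someI)
    have q_close: "\<bar>q y - p y\<bar> \<le> \<epsilon>" if y: "y \<in> R" for y
    proof -
      obtain s where s: "passes_at (zs n) y s" "\<bar>s - p y\<bar> < \<epsilon>" using elim(1) y by blast
      then show ?thesis using passes_at_unique[OF q[OF y] s(1)] by simp
    qed
    have q_less: "q y < q y'" if "y \<in> R" "y' \<in> R" "p y < p y'" for y y'
      using elim(3) that q[OF that(1)] q[OF that(2)] by blast
    have q_eq: "q y = q y'" if y: "y \<in> R" "y' \<in> R" "p y = p y'" for y y'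
    proof -
      obtain s where "passes_at (zs n) y s" "passes_at (zs n) y' s" using elim(4) y by blast
      then show ?thesis using passes_at_unique q[OF y(1)] q[OF y(2)] by blast
    qed
    have q_zero: "p y = 0 \<longleftrightarrow> q y = 0" if "y \<in> R" for y
      using elim(2) that q[OF that] by blast
    have z_below: "z t < y" if "y \<in> Y - R" "0 \<le> t" for y t using never'[OF that(1)] that(2) by blast
    have zs_below: "zs n t < y" if "y \<in> Y - R" "0 \<le> t" "t \<le> T + \<epsilon>" for y t
      using elim(5) that by simp
    obtain \<sigma> where \<sigma>: "\<sigma> \<in> time_changes" "\<And>t. 0 \<le> t \<Longrightarrow> \<bar>\<sigma> t - t\<bar> \<le> \<epsilon>"
      "\<And>t y. 0 \<le> t \<Longrightarrow> t \<le> T \<Longrightarrow> y \<in> Y \<Longrightarrow> y \<le> z t \<longleftrightarrow> y \<le> zs n (\<sigma> t)"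
      using passage_times_matched[OF finY RY \<epsilon> p q q_close q_less q_eq q_zero z_below zs_below]
      by blast
    show ?case
    proof (intro bexI[OF _ \<sigma>(1)] conjI allI impI ballI \<sigma>(2))
      fix t assume "t \<in> {0..T}"
      then have t: "0 \<le> t" "t \<le> T" by auto
      have "\<bar>real_of_ereal (zs n (\<sigma> t)) - real_of_ereal (z t)\<bar> \<le> 1 / real k"
      proof (rule same_cell_close[where K = K])
        show "0 \<le> z t" using level_path_nonneg[OF z t(1)] .
        show "0 \<le> zs n (\<sigma> t)" using zs time_change_nonneg[OF \<sigma>(1) t(1)] .
        show "z t \<noteq> \<infinity> \<Longrightarrow> z t < ereal (real K)" using K[OF t] .
        show "\<infinity> \<le> z t \<longleftrightarrow> \<infinity> \<le> zs n (\<sigma> t)" by (rule \<sigma>(3)[OF t Y_inf])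
        show "ereal (real i / real k) \<le> z t \<longleftrightarrow> ereal (real i / real k) \<le> zs n (\<sigma> t)"
          if "1 \<le> i" "i \<le> K * k" for i
          by (rule \<sigma>(3)[OF t Y_cell[OF that]])
      qed (rule k(1))
      then show "\<bar>real_of_ereal (zs n (\<sigma> t)) - real_of_ereal (z t)\<bar> \<le> \<epsilon>" using k(2) by linarith
    qed
  qed
qed

lemma level_paths_J1_converge:
  fixes z :: "real \<Rightarrow> ereal" and zs :: "nat \<Rightarrow> real \<Rightarrow> ereal"
  assumes "level_path z" "\<And>n t. 0 \<le> t \<Longrightarrow> 0 \<le> zs n t"
    and "\<And>y s e. y \<in> grid_levels \<Longrightarrow> passes_at z y s \<Longrightarrow> 0 < e \<Longrightarrow>
        \<forall>\<^sub>F n in sequentially. \<exists>s'. passes_at (zs n) y s' \<and> \<bar>s' - s\<bar> < e"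
    and "\<And>y. y \<in> grid_levels \<Longrightarrow> passes_at z y 0 \<Longrightarrow> \<forall>\<^sub>F n in sequentially. passes_at (zs n) y 0"
    and "\<And>y y' s. y \<in> grid_levels \<Longrightarrow> y' \<in> grid_levels \<Longrightarrow> passes_at z y s \<Longrightarrow> passes_at z y' s \<Longrightarrow>
        \<forall>\<^sub>F n in sequentially. \<exists>s'. passes_at (zs n) y s' \<and> passes_at (zs n) y' s'"
    and "\<And>y T. y \<in> grid_levels \<Longrightarrow> \<forall>t\<ge>0. z t < y \<Longrightarrow>
        \<forall>\<^sub>F n in sequentially. \<forall>t\<in>{0..T}. zs n t < y"
  shows "J1_converges (\<lambda>n. real_path (zs n)) (real_path z)"
proof (rule J1_convergesI)
  fix \<epsilon> T :: real assume "0 < \<epsilon>" "0 \<le> T"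
  from level_paths_matched[OF assms this]
  show "\<forall>\<^sub>F n in sequentially. \<exists>\<sigma>\<in>time_changes. (\<forall>t\<ge>0. \<bar>\<sigma> t - t\<bar> \<le> \<epsilon>) \<and>
        (\<forall>t\<in>{0..T}. \<bar>real_path (zs n) (\<sigma> t) - real_path z t\<bar> \<le> \<epsilon>)"
  proof (rule eventually_mono)
    fix n
    assume "\<exists>\<sigma>\<in>time_changes. (\<forall>t\<ge>0. \<bar>\<sigma> t - t\<bar> \<le> \<epsilon>) \<and>
      (\<forall>t\<in>{0..T}. \<bar>real_of_ereal (zs n (\<sigma> t)) - real_of_ereal (z t)\<bar> \<le> \<epsilon>)"
    then obtain \<sigma> where \<sigma>: "\<sigma> \<in> time_changes" "\<forall>t\<ge>0. \<bar>\<sigma> t - t\<bar> \<le> \<epsilon>"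
      "\<forall>t\<in>{0..T}. \<bar>real_of_ereal (zs n (\<sigma> t)) - real_of_ereal (z t)\<bar> \<le> \<epsilon>" by blast
    show "\<exists>\<sigma>\<in>time_changes. (\<forall>t\<ge>0. \<bar>\<sigma> t - t\<bar> \<le> \<epsilon>) \<and>
        (\<forall>t\<in>{0..T}. \<bar>real_path (zs n) (\<sigma> t) - real_path z t\<bar> \<le> \<epsilon>)"
    proof (intro bexI[OF _ \<sigma>(1)] conjI \<sigma>(2) ballI)
      fix t assume t: "t \<in> {0..T}"
      have "real_path (zs n) (\<sigma> t) = real_of_ereal (zs n (\<sigma> t))" "real_path z t = real_of_ereal (z t)"
        using t time_change_nonneg[OF \<sigma>(1)] by (simp_all add: real_path_def)
      then show "\<bar>real_path (zs n) (\<sigma> t) - real_path z t\<bar> \<le> \<epsilon>" using \<sigma>(3) t by simp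
    qed
  qed
qed

text \<open>
  Reading a path at the right end point of the current cell \<open>[k / n, (k + 1) / n)\<close> shifts all passage
  times by the same rule \<open>s \<mapsto> (\<lceil>n s\<rceil> - 1) / n\<close>, so that equal passage times remain equal.
\<close>
lemma passes_at_sampled:
  assumes "passes_at z y s" "0 < n"
  shows "passes_at (\<lambda>t. z ((real (nat \<lfloor>real n * t\<rfloor>) + 1) / real n)) y
           (max 0 ((real_of_int \<lceil>real n * s\<rceil> - 1) / real n))"
  unfolding passes_at_def
proof (intro conjI allI impI)
  fix t :: real assume t: "0 \<le> t"
  have n: "0 < real n" using assms(2) by simp
  have floor0: "0 \<le> \<lfloor>real n * t\<rfloor>" using t by simp
  have "y \<le> z ((real (nat \<lfloor>real n * t\<rfloor>) + 1) / real n) \<longleftrightarrow> s \<le> (real (nat \<lfloor>real n * t\<rfloor>) + 1) / real n"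
    using assms(1) by (simp add: passes_at_def)
  also have "\<dots> \<longleftrightarrow> real n * s \<le> real_of_int (\<lfloor>real n * t\<rfloor> + 1)"
    using n floor0 by (simp add: pos_le_divide_eq mult.commute)
  also have "\<dots> \<longleftrightarrow> \<lceil>real n * s\<rceil> - 1 \<le> \<lfloor>real n * t\<rfloor>" by (simp only: ceiling_le_iff[symmetric]) linarith
  also have "\<dots> \<longleftrightarrow> real_of_int \<lceil>real n * s\<rceil> - 1 \<le> real n * t" by (simp add: le_floor_iff)
  also have "\<dots> \<longleftrightarrow> (real_of_int \<lceil>real n * s\<rceil> - 1) / real n \<le> t"
    using n by (simp add: pos_divide_le_eq mult.commute)
  also have "\<dots> \<longleftrightarrow> max 0 ((real_of_int \<lceil>real n * s\<rceil> - 1) / real n) \<le> t" using t by simp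
  finally show "y \<le> z ((real (nat \<lfloor>real n * t\<rfloor>) + 1) / real n) \<longleftrightarrow>
      max 0 ((real_of_int \<lceil>real n * s\<rceil> - 1) / real n) \<le> t" .
qed simp

lemma sampled_passage_time_close:
  assumes "0 \<le> s" "0 < n"
  shows "\<bar>max 0 ((real_of_int \<lceil>real n * s\<rceil> - 1) / real n) - s\<bar> \<le> 1 / real n"
proof -
  have n: "0 < real n" using assms(2) by simp
  have "real n * s \<le> real_of_int \<lceil>real n * s\<rceil>" "real_of_int \<lceil>real n * s\<rceil> - 1 \<le> real n * s" by linarith+
  then have "s \<le> real_of_int \<lceil>real n * s\<rceil> / real n" "(real_of_int \<lceil>real n * s\<rceil> - 1) / real n \<le> s"
    using n by (simp_all add: pos_le_divide_eq pos_divide_le_eq mult.commute)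
  then show ?thesis using assms(1) by (simp add: diff_divide_distrib abs_le_iff max_def)
qed

lemma sampled_paths_J1_converge:
  assumes z: "level_path z"
  shows "J1_converges (\<lambda>n. real_path (\<lambda>t. z ((real (nat \<lfloor>real n * t\<rfloor>) + 1) / real n))) (real_path z)"
proof (rule level_paths_J1_converge[OF z])
  have ev: "\<forall>\<^sub>F n::nat in sequentially. 0 < n" by (rule eventually_gt_at_top)
  show "0 \<le> z ((real (nat \<lfloor>real n * t\<rfloor>) + 1) / real n)" for n :: nat and t
    by (rule level_path_nonneg[OF z]) simp
  show "\<forall>\<^sub>F n in sequentially. \<exists>s'. passes_at (\<lambda>t. z ((real (nat \<lfloor>real n * t\<rfloor>) + 1) / real n)) y s'
      \<and> \<bar>s' - s\<bar> < e" if y: "passes_at z y s" and e: "0 < e" for y s e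
  proof -
    have s: "0 \<le> s" using y by (simp add: passes_at_def)
    have "(\<lambda>n. 1 / real n) \<longlonglongrightarrow> 0" by real_asymp
    from order_tendstoD(2)[OF this e] ev show ?thesis
    proof eventually_elim
      case (elim n)
      have "\<bar>max 0 ((real_of_int \<lceil>real n * s\<rceil> - 1) / real n) - s\<bar> < e"
        using sampled_passage_time_close[OF s elim(2)] elim(1) by linarith
      with passes_at_sampled[OF y elim(2)] show ?case by (intro exI conjI)
    qed
  qed
  show "\<forall>\<^sub>F n in sequentially. passes_at (\<lambda>t. z ((real (nat \<lfloor>real n * t\<rfloor>) + 1) / real n)) y 0"
    if y: "passes_at z y 0" for y
    using ev
  proof eventually_elim
    case (elim n)
    from passes_at_sampled[OF y elim] show ?case using elim by simp
  qed
  show "\<forall>\<^sub>F n in sequentially. \<exists>s'. passes_at (\<lambda>t. z ((real (nat \<lfloor>real n * t\<rfloor>) + 1) / real n)) y s'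
      \<and> passes_at (\<lambda>t. z ((real (nat \<lfloor>real n * t\<rfloor>) + 1) / real n)) y' s'"
    if y: "passes_at z y s" and y': "passes_at z y' s" for y y' s
    using ev
  proof eventually_elim
    case (elim n)
    show ?case by (intro exI conjI) (rule passes_at_sampled[OF y elim], rule passes_at_sampled[OF y' elim])
  qed
  show "\<forall>\<^sub>F n in sequentially. \<forall>t\<in>{0..T}. z ((real (nat \<lfloor>real n * t\<rfloor>) + 1) / real n) < y"
    if "\<forall>t\<ge>0. z t < y" for y T
    using that by (intro always_eventually) simp
qed

section \<open>Measurability with respect to the Borel sets of the Skorokhod space\<close>

text \<open>
  If countably many events determine the path up to convergence, then every point of the preimage of
  an open set has a neighbourhood in that preimage that is fixed by finitely many of the events, and
  there are only countably many such neighbourhoods.  The events may come from discontinuous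
  functionals of the path, which makes it easy to provide enough of them.
\<close>
lemma measurable_skorokhod_J1I:
  fixes Y :: "'b \<Rightarrow> real \<Rightarrow> real"
  assumes \<A>: "countable \<A>" "\<A> \<subseteq> sets Q"
    and Y: "\<And>\<omega>. \<omega> \<in> space Q \<Longrightarrow> Y \<omega> \<in> skorokhod_space"
    and conv: "\<And>\<omega> \<omega>s. \<omega> \<in> space Q \<Longrightarrow> (\<And>n. \<omega>s n \<in> space Q) \<Longrightarrow>
      (\<And>A. A \<in> \<A> \<Longrightarrow> \<forall>\<^sub>F n in sequentially. \<omega>s n \<in> A \<longleftrightarrow> \<omega> \<in> A) \<Longrightarrow>
      J1_converges (\<lambda>n. Y (\<omega>s n)) (Y \<omega>)"
  shows "Y \<in> measurable Q (borel_algebra_of skorokhod_J1)"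
  unfolding borel_algebra_of_def
proof (rule measurable_sigma_sets[OF sets_measure_of])
  show "{U. openin skorokhod_J1 U} \<subseteq> Pow (topspace skorokhod_J1)" by (auto dest: openin_subset)
  then show "{U. openin skorokhod_J1 U} \<subseteq> Pow (topspace skorokhod_J1)" .
  show "Y \<in> space Q \<rightarrow> topspace skorokhod_J1" using Y by (simp add: topspace_skorokhod_J1)
next
  fix U assume "U \<in> {U. openin skorokhod_J1 U}"
  then have U: "openin skorokhod_J1 U" by simp
  define E where "E = from_nat_into (insert (space Q) \<A>)"
  have E: "E i \<in> sets Q" for i
    unfolding E_def using from_nat_into[of "insert (space Q) \<A>" i] \<A>(2) by auto
  have E_surj: "\<exists>i. E i = A" if "A \<in> \<A>" for A
    unfolding E_def using from_nat_into_surj[of "insert (space Q) \<A>" A] that \<A>(1) by auto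
  \<comment> \<open>The points at which the first \<open>k\<close> events show the pattern \<open>s\<close>.\<close>
  define cell where "cell k s = {\<omega> \<in> space Q. \<forall>i<k. \<omega> \<in> E i \<longleftrightarrow> i \<in> s}" for k :: nat and s
  have [measurable]: "\<And>i. E i \<in> sets Q" by (rule E)
  have cell_sets: "cell k s \<in> sets Q" for k s
    unfolding cell_def by measurable
  define J where "J = {(k, s). s \<subseteq> {..<k} \<and> cell k s \<subseteq> Y -` U}"
  have "J \<subseteq> Sigma UNIV (\<lambda>k. Pow {..<k})" by (auto simp: J_def)
  moreover have "countable (Sigma (UNIV :: nat set) (\<lambda>k. Pow {..<k}))"
    by (rule countable_SIGMA) (auto intro: countable_finite)
  ultimately have J: "countable J" by (rule countable_subset)
  have "Y -` U \<inter> space Q = (\<Union>(k, s)\<in>J. cell k s)"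
  proof (intro equalityI subsetI)
    fix \<omega> assume \<omega>: "\<omega> \<in> Y -` U \<inter> space Q"
    define s where "s k = {i. i < k \<and> \<omega> \<in> E i}" for k
    have "\<exists>k. cell k (s k) \<subseteq> Y -` U"
    \<comment> \<open>Otherwise there are \<open>\<omega>s k\<close> outside that agree with \<open>\<omega>\<close> on the first \<open>k\<close> events.\<close>
    proof (rule ccontr)
      assume "\<nexists>k. cell k (s k) \<subseteq> Y -` U"
      then have "\<forall>k. \<exists>\<omega>'. \<omega>' \<in> cell k (s k) \<and> Y \<omega>' \<notin> U" by blast
      then obtain \<omega>s where \<omega>s: "\<And>k. \<omega>s k \<in> cell k (s k)" "\<And>k. Y (\<omega>s k) \<notin> U" by metis
      have "J1_converges (\<lambda>n. Y (\<omega>s n)) (Y \<omega>)"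
      proof (rule conv)
        show "\<omega> \<in> space Q" using \<omega> by simp
        show "\<omega>s n \<in> space Q" for n using \<omega>s(1)[of n] by (simp add: cell_def)
        fix A assume "A \<in> \<A>"
        then obtain i where i: "E i = A" using E_surj by blast
        have "\<forall>\<^sub>F n in sequentially. i < n" by (rule eventually_gt_at_top)
        then show "\<forall>\<^sub>F n in sequentially. \<omega>s n \<in> A \<longleftrightarrow> \<omega> \<in> A"
        proof eventually_elim
          case (elim n)
          then show ?case using \<omega>s(1)[of n] i by (auto simp: cell_def s_def)
        qed
      qed
      moreover have "\<forall>n. Y (\<omega>s n) \<in> skorokhod_space"
        using \<omega>s(1) Y by (simp add: cell_def)
      moreover have "Y \<omega> \<in> U" using \<omega> by simp
      ultimately have "\<forall>\<^sub>F n in sequentially. Y (\<omega>s n) \<in> U"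
        using mp[OF spec[OF bspec[OF conjunct2[OF iffD1[OF openin_skorokhod_J1 U]], of "Y \<omega>"], of "\<lambda>n. Y (\<omega>s n)"]]
        by simp
      then show False using \<omega>s(2) by simp
    qed
    then obtain k where "cell k (s k) \<subseteq> Y -` U" by blast
    then have "(k, s k) \<in> J" by (auto simp: J_def s_def)
    moreover have "\<omega> \<in> cell k (s k)" using \<omega> by (simp add: cell_def s_def)
    ultimately show "\<omega> \<in> (\<Union>(k, s)\<in>J. cell k s)" by blast
  next
    fix \<omega> assume "\<omega> \<in> (\<Union>(k, s)\<in>J. cell k s)"
    then show "\<omega> \<in> Y -` U \<inter> space Q" by (auto simp: J_def cell_def)
  qed
  also have "\<dots> \<in> sets Q"
    using J cell_sets by (intro sets.countable_UN') auto
  finally show "Y -` U \<inter> space Q \<in> sets Q" .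
qed

text \<open>
  For nondecreasing paths suitable events are: a level is reached by a rational time, and the path
  stays between two levels at some rational time.  The second kind decides whether two levels are
  passed simultaneously.
\<close>
lemma level_paths_measurable:
  fixes Z :: "'b \<Rightarrow> real \<Rightarrow> ereal"
  assumes Z: "\<And>\<omega>. \<omega> \<in> space Q \<Longrightarrow> level_path (Z \<omega>)"
    and meas: "\<And>y t. 0 < y \<Longrightarrow> 0 \<le> t \<Longrightarrow> {\<omega> \<in> space Q. y \<le> Z \<omega> t} \<in> sets Q"
  shows "(\<lambda>\<omega>. real_path (Z \<omega>)) \<in> measurable Q (borel_algebra_of skorokhod_J1)"
proof -
  define T where "T = {t \<in> \<rat>. (0::real) \<le> t}"
  have T: "countable T" unfolding T_def using countable_rat by (rule countable_subset[rotated]) auto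
  have T0: "0 \<le> t" if "t \<in> T" for t using that by (simp add: T_def)
  have dense: "\<exists>t\<in>T. a < t \<and> t < b" if "0 \<le> a" "a < b" for a b
    using Rats_dense_in_real[OF that(2)] that(1) by (force simp: T_def)
  define reach where "reach = (\<lambda>(y, t). {\<omega> \<in> space Q. y \<le> Z \<omega> t})"
  define between where "between = (\<lambda>(y, y'). {\<omega> \<in> space Q. \<exists>t\<in>T. y \<le> Z \<omega> t \<and> Z \<omega> t < y'})"
  define \<A> where "\<A> = reach ` (grid_levels \<times> T) \<union> between ` (grid_levels \<times> grid_levels)"
  have "between (y, y') = (\<Union>t\<in>T. reach (y, t) - reach (y', t))" for y y'
    by (auto simp: between_def reach_def not_le)
  moreover have "reach (y, t) \<in> sets Q" if "y \<in> grid_levels" "t \<in> T" for y t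
    using meas[OF grid_levels_pos[OF that(1)] T0[OF that(2)]] by (simp add: reach_def)
  ultimately have "\<A> \<subseteq> sets Q"
    unfolding \<A>_def using T by (auto intro!: sets.countable_UN' sets.Diff)
  moreover have "countable \<A>"
    unfolding \<A>_def using T countable_grid_levels by auto
  ultimately show ?thesis
  proof (intro measurable_skorokhod_J1I)
    show "real_path (Z \<omega>) \<in> skorokhod_space" if "\<omega> \<in> space Q" for \<omega>
      by (rule real_path_in_skorokhod_space[OF Z[OF that]])
  next
    fix \<omega> \<omega>s
    assume \<omega>: "\<omega> \<in> space Q" and \<omega>s: "\<And>n. \<omega>s n \<in> space Q"
      and agree: "\<And>A. A \<in> \<A> \<Longrightarrow> \<forall>\<^sub>F n in sequentially. \<omega>s n \<in> A \<longleftrightarrow> \<omega> \<in> A"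
    have reach: "\<forall>\<^sub>F n in sequentially. y \<le> Z (\<omega>s n) t \<longleftrightarrow> y \<le> Z \<omega> t"
      if "y \<in> grid_levels" "t \<in> T" for y t
    proof -
      have "reach (y, t) \<in> \<A>" using that by (auto simp: \<A>_def)
      from agree[OF this] show ?thesis using \<omega> \<omega>s by (simp add: reach_def)
    qed
    have between: "\<forall>\<^sub>F n in sequentially. (\<exists>t\<in>T. y \<le> Z (\<omega>s n) t \<and> Z (\<omega>s n) t < y') \<longleftrightarrow>
        (\<exists>t\<in>T. y \<le> Z \<omega> t \<and> Z \<omega> t < y')"
      if "y \<in> grid_levels" "y' \<in> grid_levels" for y y'
    proof -
      have "between (y, y') \<in> \<A>" using that by (auto simp: \<A>_def)
      from agree[OF this] show ?thesis using \<omega> \<omega>s by (simp add: between_def)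
    qed
    have pass: "\<forall>\<^sub>F n in sequentially. \<exists>s'. passes_at (Z (\<omega>s n)) y s' \<and> \<bar>s' - s\<bar> < e"
      if y: "y \<in> grid_levels" and s: "passes_at (Z \<omega>) y s" and e: "0 < e" for y s e
    proof -
      have s0: "0 \<le> s" using s by (simp add: passes_at_def)
      obtain u where u: "u \<in> T" "s < u" "u < s + e" using dense[of s "s + e"] s0 e by auto
      have yu: "y \<le> Z \<omega> u" using s u(2) T0[OF u(1)] by (simp add: passes_at_def)
      have low: "\<forall>\<^sub>F n in sequentially. \<forall>s'. passes_at (Z (\<omega>s n)) y s' \<longrightarrow> s - e < s'"
      proof (cases "s = 0")
        case True
        then show ?thesis using e by (intro always_eventually) (auto simp: passes_at_def)
      next
        case False
        then obtain v where v: "v \<in> T" "max 0 (s - e) < v" "v < s"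
          using dense[of "max 0 (s - e)" s] s0 e by auto
        have nv: "\<not> y \<le> Z \<omega> v" using s v(3) T0[OF v(1)] by (simp add: passes_at_def)
        from reach[OF y v(1)] show ?thesis
        proof eventually_elim
          case (elim n)
          show ?case
          proof (intro allI impI)
            fix s' assume "passes_at (Z (\<omega>s n)) y s'"
            then have "\<not> s' \<le> v" using elim nv T0[OF v(1)] by (simp add: passes_at_def)
            then show "s - e < s'" using v(2) by simp
          qed
        qed
      qed
      from reach[OF y u(1)] low show ?thesis
      proof eventually_elim
        case (elim n)
        have yn: "y \<le> Z (\<omega>s n) u" using elim(1) yu by simp
        from level_path_cases[OF Z[OF \<omega>s[of n]] grid_levels_pos[OF y]]
        obtain s' where s': "passes_at (Z (\<omega>s n)) y s'"
          using yn T0[OF u(1)] by (metis leD)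
        then have "s' \<le> u" using yn T0[OF u(1)] by (simp add: passes_at_def)
        moreover have "s - e < s'" using elim(2) s' by blast
        ultimately show ?case using s' u(3) by (intro exI[of _ s']) auto
      qed
    qed
    show "J1_converges (\<lambda>n. real_path (Z (\<omega>s n))) (real_path (Z \<omega>))"
    proof (rule level_paths_J1_converge[OF Z[OF \<omega>]])
      show "0 \<le> Z (\<omega>s n) t" if "0 \<le> t" for n t by (rule level_path_nonneg[OF Z[OF \<omega>s] that])
      show "\<forall>\<^sub>F n in sequentially. \<exists>s'. passes_at (Z (\<omega>s n)) y s' \<and> \<bar>s' - s\<bar> < e"
        if "y \<in> grid_levels" "passes_at (Z \<omega>) y s" "0 < e" for y s e by (rule pass[OF that])
    next
      fix y assume y: "y \<in> grid_levels" "passes_at (Z \<omega>) y 0"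
      have "0 \<in> T" by (simp add: T_def)
      from reach[OF y(1) this]
      show "\<forall>\<^sub>F n in sequentially. passes_at (Z (\<omega>s n)) y 0"
      proof eventually_elim
        case (elim n)
        have "y \<le> Z (\<omega>s n) 0" using elim y(2) by (simp add: passes_at_def)
        then show ?case
          using level_path_mono[OF Z[OF \<omega>s[of n]], of 0] by (auto simp: passes_at_def intro: order_trans)
      qed
    next
      have equal: "\<forall>\<^sub>F n in sequentially. \<exists>s'. passes_at (Z (\<omega>s n)) y s' \<and> passes_at (Z (\<omega>s n)) y' s'"
        if y: "y \<in> grid_levels" "y' \<in> grid_levels" "y \<le> y'"
          and s: "passes_at (Z \<omega>) y s" "passes_at (Z \<omega>) y' s" for y y' s
      proof -
        have none: "\<not> (\<exists>t\<in>T. y \<le> Z \<omega> t \<and> Z \<omega> t < y')"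
          using s T0 unfolding passes_at_def by (meson leD)
        from pass[OF y(1) s(1) zero_less_one] pass[OF y(2) s(2) zero_less_one] between[OF y(1,2)]
        show ?thesis
        proof eventually_elim
          case (elim n)
          then obtain r r' where r: "passes_at (Z (\<omega>s n)) y r" "passes_at (Z (\<omega>s n)) y' r'" by blast
          have "0 \<le> r" "0 \<le> r'" using r by (auto simp: passes_at_def)
          moreover have "y' \<le> Z (\<omega>s n) r'" using r(2) \<open>0 \<le> r'\<close> by (simp add: passes_at_def)
          then have "r \<le> r'" using r(1) y(3) \<open>0 \<le> r'\<close> unfolding passes_at_def by (meson order_trans)
          moreover have "\<not> r < r'"
          proof
            assume "r < r'"
            then obtain t where t: "t \<in> T" "r < t" "t < r'" using dense \<open>0 \<le> r\<close> by blast
            then have "y \<le> Z (\<omega>s n) t" "\<not> y' \<le> Z (\<omega>s n) t"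
              using r T0[OF t(1)] by (auto simp: passes_at_def)
            then show False using elim(3) none t(1) not_le by blast
          qed
          ultimately have "r = r'" by simp
          then show ?case using r by blast
        qed
      qed
      show "\<forall>\<^sub>F n in sequentially. \<exists>s'. passes_at (Z (\<omega>s n)) y s' \<and> passes_at (Z (\<omega>s n)) y' s'"
        if y: "y \<in> grid_levels" "y' \<in> grid_levels"
          and s: "passes_at (Z \<omega>) y s" "passes_at (Z \<omega>) y' s" for y y' s
      proof (cases "y \<le> y'")
        case True
        from equal[OF y True s] show ?thesis .
      next
        case False
        then have "y' \<le> y" by simp
        from equal[OF y(2,1) this s(2,1)] show ?thesis by (rule eventually_mono) blast
      qed
    next
      fix y and r :: real assume y: "y \<in> grid_levels" "\<forall>t\<ge>0. Z \<omega> t < y"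
      define u where "u = real (nat \<lceil>r\<rceil>)"
      have u: "u \<in> T" "r \<le> u" "0 \<le> u" by (auto simp: T_def u_def) linarith
      from reach[OF y(1) u(1)]
      show "\<forall>\<^sub>F n in sequentially. \<forall>t\<in>{0..r}. Z (\<omega>s n) t < y"
      proof eventually_elim
        case (elim n)
        have "\<not> y \<le> Z \<omega> u" using y(2) u(3) by (simp add: not_le)
        then have "Z (\<omega>s n) u < y" using elim by (meson not_le)
        show ?case
        proof
          fix t assume "t \<in> {0..r}"
          then have "0 \<le> t" "t \<le> u" using u(2) by auto
          then have "Z (\<omega>s n) t \<le> Z (\<omega>s n) u" by (rule level_path_mono[OF Z[OF \<omega>s]])
          then show "Z (\<omega>s n) t < y" using \<open>Z (\<omega>s n) u < y\<close> by (rule le_less_trans)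
        qed
      qed
    qed
  qed
qed

section \<open>Step paths and transfer of convergence\<close>

definition step_path :: "nat \<Rightarrow> (nat \<Rightarrow> real) \<Rightarrow> real \<Rightarrow> real" where
  "step_path n u = (\<lambda>t\<in>{0..}. u (nat \<lfloor>real n * t\<rfloor>))"

lemma step_path_in_skorokhod_space: "step_path n u \<in> skorokhod_space"
  unfolding skorokhod_space_def mem_Collect_eq
proof (intro conjI allI impI)
  show "step_path n u \<in> extensional {0..}" by (simp add: step_path_def)
next
  fix t :: real assume t: "0 \<le> t"
  have "\<forall>\<^sub>F s in at_right t. \<lfloor>real n * s\<rfloor> = \<lfloor>real n * t\<rfloor>"
  proof (cases "n = 0")
    case False
    then have n: "0 < real n" by simp
    have "t < (real_of_int \<lfloor>real n * t\<rfloor> + 1) / real n"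
      using n by (simp add: pos_less_divide_eq mult.commute)
    then have "\<forall>\<^sub>F s in at_right t. s < (real_of_int \<lfloor>real n * t\<rfloor> + 1) / real n"
      by (auto simp: eventually_at_right_field)
    moreover have "\<forall>\<^sub>F s in at_right t. t < s" by (rule eventually_at_right_less)
    ultimately show ?thesis
    proof eventually_elim
      case (elim s)
      have "real n * s < real_of_int \<lfloor>real n * t\<rfloor> + 1"
        using elim(1) n by (simp add: pos_less_divide_eq mult.commute)
      moreover have "real n * t \<le> real n * s" using elim(2) n by simp
      ultimately show ?case by linarith
    qed
  qed simp
  moreover have "\<forall>\<^sub>F s in at_right t. t < s" by (rule eventually_at_right_less)
  ultimately have "\<forall>\<^sub>F s in at_right t. step_path n u s = step_path n u t"
    by eventually_elim (use t in \<open>simp add: step_path_def\<close>)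
  then show "(step_path n u \<longlongrightarrow> step_path n u t) (at_right t)" by (rule tendsto_eventually)
next
  fix t :: real assume t: "0 < t"
  have "\<forall>\<^sub>F s in at_left t. \<lfloor>real n * s\<rfloor> = \<lceil>real n * t\<rceil> - 1 \<or> n = 0"
  proof (cases "n = 0")
    case False
    then have n: "0 < real n" by simp
    have "(real_of_int \<lceil>real n * t\<rceil> - 1) / real n < t"
      using n by (simp add: pos_divide_less_eq mult.commute) linarith
    then have "\<forall>\<^sub>F s in at_left t. (real_of_int \<lceil>real n * t\<rceil> - 1) / real n < s"
      by (auto simp: eventually_at_left_field)
    moreover have "\<forall>\<^sub>F s in at_left t. s < t" by (simp add: eventually_at_left_field lt_ex)
    ultimately show ?thesis
    proof eventually_elim
      case (elim s)
      have "real_of_int \<lceil>real n * t\<rceil> - 1 < real n * s"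
        using elim(1) n by (simp add: pos_divide_less_eq mult.commute)
      moreover have "real n * s < real n * t" using elim(2) n by simp
      ultimately have "\<lfloor>real n * s\<rfloor> = \<lceil>real n * t\<rceil> - 1" by linarith
      then show ?case by simp
    qed
  qed simp
  moreover have "\<forall>\<^sub>F s in at_left t. 0 < s" using t by (auto simp: eventually_at_left_field)
  ultimately have "\<forall>\<^sub>F s in at_left t. step_path n u s = u (if n = 0 then 0 else nat (\<lceil>real n * t\<rceil> - 1))"
    by eventually_elim (auto simp: step_path_def)
  then show "\<exists>l. (step_path n u \<longlongrightarrow> l) (at_left t)"
    by (intro exI) (rule tendsto_eventually)
qed

lemma step_path_J1_converges:
  assumes "\<And>k. (\<lambda>i. us i k) \<longlonglongrightarrow> u k"
  shows "J1_converges (\<lambda>i. step_path n (us i)) (step_path n u)"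
proof (rule J1_converges_locally_uniform)
  fix \<epsilon> T :: real assume \<epsilon>: "0 < \<epsilon>" and T: "0 \<le> T"
  have "\<forall>\<^sub>F i in sequentially. \<forall>k\<in>{..nat \<lfloor>real n * T\<rfloor>}. dist (us i k) (u k) < \<epsilon>"
    using tendstoD[OF assms \<epsilon>] by (intro eventually_ball_finite) auto
  then show "\<forall>\<^sub>F i in sequentially. \<forall>t\<in>{0..T}. \<bar>step_path n (us i) t - step_path n u t\<bar> \<le> \<epsilon>"
  proof eventually_elim
    case (elim i)
    show ?case
    proof
      fix t assume t: "t \<in> {0..T}"
      then have "real n * t \<le> real n * T" by (simp add: mult_left_mono)
      then have "nat \<lfloor>real n * t\<rfloor> \<in> {..nat \<lfloor>real n * T\<rfloor>}" by (simp add: floor_mono nat_mono)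
      with elim have "dist (us i (nat \<lfloor>real n * t\<rfloor>)) (u (nat \<lfloor>real n * t\<rfloor>)) < \<epsilon>" by blast
      then show "\<bar>step_path n (us i) t - step_path n u t\<bar> \<le> \<epsilon>"
        using t by (simp add: step_path_def dist_real_def)
    qed
  qed
qed

lemma open_step_path_vimage:
  assumes U: "openin skorokhod_J1 U"
  shows "open {u. step_path n u \<in> U}"
proof -
  have "closed {u. step_path n u \<notin> U}"
    unfolding closed_sequential_limits
  proof (intro allI impI)
    fix x :: "nat \<Rightarrow> nat \<Rightarrow> real" and l assume x: "(\<forall>i. x i \<in> {u. step_path n u \<notin> U}) \<and> x \<longlonglongrightarrow> l"
    have "(\<lambda>i. x i k) \<longlonglongrightarrow> l k" for k
      using continuous_on_tendsto_compose[OF continuous_on_product_coordinates[of k], of x l sequentially] x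
      by simp
    then have conv: "J1_converges (\<lambda>i. step_path n (x i)) (step_path n l)"
      by (rule step_path_J1_converges)
    have "step_path n l \<notin> U"
    proof
      assume "step_path n l \<in> U"
      from mp[OF spec[OF bspec[OF conjunct2[OF iffD1[OF openin_skorokhod_J1 U]] this]]
          conjI[OF allI[OF step_path_in_skorokhod_space] conv]]
      show False using x by simp
    qed
    then show "l \<in> {u. step_path n u \<notin> U}" by simp
  qed
  moreover have "{u. step_path n u \<notin> U} = - {u. step_path n u \<in> U}" by auto
  ultimately show ?thesis by (simp add: closed_def)
qed

lemma continuous_on_step_path:
  fixes F :: "(real \<Rightarrow> real) \<Rightarrow> real"
  assumes F: "continuous_map skorokhod_J1 euclideanreal F"
  shows "continuous_on UNIV (\<lambda>u. F (step_path n u))"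
  unfolding continuous_on_open_vimage[OF open_UNIV]
proof (intro allI impI)
  fix B :: "real set" assume "open B"
  then have "openin euclideanreal B" using open_openin by blast
  from open_step_path_vimage[OF openin_continuous_map_preimage[OF F this], of n]
  show "open ((\<lambda>u. F (step_path n u)) -` B \<inter> UNIV)"
    by (simp add: topspace_skorokhod_J1 step_path_in_skorokhod_space vimage_def)
qed

lemma step_path_measurable:
  assumes u: "u \<in> borel_measurable M"
  shows "(\<lambda>\<omega>. step_path n (u \<omega>)) \<in> measurable M (borel_algebra_of skorokhod_J1)"
  unfolding borel_algebra_of_def
proof (rule measurable_sigma_sets[OF sets_measure_of])
  show "{U. openin skorokhod_J1 U} \<subseteq> Pow (topspace skorokhod_J1)" by (auto dest: openin_subset)
  then show "{U. openin skorokhod_J1 U} \<subseteq> Pow (topspace skorokhod_J1)" .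
  show "(\<lambda>\<omega>. step_path n (u \<omega>)) \<in> space M \<rightarrow> topspace skorokhod_J1"
    by (simp add: topspace_skorokhod_J1 step_path_in_skorokhod_space)
  fix U assume "U \<in> {U. openin skorokhod_J1 U}"
  then have "{v. step_path n v \<in> U} \<in> sets borel" by (simp add: open_step_path_vimage)
  from measurable_sets[OF u this]
  show "(\<lambda>\<omega>. step_path n (u \<omega>)) -` U \<inter> space M \<in> sets M" by (simp add: vimage_def)
qed

text \<open>
  Perturbed paths chosen to violate the conclusion would converge to the same limit \<open>x\<close> as the
  unperturbed ones, and this contradicts continuity of \<open>F\<close> at \<open>x\<close>.  The argument replaces the uniform
  continuity that \<open>F\<close> may lack.
\<close>
lemma eventually_insensitive:
  fixes F :: "(real \<Rightarrow> real) \<Rightarrow> real" and \<kappa> :: "nat \<Rightarrow> nat"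
  assumes F: "continuous_map skorokhod_J1 euclideanreal F"
    and conv: "J1_converges (\<lambda>n. step_path n (a n)) x" and x: "x \<in> skorokhod_space"
    and \<kappa>: "filterlim \<kappa> at_top sequentially" and e: "0 < e"
  shows "\<forall>\<^sub>F n in sequentially. \<forall>b. (\<forall>k\<le>n * \<kappa> n. \<bar>a n k - b k\<bar> < 1 / Suc (\<kappa> n)) \<longrightarrow>
           \<bar>F (step_path n b) - F (step_path n (a n))\<bar> \<le> e"
proof -
  define bad where "bad n b \<longleftrightarrow> (\<forall>k\<le>n * \<kappa> n. \<bar>a n k - b k\<bar> < 1 / Suc (\<kappa> n)) \<and>
      \<not> \<bar>F (step_path n b) - F (step_path n (a n))\<bar> \<le> e" for n b
  \<comment> \<open>Take a violating perturbation whenever there is one.\<close>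
  define b where "b n = (if \<exists>b. bad n b then SOME b. bad n b else a n)" for n
  have b_bad: "bad n (b n)" if "bad n c" for n c
  proof -
    have "\<exists>b. bad n b" using that by blast
    then show ?thesis unfolding b_def by (simp add: someI_ex)
  qed
  have b_close: "\<bar>a n k - b n k\<bar> \<le> 1 / Suc (\<kappa> n)" if "k \<le> n * \<kappa> n" for n k
  proof (cases "\<exists>c. bad n c")
    case True
    then have "bad n (b n)" using b_bad by blast
    then show ?thesis using that by (auto simp: bad_def less_imp_le)
  qed (simp add: b_def)
  have "J1_converges (\<lambda>n. step_path n (b n)) x"
  proof (rule J1_converges_perturbation[OF conv])
    fix \<epsilon> T :: real assume \<epsilon>: "0 < \<epsilon>" and T: "0 \<le> T"
    obtain m where m: "1 / real (Suc m) < \<epsilon>"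
      using reals_Archimedean[OF \<epsilon>] by (auto simp: inverse_eq_divide)
    have "\<forall>\<^sub>F n in sequentially. max m (nat \<lceil>T\<rceil>) \<le> \<kappa> n" using \<kappa> by (simp only: filterlim_at_top)
    then show "\<forall>\<^sub>F n in sequentially. \<forall>t\<in>{0..T}. \<bar>step_path n (b n) t - step_path n (a n) t\<bar> \<le> \<epsilon>"
    proof eventually_elim
      case (elim n)
      show ?case
      proof
        fix t assume t: "t \<in> {0..T}"
        have "t \<le> real (\<kappa> n)" using t elim by simp
        then have "real n * t \<le> real (n * \<kappa> n)" by (simp add: mult_left_mono)
        then have "nat \<lfloor>real n * t\<rfloor> \<le> n * \<kappa> n" by linarith
        from b_close[OF this]
        have "\<bar>step_path n (b n) t - step_path n (a n) t\<bar> \<le> 1 / Suc (\<kappa> n)"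
          using t by (simp add: step_path_def abs_minus_commute)
        also have "\<dots> \<le> 1 / real (Suc m)" using elim by (intro divide_left_mono) auto
        finally show "\<bar>step_path n (b n) t - step_path n (a n) t\<bar> \<le> \<epsilon>" using m by linarith
      qed
    qed
  qed
  from continuous_map_skorokhod_J1_sequentially[OF F step_path_in_skorokhod_space x this]
  have "(\<lambda>n. F (step_path n (b n))) \<longlonglongrightarrow> F x" .
  from tendsto_diff[OF this continuous_map_skorokhod_J1_sequentially[OF F step_path_in_skorokhod_space x conv]]
  have "(\<lambda>n. F (step_path n (b n)) - F (step_path n (a n))) \<longlonglongrightarrow> 0" by simp
  from tendstoD[OF this e] show ?thesis
  proof eventually_elim
    case (elim n)
    then have "\<not> bad n (b n)" by (simp add: bad_def)
    then have "\<not> bad n c" for c using b_bad by blast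
    then show ?case unfolding bad_def by blast
  qed
qed

lemma open_sensitive_set:
  fixes f :: "(nat \<Rightarrow> real) \<Rightarrow> real"
  assumes f: "continuous_on UNIV f"
  shows "open {a. \<exists>b. (\<forall>k\<le>m. \<bar>a k - b k\<bar> < \<delta>) \<and> e < \<bar>f b - f a\<bar>}"
proof -
  have c1: "continuous_on UNIV (\<lambda>p :: (nat \<Rightarrow> real) \<times> (nat \<Rightarrow> real). fst p k)" for k
    by (rule continuous_on_compose2[OF continuous_on_product_coordinates]) (auto intro: continuous_intros)
  have c2: "continuous_on UNIV (\<lambda>p :: (nat \<Rightarrow> real) \<times> (nat \<Rightarrow> real). snd p k)" for k
    by (rule continuous_on_compose2[OF continuous_on_product_coordinates]) (auto intro: continuous_intros)
  have f1: "continuous_on UNIV (\<lambda>p :: (nat \<Rightarrow> real) \<times> (nat \<Rightarrow> real). f (fst p))"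
    by (rule continuous_on_compose2[OF f]) (auto intro: continuous_intros)
  have f2: "continuous_on UNIV (\<lambda>p :: (nat \<Rightarrow> real) \<times> (nat \<Rightarrow> real). f (snd p))"
    by (rule continuous_on_compose2[OF f]) (auto intro: continuous_intros)
  let ?S = "(\<Inter>k\<in>{..m}. {p. \<bar>fst p k - snd p k\<bar> < \<delta>}) \<inter> {p. e < \<bar>f (snd p) - f (fst p)\<bar>}"
  have "open ?S"
    by (intro open_Int open_INT ballI open_Collect_less continuous_intros c1 c2 f1 f2) auto
  then have "open (fst ` ?S)" by (rule open_image_fst)
  moreover have "fst ` ?S = {a. \<exists>b. (\<forall>k\<le>m. \<bar>a k - b k\<bar> < \<delta>) \<and> e < \<bar>f b - f a\<bar>}" (is "_ = ?O")
  proof (intro equalityI subsetI)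
    fix a assume "a \<in> ?O"
    then obtain b where "(\<forall>k\<le>m. \<bar>a k - b k\<bar> < \<delta>) \<and> e < \<bar>f b - f a\<bar>" by blast
    then have "(a, b) \<in> ?S" by simp
    then show "a \<in> fst ` ?S" by (rule rev_image_eqI) simp
  qed auto
  ultimately show ?thesis by simp
qed

text \<open>
  A transfer principle: \<open>u n\<close> lives on \<open>M\<close>, is close to \<open>v n\<close> in probability, and has on the space
  \<open>Q\<close> of the limit a copy \<open>u' n\<close> whose paths converge almost surely.  Sensitivity of \<open>F\<close> at \<open>u n\<close> to
  small perturbations is an open condition on \<open>u n\<close>, hence an event whose probability can be
  computed from the copy.
\<close>
lemma step_paths_integral_tendsto:
  fixes F :: "(real \<Rightarrow> real) \<Rightarrow> real" and u v :: "nat \<Rightarrow> 'a \<Rightarrow> nat \<Rightarrow> real"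
    and u' :: "nat \<Rightarrow> 'b \<Rightarrow> nat \<Rightarrow> real"
  assumes M: "prob_space M" and Q: "prob_space Q"
    and F: "continuous_map skorokhod_J1 euclideanreal F" "bounded (F ` skorokhod_space)"
    and u: "\<And>n. u n \<in> borel_measurable M" and v: "\<And>n. v n \<in> borel_measurable M"
    and u': "\<And>n. u' n \<in> borel_measurable Q"
    and law: "\<And>n. 0 < n \<Longrightarrow> distr M borel (u n) = distr Q borel (u' n)"
    and Y: "Y \<in> measurable Q (borel_algebra_of skorokhod_J1)"
    and conv: "AE \<omega> in Q. J1_converges (\<lambda>n. step_path n (u' n \<omega>)) (Y \<omega>)"
    and close: "\<And>\<delta> T. 0 < \<delta> \<Longrightarrow>
      (\<lambda>n. measure M {\<omega> \<in> space M. \<exists>k\<le>n * T. \<delta> \<le> \<bar>u n \<omega> k - v n \<omega> k\<bar>}) \<longlonglongrightarrow> 0"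
  shows "(\<lambda>n. \<integral>\<omega>. F (step_path n (v n \<omega>)) \<partial>M) \<longlonglongrightarrow> (\<integral>\<omega>. F (Y \<omega>) \<partial>Q)"
proof -
  interpret M: prob_space M by (rule M)
  interpret Q: prob_space Q by (rule Q)
  obtain B where B0: "0 < B" and B': "\<forall>y\<in>F ` skorokhod_space. norm y \<le> B"
    using F(2) unfolding bounded_pos by blast
  have B: "\<bar>F x\<bar> \<le> B" if "x \<in> skorokhod_space" for x
    using bspec[OF B' imageI[OF that]] by simp
  have Bs: "\<bar>F (step_path n a)\<bar> \<le> B" for n a by (rule B[OF step_path_in_skorokhod_space])
  define f where "f n a = F (step_path n a)" for n a
  have f_cont: "continuous_on UNIV (f n)" for n
    unfolding f_def by (rule continuous_on_step_path[OF F(1)])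
  have [measurable]: "f n \<in> borel_measurable borel" for n
    by (rule borel_measurable_continuous_onI[OF f_cont])
  note [measurable] = u v u'
  have F_meas: "F \<in> borel_measurable (borel_algebra_of skorokhod_J1)"
    unfolding borel_algebra_of_def
  proof (rule borel_measurableI)
    fix S :: "real set" assume "open S"
    then have "openin euclideanreal S" using open_openin by blast
    from openin_continuous_map_preimage[OF F(1) this]
    moreover have "F -` S \<inter> topspace skorokhod_J1 = {x \<in> topspace skorokhod_J1. F x \<in> S}" by auto
    moreover have sub: "{U. openin skorokhod_J1 U} \<subseteq> Pow (topspace skorokhod_J1)"
      by (auto dest: openin_subset)
    ultimately show "F -` S \<inter> space (sigma (topspace skorokhod_J1) {U. openin skorokhod_J1 U})
        \<in> sets (sigma (topspace skorokhod_J1) {U. openin skorokhod_J1 U})"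
      unfolding space_measure_of[OF sub] sets_measure_of[OF sub] by (intro sigma_sets.Basic) simp
  qed
  have FY [measurable]: "(\<lambda>\<omega>. F (Y \<omega>)) \<in> borel_measurable Q"
    by (rule measurable_compose[OF Y F_meas])
  have Y_in: "Y \<omega> \<in> skorokhod_space" if "\<omega> \<in> space Q" for \<omega>
    using measurable_space[OF Y that] by (simp add: borel_algebra_of_def topspace_skorokhod_J1 space_measure_of_conv)
  have "(\<lambda>n. \<integral>\<omega>. f n (u' n \<omega>) \<partial>Q) \<longlonglongrightarrow> (\<integral>\<omega>. F (Y \<omega>) \<partial>Q)"
  proof (rule integral_dominated_convergence[where w = "\<lambda>_. B"])
    show "AE \<omega> in Q. (\<lambda>n. f n (u' n \<omega>)) \<longlonglongrightarrow> F (Y \<omega>)"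
      using conv
    proof (rule AE_mp, intro AE_I2 impI)
      fix \<omega> assume \<omega>: "\<omega> \<in> space Q" and c: "J1_converges (\<lambda>n. step_path n (u' n \<omega>)) (Y \<omega>)"
      show "(\<lambda>n. f n (u' n \<omega>)) \<longlonglongrightarrow> F (Y \<omega>)"
        unfolding f_def
        by (rule continuous_map_skorokhod_J1_sequentially[OF F(1) step_path_in_skorokhod_space Y_in[OF \<omega>] c])
    qed
    show "AE \<omega> in Q. norm (f n (u' n \<omega>)) \<le> B" for n using Bs by (simp add: f_def)
  qed simp_all
  moreover have "(\<integral>\<omega>. f n (u n \<omega>) \<partial>M) = (\<integral>\<omega>. f n (u' n \<omega>) \<partial>Q)" if "0 < n" for n
  proof -
    have "(\<integral>\<omega>. f n (u n \<omega>) \<partial>M) = (\<integral>a. f n a \<partial>distr M borel (u n))" by (simp add: integral_distr)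
    also have "\<dots> = (\<integral>\<omega>. f n (u' n \<omega>) \<partial>Q)" unfolding law[OF that] by (simp add: integral_distr)
    finally show ?thesis .
  qed
  then have "\<forall>\<^sub>F n in sequentially. (\<integral>\<omega>. f n (u' n \<omega>) \<partial>Q) = (\<integral>\<omega>. f n (u n \<omega>) \<partial>M)"
    by (intro eventually_mono[OF eventually_gt_at_top[of "0::nat"]]) simp
  ultimately have lim_u: "(\<lambda>n. \<integral>\<omega>. f n (u n \<omega>) \<partial>M) \<longlonglongrightarrow> (\<integral>\<omega>. F (Y \<omega>) \<partial>Q)"
    by (rule Lim_transform_eventually)
  \<comment> \<open>Let accuracy and horizon improve slowly enough that the two sequences still agree in probability.\<close>
  define far where "far j n = {\<omega> \<in> space M. \<exists>k\<le>n * j. 1 / Suc j \<le> \<bar>u n \<omega> k - v n \<omega> k\<bar>}" for j n :: nat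
  have coord: "(\<lambda>\<omega>. w \<omega> k) \<in> borel_measurable M" if "w \<in> borel_measurable M" for w :: "'a \<Rightarrow> nat \<Rightarrow> real" and k
    by (rule measurable_compose[OF that]) (rule borel_measurable_continuous_onI[OF continuous_on_product_coordinates])
  note [measurable] = coord[OF u] coord[OF v]
  have [measurable]: "far j n \<in> sets M" for j n unfolding far_def by measurable
  have "\<forall>\<^sub>F n in sequentially. measure M (far j n) < 1 / Suc j" for j
    unfolding far_def by (rule order_tendstoD(2)[OF close]) auto
  then obtain \<kappa> where \<kappa>: "filterlim \<kappa> at_top sequentially"
      and far_small: "\<forall>\<^sub>F n in sequentially. measure M (far (\<kappa> n) n) < 1 / Suc (\<kappa> n)"
    by (rule diagonal_sequence)
  have "(\<lambda>n. \<integral>\<omega>. f n (v n \<omega>) \<partial>M - (\<integral>\<omega>. f n (u n \<omega>) \<partial>M)) \<longlonglongrightarrow> 0"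
  proof (rule tendstoI)
    fix e :: real assume e: "0 < e"
    define e' where "e' = e / 4"
    have e': "0 < e'" using e by (simp add: e'_def)
    define Sens where "Sens n = {a. \<exists>b. (\<forall>k\<le>n * \<kappa> n. \<bar>a k - b k\<bar> < 1 / Suc (\<kappa> n)) \<and> e' < \<bar>f n b - f n a\<bar>}" for n
    have "open (Sens n)" for n unfolding Sens_def by (rule open_sensitive_set[OF f_cont])
    then have [measurable]: "Sens n \<in> sets borel" for n by simp
    have "(\<lambda>n. \<integral>\<omega>. indicator (Sens n) (u' n \<omega>) \<partial>Q) \<longlonglongrightarrow> (\<integral>\<omega>. (0::real) \<partial>Q)"
    proof (rule integral_dominated_convergence[where w = "\<lambda>_. 1"])
      show "AE \<omega> in Q. (\<lambda>n. indicator (Sens n) (u' n \<omega>) :: real) \<longlonglongrightarrow> 0"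
        using conv
      proof (rule AE_mp, intro AE_I2 impI)
        fix \<omega> assume \<omega>: "\<omega> \<in> space Q" and c: "J1_converges (\<lambda>n. step_path n (u' n \<omega>)) (Y \<omega>)"
        from eventually_insensitive[OF F(1) c Y_in[OF \<omega>] \<kappa> e']
        have "\<forall>\<^sub>F n in sequentially. indicator (Sens n) (u' n \<omega>) = (0::real)"
        proof (rule eventually_mono)
          fix n assume ins: "\<forall>b. (\<forall>k\<le>n * \<kappa> n. \<bar>u' n \<omega> k - b k\<bar> < 1 / Suc (\<kappa> n)) \<longrightarrow>
            \<bar>F (step_path n b) - F (step_path n (u' n \<omega>))\<bar> \<le> e'"
          have "u' n \<omega> \<notin> Sens n"
          proof
            assume "u' n \<omega> \<in> Sens n"
            then obtain b where "\<forall>k\<le>n * \<kappa> n. \<bar>u' n \<omega> k - b k\<bar> < 1 / Suc (\<kappa> n)"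
              "e' < \<bar>f n b - f n (u' n \<omega>)\<bar>" unfolding Sens_def by blast
            moreover from mp[OF spec[OF ins] this(1)] have "\<bar>f n b - f n (u' n \<omega>)\<bar> \<le> e'"
              unfolding f_def .
            ultimately show False by linarith
          qed
          then show "indicator (Sens n) (u' n \<omega>) = (0::real)" by simp
        qed
        then show "(\<lambda>n. indicator (Sens n) (u' n \<omega>) :: real) \<longlonglongrightarrow> 0" by (rule tendsto_eventually)
      qed
    qed (simp_all add: indicator_def)
    then have lim_O: "(\<lambda>n. \<integral>\<omega>. indicator (Sens n) (u' n \<omega>) \<partial>Q) \<longlonglongrightarrow> (0::real)" by simp
    have "\<forall>\<^sub>F n in sequentially. (\<integral>\<omega>. indicator (Sens n) (u' n \<omega>) \<partial>Q) < e' / (2 * B)"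
      by (rule order_tendstoD(2)[OF lim_O]) (use e' B0 in simp)
    moreover have "\<forall>\<^sub>F n in sequentially. 1 / Suc (\<kappa> n) < e' / (2 * B)"
    proof -
      have "(\<lambda>j. 1 / real (Suc j)) \<longlonglongrightarrow> 0" by real_asymp
      from order_tendstoD(2)[OF filterlim_compose[OF this \<kappa>], of "e' / (2 * B)"]
      show ?thesis using e' B0 by simp
    qed
    moreover note far_small eventually_gt_at_top[of "0::nat"]
    ultimately show "\<forall>\<^sub>F n in sequentially. dist ((\<integral>\<omega>. f n (v n \<omega>) \<partial>M) - (\<integral>\<omega>. f n (u n \<omega>) \<partial>M)) 0 < e"
    proof eventually_elim
      case (elim n)
      have fb: "\<bar>f n a\<bar> \<le> B" for a unfolding f_def by (rule Bs)
      have int: "integrable M (\<lambda>\<omega>. f n (w \<omega>))" if [measurable]: "w \<in> borel_measurable M" for w :: "'a \<Rightarrow> nat \<Rightarrow> real"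
        by (rule M.integrable_const_bound[where B = B]) (use fb in auto)
      have "\<bar>(\<integral>\<omega>. f n (v n \<omega>) \<partial>M) - (\<integral>\<omega>. f n (u n \<omega>) \<partial>M)\<bar> = \<bar>\<integral>\<omega>. f n (v n \<omega>) - f n (u n \<omega>) \<partial>M\<bar>"
        using int[OF u] int[OF v] by simp
      also have "\<dots> \<le> (\<integral>\<omega>. \<bar>f n (v n \<omega>) - f n (u n \<omega>)\<bar> \<partial>M)" by (rule integral_abs_bound)
      also have "\<dots> \<le> (\<integral>\<omega>. e' + 2 * B * (indicator (Sens n) (u n \<omega>) + indicator (far (\<kappa> n) n) \<omega>) \<partial>M)"
      proof (rule integral_mono)
        show "integrable M (\<lambda>\<omega>. \<bar>f n (v n \<omega>) - f n (u n \<omega>)\<bar>)" using int[OF u] int[OF v] by simp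
        show "integrable M (\<lambda>\<omega>. e' + 2 * B * (indicator (Sens n) (u n \<omega>) + indicator (far (\<kappa> n) n) \<omega>))"
          by (rule M.integrable_const_bound[where B = "e' + 4 * B"])
            (use B0 e' in \<open>auto simp: indicator_def abs_mult\<close>)
        fix \<omega> assume \<omega>: "\<omega> \<in> space M"
        have tri: "\<bar>f n (v n \<omega>) - f n (u n \<omega>)\<bar> \<le> 2 * B"
          using fb[of "v n \<omega>"] fb[of "u n \<omega>"] by linarith
        consider "u n \<omega> \<in> Sens n" | "\<omega> \<in> far (\<kappa> n) n" | "u n \<omega> \<notin> Sens n" "\<omega> \<notin> far (\<kappa> n) n" by blast
        then show "\<bar>f n (v n \<omega>) - f n (u n \<omega>)\<bar>
            \<le> e' + 2 * B * (indicator (Sens n) (u n \<omega>) + indicator (far (\<kappa> n) n) \<omega>)"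
        proof cases
          case 1
          then show ?thesis using tri e' B0 by (auto simp: indicator_def)
        next
          case 2
          then show ?thesis using tri e' B0 by (auto simp: indicator_def)
        next
          case 3
          have "\<forall>k\<le>n * \<kappa> n. \<bar>u n \<omega> k - v n \<omega> k\<bar> < 1 / Suc (\<kappa> n)"
            using 3(2) \<omega> by (simp add: far_def) (meson not_le)
          then have "\<not> e' < \<bar>f n (v n \<omega>) - f n (u n \<omega>)\<bar>" using 3(1) unfolding Sens_def by blast
          then show ?thesis using 3 by simp
        qed
      qed
      also have "\<dots> = e' + 2 * B * ((\<integral>\<omega>. indicator (Sens n) (u n \<omega>) \<partial>M) + measure M (far (\<kappa> n) n))"
      proof -
        have "integrable M (\<lambda>\<omega>. indicator (Sens n) (u n \<omega>) :: real)"
          by (rule M.integrable_const_bound[where B = 1]) (auto simp: indicator_def)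
        moreover have "integrable M (indicator (far (\<kappa> n) n) :: 'a \<Rightarrow> real)"
          by (rule M.integrable_const_bound[where B = 1]) (auto simp: indicator_def)
        moreover have "far (\<kappa> n) n \<inter> space M = far (\<kappa> n) n" by (auto simp: far_def)
        ultimately show ?thesis by (simp add: M.prob_space)
      qed
      also have "(\<integral>\<omega>. indicator (Sens n) (u n \<omega>) \<partial>M) = (\<integral>\<omega>. indicator (Sens n) (u' n \<omega>) \<partial>Q :: real)"
      proof -
        have "(\<integral>\<omega>. indicator (Sens n) (u n \<omega>) \<partial>M :: real) = (\<integral>a. indicator (Sens n) a \<partial>distr M borel (u n))"
          by (rule integral_distr[symmetric]) auto
        also have "\<dots> = (\<integral>\<omega>. indicator (Sens n) (u' n \<omega>) \<partial>Q)"
          unfolding law[OF elim(4)] by (rule integral_distr) auto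
        finally show ?thesis .
      qed
      also have "e' + 2 * B * ((\<integral>\<omega>. indicator (Sens n) (u' n \<omega>) \<partial>Q) + measure M (far (\<kappa> n) n))
          < e' + 2 * B * (e' / (2 * B) + e' / (2 * B))"
        using elim(1-3) B0 by (intro add_strict_left_mono mult_strict_left_mono add_strict_mono) auto
      also have "\<dots> = 3 * e'" using B0 by (simp add: field_simps)
      also have "\<dots> < e" using e by (simp add: e'_def)
      finally show ?case by simp
    qed
  qed
  from tendsto_add[OF this lim_u] show ?thesis by (simp add: f_def)
qed

section \<open>A maximal inequality\<close>

definition stays_below :: "real \<Rightarrow> nat \<Rightarrow> (nat \<Rightarrow> real) \<Rightarrow> bool" where
  "stays_below x k f \<longleftrightarrow> (\<forall>j\<le>k. \<bar>\<Sum>i=1..j. f i\<bar> < x)"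

text \<open>
  The partial sum frozen as soon as its absolute value reaches \<open>x\<close>.  It is a function of the
  increments alone, so that independence of the next increment can be applied to it.
\<close>
primrec stopped_sum :: "real \<Rightarrow> nat \<Rightarrow> (nat \<Rightarrow> real) \<Rightarrow> real" where
  "stopped_sum x 0 f = 0"
| "stopped_sum x (Suc k) f = stopped_sum x k f + (if stays_below x k f then f (Suc k) else 0)"

lemma stays_below_mono: "stays_below x k f \<Longrightarrow> j \<le> k \<Longrightarrow> stays_below x j f"
  by (auto simp: stays_below_def)

lemma stopped_sum_eq: "stays_below x k f \<Longrightarrow> stopped_sum x k f = (\<Sum>i=1..k. f i)"
proof (induction k)
  case (Suc k)
  then have "stays_below x k f" using stays_below_mono[of x "Suc k" f k] by simp
  with Suc show ?case by simp
qed simp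

lemma stopped_sum_large:
  assumes "0 < x" "\<not> stays_below x k f"
  shows "x \<le> \<bar>stopped_sum x k f\<bar>"
  using assms(2)
proof (induction k)
  case 0
  then show ?case using assms(1) by (simp add: stays_below_def)
next
  case (Suc k)
  show ?case
  proof (cases "stays_below x k f")
    case False
    then show ?thesis using Suc.IH[OF False] by simp
  next
    case True
    then have "stopped_sum x (Suc k) f = (\<Sum>i=1..Suc k. f i)"
      using stopped_sum_eq[OF True] by simp
    moreover have "x \<le> \<bar>\<Sum>i=1..Suc k. f i\<bar>"
      using Suc.prems True unfolding stays_below_def by (metis le_Suc_eq not_le)
    ultimately show ?thesis by simp
  qed
qed

lemma stays_below_measurable:
  assumes "{1..k} \<subseteq> I"
  shows "Measurable.pred (PiM I (\<lambda>_. borel)) (stays_below x k)"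
proof -
  have sum [measurable]: "(\<lambda>f. \<Sum>i=1..j. f i) \<in> borel_measurable (PiM I (\<lambda>_. borel :: real measure))"
    if "j \<in> {..k}" for j
  proof (rule borel_measurable_sum)
    fix i assume "i \<in> {1..j}"
    then have "i \<in> I" using assms that by auto
    then show "(\<lambda>f. f i) \<in> borel_measurable (PiM I (\<lambda>_. borel))"
      by (rule measurable_component_singleton)
  qed
  have "Measurable.pred (PiM I (\<lambda>_. borel)) (\<lambda>f. \<forall>j\<in>{..k}. \<bar>\<Sum>i=1..j. f i\<bar> < x)"
    by measurable
  moreover have "(\<lambda>f. \<forall>j\<in>{..k}. \<bar>\<Sum>i=1..j. f i\<bar> < x) = stays_below x k"
    by (simp only: fun_eq_iff stays_below_def atMost_iff Ball_def) simp
  ultimately show ?thesis by simp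
qed

lemma stopped_sum_measurable:
  assumes "{1..k} \<subseteq> I"
  shows "stopped_sum x k \<in> borel_measurable (PiM I (\<lambda>_. borel))"
  using assms
proof (induction k)
  case 0
  have "stopped_sum x 0 = (\<lambda>_. 0)" by (rule ext) simp
  then show ?case by simp
next
  case (Suc k)
  have sub: "{1..k} \<subseteq> I" and mem: "Suc k \<in> I" using Suc.prems by auto
  note [measurable] = Suc.IH[OF sub] stays_below_measurable[OF sub]
  have [measurable]: "(\<lambda>f. f (Suc k)) \<in> borel_measurable (PiM I (\<lambda>_. borel :: real measure))"
    using mem by (rule measurable_component_singleton)
  have "(\<lambda>f. stopped_sum x k f + (if stays_below x k f then f (Suc k) else 0))
      \<in> borel_measurable (PiM I (\<lambda>_. borel))" by measurable
  then show ?case by (simp cong: measurable_cong)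
qed

lemma stays_below_cong:
  assumes "\<And>i. i \<in> {1..k} \<Longrightarrow> f i = g i"
  shows "stays_below x k f = stays_below x k g"
proof -
  have "(\<Sum>i=1..j. f i) = (\<Sum>i=1..j. g i)" if "j \<le> k" for j
    using assms that by (intro sum.cong) auto
  then show ?thesis unfolding stays_below_def by metis
qed

lemma stopped_sum_cong:
  "(\<And>i. i \<in> {1..k} \<Longrightarrow> f i = g i) \<Longrightarrow> stopped_sum x k f = stopped_sum x k g"
proof (induction k)
  case (Suc k)
  have eq: "f i = g i" if "i \<in> {1..k}" for i using Suc.prems[of i] that by simp
  have "stays_below x k f = stays_below x k g" by (rule stays_below_cong) (rule eq)
  moreover have "stopped_sum x k f = stopped_sum x k g" by (rule Suc.IH) (rule eq)
  moreover have "f (Suc k) = g (Suc k)" by (rule Suc.prems) simp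
  ultimately show ?case by simp
qed simp

lemma stopped_sum_bound:
  "(\<And>i. \<bar>f i\<bar> \<le> B) \<Longrightarrow> \<bar>stopped_sum x k f\<bar> \<le> real k * B"
proof (induction k)
  case (Suc k)
  have B: "0 \<le> B" using Suc.prems[of 0] by simp
  have "\<bar>stopped_sum x (Suc k) f\<bar> \<le> \<bar>stopped_sum x k f\<bar> + B"
    using Suc.prems[of "Suc k"] B by auto
  with Suc show ?case by (simp add: algebra_simps) 
qed simp

context prob_space
begin

text \<open>
  Freezing does not create a drift: the part of the next increment that is kept is multiplied by an
  indicator depending on earlier increments only.
\<close>
lemma stopped_sum_second_moment:
  fixes X :: "nat \<Rightarrow> 'a \<Rightarrow> real" and B v x :: real
  assumes indep: "indep_vars (\<lambda>_. borel) X UNIV"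
    and B: "\<And>i \<omega>. \<bar>X i \<omega>\<bar> \<le> B"
    and mean: "\<And>i. expectation (X i) = 0" and var: "\<And>i. expectation (\<lambda>\<omega>. (X i \<omega>)\<^sup>2) \<le> v"
  shows "expectation (\<lambda>\<omega>. (stopped_sum x k (\<lambda>i. X i \<omega>))\<^sup>2) \<le> real k * v"
proof (induction k)
  case (Suc k)
  have X [measurable]: "X i \<in> borel_measurable M" for i
    using indep unfolding indep_vars_def by blast
  define T where "T \<omega> = stopped_sum x k (\<lambda>i. X i \<omega>)" for \<omega>
  define A where "A \<omega> = (if stays_below x k (\<lambda>i. X i \<omega>) then 1 else 0 :: real)" for \<omega>
  have B0: "0 \<le> B" by (rule order_trans[OF abs_ge_zero B])
  let ?past = "\<lambda>\<omega>. \<lambda>i\<in>{1..k}. X i \<omega>"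
  define G where "G f = stopped_sum x k f * (if stays_below x k f then 1 else 0)" for f
  have past: "?past \<in> measurable M (PiM {1..k} (\<lambda>_. borel))"
    by (rule measurable_restrict) (rule X)
  have T_eq: "T \<omega> = stopped_sum x k (?past \<omega>)" for \<omega>
    unfolding T_def by (rule stopped_sum_cong) simp
  have A_eq: "stays_below x k (\<lambda>i. X i \<omega>) = stays_below x k (?past \<omega>)" for \<omega>
    by (rule stays_below_cong) simp
  have TA_eq: "T \<omega> * A \<omega> = G (?past \<omega>)" for \<omega> by (simp only: T_eq A_eq A_def G_def)
  note [measurable] = stopped_sum_measurable[OF order_refl] stays_below_measurable[OF order_refl]
  have G_meas: "G \<in> borel_measurable (PiM {1..k} (\<lambda>_. borel))" unfolding G_def by measurable
  have T_meas [measurable]: "T \<in> borel_measurable M"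
    unfolding T_eq by (rule measurable_compose[OF past stopped_sum_measurable[OF order_refl]])
  have "(\<lambda>f. if stays_below x k f then 1 else 0 :: real) \<in> borel_measurable (PiM {1..k} (\<lambda>_. borel))"
    by measurable
  from measurable_compose[OF past this]
  have A_meas [measurable]: "A \<in> borel_measurable M" unfolding A_def A_eq .
  have A01: "A \<omega> = 0 \<or> A \<omega> = 1" for \<omega> by (simp add: A_def)
  have Tb: "\<bar>T \<omega>\<bar> \<le> real k * B" for \<omega> unfolding T_def by (rule stopped_sum_bound) (rule B)
  have int: "integrable M g" if [measurable]: "g \<in> borel_measurable M" and "\<And>\<omega>. \<bar>g \<omega>\<bar> \<le> c" for g :: "'a \<Rightarrow> real" and c :: real
    by (rule integrable_const_bound[where B = c]) (use that in auto)
  have int_T2: "integrable M (\<lambda>\<omega>. (T \<omega>)\<^sup>2)"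
  proof (rule int[of _ "(real k * B)\<^sup>2"])
    show "\<bar>(T \<omega>)\<^sup>2\<bar> \<le> (real k * B)\<^sup>2" for \<omega>
      using power_mono[OF Tb[of \<omega>] abs_ge_zero, of 2] by simp
  qed simp
  have int_X2: "integrable M (\<lambda>\<omega>. (X (Suc k) \<omega>)\<^sup>2)"
  proof (rule int[of _ "B\<^sup>2"])
    show "\<bar>(X (Suc k) \<omega>)\<^sup>2\<bar> \<le> B\<^sup>2" for \<omega>
      using power_mono[OF B[of "Suc k" \<omega>] abs_ge_zero, of 2] by simp
  qed simp
  have int_X: "integrable M (X (Suc k))" by (rule int[OF X B])
  have int_AX2: "integrable M (\<lambda>\<omega>. A \<omega> * (X (Suc k) \<omega>)\<^sup>2)"
    by (rule Bochner_Integration.integrable_bound[OF int_X2])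
      (measurable, rule AE_I2, use A01 in \<open>metis abs_ge_zero abs_mult abs_one mult_1 mult_zero_left norm_zero order_refl real_norm_def\<close>)
  have int_TA: "integrable M (\<lambda>\<omega>. T \<omega> * A \<omega>)"
  proof (rule int[of _ "real k * B"])
    show "\<bar>T \<omega> * A \<omega>\<bar> \<le> real k * B" for \<omega>
      using Tb[of \<omega>] A01[of \<omega>] B0 by (auto simp: abs_mult)
  qed measurable
  have "indep_var (PiM {1..k} (\<lambda>_. borel)) (\<lambda>\<omega>. \<lambda>i\<in>{1..k}. X i \<omega>)
      (PiM {Suc k} (\<lambda>_. borel)) (\<lambda>\<omega>. \<lambda>i\<in>{Suc k}. X i \<omega>)"
    by (rule indep_var_restrict[OF indep]) auto
  moreover note G_meas
  moreover have "(\<lambda>f. f (Suc k)) \<in> borel_measurable (PiM {Suc k} (\<lambda>_. borel :: real measure))"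
    by (rule measurable_component_singleton) simp
  ultimately have "indep_var borel (G \<circ> ?past) borel ((\<lambda>f. f (Suc k)) \<circ> (\<lambda>\<omega>. \<lambda>i\<in>{Suc k}. X i \<omega>))"
    by (rule indep_var_compose)
  moreover have "G \<circ> ?past = (\<lambda>\<omega>. T \<omega> * A \<omega>)" by (simp only: fun_eq_iff comp_apply TA_eq) simp
  moreover have "(\<lambda>f. f (Suc k)) \<circ> (\<lambda>\<omega>. \<lambda>i\<in>{Suc k}. X i \<omega>) = X (Suc k)" by (simp add: fun_eq_iff)
  ultimately have ind: "indep_var borel (\<lambda>\<omega>. T \<omega> * A \<omega>) borel (X (Suc k))" by (simp only:)
  \<comment> \<open>The increment is independent of the past and centred.\<close>
  have cross: "expectation (\<lambda>\<omega>. T \<omega> * A \<omega> * X (Suc k) \<omega>) = 0"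
    using indep_var_lebesgue_integral[OF ind int_TA int_X] mean by simp
  have int_cross: "integrable M (\<lambda>\<omega>. T \<omega> * A \<omega> * X (Suc k) \<omega>)"
    by (rule indep_var_integrable[OF ind int_TA int_X])
  have "expectation (\<lambda>\<omega>. (stopped_sum x (Suc k) (\<lambda>i. X i \<omega>))\<^sup>2)
      = expectation (\<lambda>\<omega>. (T \<omega>)\<^sup>2 + (2 * (T \<omega> * A \<omega> * X (Suc k) \<omega>) + A \<omega> * (X (Suc k) \<omega>)\<^sup>2))"
    by (rule arg_cong[where f = expectation]) (auto simp: fun_eq_iff T_def A_def power2_eq_square algebra_simps)
  also have "\<dots> = expectation (\<lambda>\<omega>. (T \<omega>)\<^sup>2) + expectation (\<lambda>\<omega>. A \<omega> * (X (Suc k) \<omega>)\<^sup>2)"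
    using int_T2 int_cross int_AX2 cross by simp
  also have "expectation (\<lambda>\<omega>. A \<omega> * (X (Suc k) \<omega>)\<^sup>2) \<le> expectation (\<lambda>\<omega>. (X (Suc k) \<omega>)\<^sup>2)"
  proof (rule integral_mono[OF int_AX2 int_X2])
    show "A \<omega> * (X (Suc k) \<omega>)\<^sup>2 \<le> (X (Suc k) \<omega>)\<^sup>2" for \<omega> using A01[of \<omega>] by auto
  qed
  also have "\<dots> \<le> v" by (rule var)
  finally show ?case using Suc by (simp add: T_def algebra_simps)
qed simp

lemma kolmogorov_maximal_inequality:
  fixes X :: "nat \<Rightarrow> 'a \<Rightarrow> real" and B v x :: real
  assumes indep: "indep_vars (\<lambda>_. borel) X UNIV"
    and B: "\<And>i \<omega>. \<bar>X i \<omega>\<bar> \<le> B"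
    and mean: "\<And>i. expectation (X i) = 0" and var: "\<And>i. expectation (\<lambda>\<omega>. (X i \<omega>)\<^sup>2) \<le> v"
    and x: "0 < x"
  shows "prob {\<omega> \<in> space M. \<exists>j\<le>k. x \<le> \<bar>\<Sum>i=1..j. X i \<omega>\<bar>} \<le> real k * v / x\<^sup>2"
proof -
  have X [measurable]: "X i \<in> borel_measurable M" for i
    using indep unfolding indep_vars_def by blast
  have [measurable]: "(\<lambda>\<omega>. stopped_sum x k (\<lambda>i. X i \<omega>)) \<in> borel_measurable M"
  proof -
    have "(\<lambda>\<omega>. \<lambda>i\<in>{1..k}. X i \<omega>) \<in> measurable M (PiM {1..k} (\<lambda>_. borel))"
    by (rule measurable_restrict) (rule X)
    from measurable_compose[OF this stopped_sum_measurable[of k "{1..k}" x]]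
    have "(\<lambda>\<omega>. stopped_sum x k (\<lambda>i\<in>{1..k}. X i \<omega>)) \<in> borel_measurable M" by simp
    moreover have "stopped_sum x k (\<lambda>i\<in>{1..k}. X i \<omega>) = stopped_sum x k (\<lambda>i. X i \<omega>)" for \<omega>
      by (rule stopped_sum_cong) simp
    ultimately show ?thesis by simp
  qed
  have Tb: "\<bar>stopped_sum x k (\<lambda>i. X i \<omega>)\<bar> \<le> real k * B" for \<omega> by (rule stopped_sum_bound) (rule B)
  have int: "integrable M (\<lambda>\<omega>. (stopped_sum x k (\<lambda>i. X i \<omega>))\<^sup>2)"
  proof (rule integrable_const_bound[where B = "(real k * B)\<^sup>2"], rule AE_I2)
    show "norm ((stopped_sum x k (\<lambda>i. X i \<omega>))\<^sup>2) \<le> (real k * B)\<^sup>2" for \<omega>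
      using power_mono[OF Tb[of \<omega>] abs_ge_zero, of 2] by simp
  qed measurable
  have sub: "{\<omega> \<in> space M. \<exists>j\<le>k. x \<le> \<bar>\<Sum>i=1..j. X i \<omega>\<bar>}
      \<subseteq> {\<omega> \<in> space M. x\<^sup>2 \<le> (stopped_sum x k (\<lambda>i. X i \<omega>))\<^sup>2}"
  proof
    fix \<omega> assume \<omega>: "\<omega> \<in> {\<omega> \<in> space M. \<exists>j\<le>k. x \<le> \<bar>\<Sum>i=1..j. X i \<omega>\<bar>}"
    then have "\<not> stays_below x k (\<lambda>i. X i \<omega>)" unfolding stays_below_def by (auto simp: not_less)
    then have "x \<le> \<bar>stopped_sum x k (\<lambda>i. X i \<omega>)\<bar>" by (rule stopped_sum_large[OF x])
    then have "x\<^sup>2 \<le> \<bar>stopped_sum x k (\<lambda>i. X i \<omega>)\<bar>\<^sup>2" using x by (intro power_mono) auto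
    then show "\<omega> \<in> {\<omega> \<in> space M. x\<^sup>2 \<le> (stopped_sum x k (\<lambda>i. X i \<omega>))\<^sup>2}" using \<omega> by simp
  qed
  then have "prob {\<omega> \<in> space M. \<exists>j\<le>k. x \<le> \<bar>\<Sum>i=1..j. X i \<omega>\<bar>}
      \<le> prob {\<omega> \<in> space M. x\<^sup>2 \<le> (stopped_sum x k (\<lambda>i. X i \<omega>))\<^sup>2}"
    by (rule finite_measure_mono) measurable
  also have "\<dots> \<le> expectation (\<lambda>\<omega>. (stopped_sum x k (\<lambda>i. X i \<omega>))\<^sup>2) / x\<^sup>2"
    by (rule integral_Markov_inequality_measure[OF int, where A = "{}"]) (use x in auto)
  also have "\<dots> \<le> real k * v / x\<^sup>2"
    using stopped_sum_second_moment[OF indep B mean var] by (intro divide_right_mono) auto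
  finally show ?thesis .
qed

end

section \<open>Truncated moments of regularly varying tails\<close>

lemma halving_recursion_bounded:
  fixes g :: "real \<Rightarrow> real"
  assumes x0: "0 < x0" and r: "0 \<le> r" "r < 1"
    and start: "\<And>b. x0 / 2 \<le> b \<Longrightarrow> b \<le> x0 \<Longrightarrow> g b \<le> C"
    and step: "\<And>b. x0 \<le> b \<Longrightarrow> g b \<le> r * g (b / 2) + q"
    and b: "x0 / 2 \<le> b"
  shows "g b \<le> max C (q / (1 - r))"
proof -
  define D where "D = max C (q / (1 - r))"
  have "q / (1 - r) \<le> D" by (simp add: D_def)
  then have qD: "r * D + q \<le> D" using r by (simp add: pos_divide_le_eq algebra_simps)
  have "\<forall>b. x0 / 2 \<le> b \<longrightarrow> b \<le> x0 * 2 ^ n \<longrightarrow> g b \<le> D" for n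
  proof (induction n)
    case 0
    show ?case using start by (auto simp: D_def intro: le_max_iff_disj[THEN iffD2])
  next
    case (Suc n)
    show ?case
    proof (intro allI impI)
      fix b assume b: "x0 / 2 \<le> b" "b \<le> x0 * 2 ^ Suc n"
      show "g b \<le> D"
      proof (cases "b \<le> x0")
        case True
        then show ?thesis using start[OF b(1)] by (simp add: D_def)
      next
        case False
        have "x0 / 2 \<le> b / 2" "b / 2 \<le> x0 * 2 ^ n" using False b by auto
        then have "g (b / 2) \<le> D" using Suc by blast
        then have "r * g (b / 2) + q \<le> r * D + q" using r by (simp add: mult_left_mono)
        moreover have "g b \<le> r * g (b / 2) + q" using False by (intro step) simp
        ultimately show ?thesis using qD by linarith
      qed
    qed
  qed
  moreover obtain n where "b / x0 < 2 ^ n" using real_arch_pow[of 2 "b / x0"] by auto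
  then have "b \<le> x0 * 2 ^ n" using x0 by (simp add: pos_divide_less_eq mult.commute less_imp_le)
  ultimately show ?thesis using b by (simp add: D_def)
qed

context prob_space
begin

text \<open>
  Splitting at \<open>b / 2\<close> gives \<open>V b \<le> V (b / 2) + b\<^sup>\<gamma> p (b / 2)\<close> for the truncated moment \<open>V\<close>.  After
  division by \<open>b\<^sup>\<gamma> p b\<close> this is a contracting recursion, because \<open>p (b / 2) / p b \<rightarrow> 2\<^sup>\<alpha> < 2\<^sup>\<gamma>\<close>.
\<close>
lemma truncated_moment_bound:
  fixes \<xi> :: "'a \<Rightarrow> real" and p :: "real \<Rightarrow> real" and \<gamma> :: nat and \<alpha> :: real
  assumes p_def: "\<And>x. p x = prob {\<omega> \<in> space M. x < \<bar>\<xi> \<omega>\<bar>}"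
    and \<xi> [measurable]: "\<xi> \<in> borel_measurable M" and p_pos: "\<And>x. 0 < p x"
    and rv: "((\<lambda>x. p (x / 2) / p x) \<longlongrightarrow> 2 powr \<alpha>) at_top" and \<gamma>: "\<alpha> < real \<gamma>" "0 < \<gamma>"
  shows "\<exists>C>0. \<forall>\<^sub>F b in at_top.
    expectation (\<lambda>\<omega>. \<bar>\<xi> \<omega>\<bar> ^ \<gamma> * indicator {\<omega>. \<bar>\<xi> \<omega>\<bar> \<le> b} \<omega>) \<le> C * b ^ \<gamma> * p b"
proof -
  define V where "V b = expectation (\<lambda>\<omega>. \<bar>\<xi> \<omega>\<bar> ^ \<gamma> * indicator {\<omega>. \<bar>\<xi> \<omega>\<bar> \<le> b} \<omega>)" for b
  have int: "integrable M (\<lambda>\<omega>. \<bar>\<xi> \<omega>\<bar> ^ \<gamma> * indicator {\<omega>. \<bar>\<xi> \<omega>\<bar> \<le> b} \<omega>)" for b :: real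
  proof (rule integrable_const_bound[where B = "max 0 b ^ \<gamma>"], rule AE_I2)
    show "norm (\<bar>\<xi> \<omega>\<bar> ^ \<gamma> * indicator {\<omega>. \<bar>\<xi> \<omega>\<bar> \<le> b} \<omega>) \<le> max 0 b ^ \<gamma>" for \<omega>
      by (auto simp: indicator_def intro: power_mono)
  qed measurable
  have V_le: "V b \<le> b ^ \<gamma>" if "0 \<le> b" for b
  proof -
    have "V b \<le> expectation (\<lambda>\<omega>. b ^ \<gamma>)"
      unfolding V_def using that by (intro integral_mono int) (auto simp: indicator_def intro: power_mono)
    then show ?thesis by (simp add: prob_space)
  qed
  have V_step: "V b \<le> V (b / 2) + b ^ \<gamma> * p (b / 2)" if "0 \<le> b" for b
  proof -
    have "V b \<le> expectation (\<lambda>\<omega>. \<bar>\<xi> \<omega>\<bar> ^ \<gamma> * indicator {\<omega>. \<bar>\<xi> \<omega>\<bar> \<le> b / 2} \<omega> +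
        b ^ \<gamma> * indicator {\<omega> \<in> space M. b / 2 < \<bar>\<xi> \<omega>\<bar>} \<omega>)"
      unfolding V_def
    proof (rule integral_mono)
      show "integrable M (\<lambda>\<omega>. \<bar>\<xi> \<omega>\<bar> ^ \<gamma> * indicator {\<omega>. \<bar>\<xi> \<omega>\<bar> \<le> b / 2} \<omega> +
          b ^ \<gamma> * indicator {\<omega> \<in> space M. b / 2 < \<bar>\<xi> \<omega>\<bar>} \<omega>)"
        by (intro Bochner_Integration.integrable_add int integrable_mult_right
            finite_measure.integrable_const_bound[where B = 1])
          (auto simp: indicator_def finite_measure_axioms)
      show "\<bar>\<xi> \<omega>\<bar> ^ \<gamma> * indicator {\<omega>. \<bar>\<xi> \<omega>\<bar> \<le> b} \<omega> \<le> \<bar>\<xi> \<omega>\<bar> ^ \<gamma> * indicator {\<omega>. \<bar>\<xi> \<omega>\<bar> \<le> b / 2} \<omega> +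
          b ^ \<gamma> * indicator {\<omega> \<in> space M. b / 2 < \<bar>\<xi> \<omega>\<bar>} \<omega>" if "\<omega> \<in> space M" for \<omega>
        using that \<open>0 \<le> b\<close> by (auto simp: indicator_def intro: power_mono)
    qed (rule int)
    also have "\<dots> = V (b / 2) + b ^ \<gamma> * p (b / 2)"
    proof -
      have "integrable M (\<lambda>\<omega>. indicator {\<omega> \<in> space M. b / 2 < \<bar>\<xi> \<omega>\<bar>} \<omega> :: real)"
        by (rule integrable_const_bound[where B = 1]) (auto simp: indicator_def)
      then have "expectation (\<lambda>\<omega>. \<bar>\<xi> \<omega>\<bar> ^ \<gamma> * indicator {\<omega>. \<bar>\<xi> \<omega>\<bar> \<le> b / 2} \<omega> +
          b ^ \<gamma> * indicator {\<omega> \<in> space M. b / 2 < \<bar>\<xi> \<omega>\<bar>} \<omega>) = V (b / 2) +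
          expectation (\<lambda>\<omega>. b ^ \<gamma> * indicator {\<omega> \<in> space M. b / 2 < \<bar>\<xi> \<omega>\<bar>} \<omega>)"
        unfolding V_def by (intro Bochner_Integration.integral_add int integrable_mult_right)
      also have "expectation (\<lambda>\<omega>. b ^ \<gamma> * indicator {\<omega> \<in> space M. b / 2 < \<bar>\<xi> \<omega>\<bar>} \<omega>) =
          b ^ \<gamma> * p (b / 2)" by (simp add: p_def Int_def conj_commute)
      finally show ?thesis .
    qed
    finally show ?thesis .
  qed
  have "2 powr \<alpha> < 2 powr real \<gamma>" using \<gamma> by simp
  then obtain q where q: "2 powr \<alpha> < q" "q < 2 powr real \<gamma>" using dense by blast
  then have q': "q < 2 ^ \<gamma>" by (simp add: powr_realpow)
  have "0 < 2 powr \<alpha>" by simp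
  then have q0: "0 < q" using q(1) by linarith
  have "\<forall>\<^sub>F x in at_top. p (x / 2) / p x < q" by (rule order_tendstoD(2)[OF rv q(1)])
  then obtain x1 where x1: "\<And>x. x1 \<le> x \<Longrightarrow> p (x / 2) / p x < q"
    by (auto simp: eventually_at_top_linorder)
  \<comment> \<open>From \<open>x0\<close> on, halving the argument multiplies \<open>p\<close> by at most \<open>q < 2\<^sup>\<gamma>\<close>.\<close>
  define x0 where "x0 = max 1 x1"
  have x0: "0 < x0" "x1 \<le> x0" by (auto simp: x0_def)
  have ratio: "p (x / 2) \<le> q * p x" if "x0 \<le> x" for x
    using x1[of x] x0(2) that p_pos[of x] by (simp add: pos_divide_less_eq)
  have p_anti: "p y \<le> p x" if "x \<le> y" for x y
    unfolding p_def by (rule finite_measure_mono) (use that in \<open>auto intro: le_less_trans\<close>)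
  define g where "g b = V b / (b ^ \<gamma> * p b)" for b
  define C where "C = max (x0 ^ \<gamma> / ((x0 / 2) ^ \<gamma> * p x0)) (q / (1 - q / 2 ^ \<gamma>))"
  have g_le: "g b \<le> C" if b: "x0 \<le> b" for b
    unfolding C_def
  proof (rule halving_recursion_bounded[where g = g, OF x0(1)])
    show "0 \<le> q / 2 ^ \<gamma>" "q / 2 ^ \<gamma> < 1" using q0 q' by auto
    show "x0 / 2 \<le> b" using b x0 by simp
  next
    fix c assume c: "x0 / 2 \<le> c" "c \<le> x0"
    have c0: "0 \<le> c" using c x0 by linarith
    have "V c \<le> x0 ^ \<gamma>" using V_le[OF c0] power_mono[OF c(2) c0, of \<gamma>] by linarith
    moreover have "(x0 / 2) ^ \<gamma> * p x0 \<le> c ^ \<gamma> * p c"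
      using c x0 p_anti[OF c(2)] p_pos[of x0] by (intro mult_mono power_mono) (auto simp: less_imp_le)
    moreover have "0 < (x0 / 2) ^ \<gamma> * p x0" using x0 p_pos by simp
    ultimately show "g c \<le> x0 ^ \<gamma> / ((x0 / 2) ^ \<gamma> * p x0)"
      unfolding g_def using x0 by (intro frac_le) auto
  next
    fix c assume c: "x0 \<le> c"
    have c0: "0 < c" using c x0 by linarith
    have pos: "0 < c ^ \<gamma> * p c" "0 < (c / 2) ^ \<gamma> * p (c / 2)" using c0 p_pos by auto
    have Vhalf: "0 \<le> V (c / 2)" unfolding V_def by (rule integral_nonneg_AE) simp
    have "c ^ \<gamma> * p (c / 2) \<le> c ^ \<gamma> * (q * p c)"
      by (rule mult_left_mono[OF ratio[OF c]]) (use c0 in simp)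
    moreover have "c ^ \<gamma> * (q * p c) = q * (c ^ \<gamma> * p c)" by (simp only: mult_ac)
    ultimately have "V c \<le> V (c / 2) + q * (c ^ \<gamma> * p c)"
      using V_step[OF less_imp_le[OF c0]] by linarith
    then have "g c \<le> (V (c / 2) + q * (c ^ \<gamma> * p c)) / (c ^ \<gamma> * p c)"
      unfolding g_def using pos by (intro divide_right_mono) auto
    also have "\<dots> = V (c / 2) / (c ^ \<gamma> * p c) + q"
      using pos(1) by (simp only: add_divide_distrib nonzero_mult_div_cancel_right less_imp_neq[symmetric] not_False_eq_True)
    also have "V (c / 2) / (c ^ \<gamma> * p c) \<le> q / 2 ^ \<gamma> * g (c / 2)"
    proof -
      have "(c / 2) ^ \<gamma> * p (c / 2) \<le> q / 2 ^ \<gamma> * (c ^ \<gamma> * p c)"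
        using mult_left_mono[OF ratio[OF c], of "(c / 2) ^ \<gamma>"] c0
        by (simp add: power_divide mult_ac)
      then have "V (c / 2) * ((c / 2) ^ \<gamma> * p (c / 2)) \<le> V (c / 2) * (q / 2 ^ \<gamma> * (c ^ \<gamma> * p c))"
        using Vhalf by (rule mult_left_mono)
      then have "V (c / 2) * ((c / 2) ^ \<gamma> * p (c / 2)) \<le> (q / 2 ^ \<gamma> * V (c / 2)) * (c ^ \<gamma> * p c)"
        by (simp only: mult_ac)
      then have "V (c / 2) / (c ^ \<gamma> * p c) \<le> (q / 2 ^ \<gamma> * V (c / 2)) / ((c / 2) ^ \<gamma> * p (c / 2))"
        using pos by (simp only: pos_divide_le_eq pos_le_divide_eq times_divide_eq_left)
      then show ?thesis by (simp add: g_def)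
    qed
    finally show "g c \<le> q / 2 ^ \<gamma> * g (c / 2) + q" by simp
  qed
  have "V b \<le> max 1 C * b ^ \<gamma> * p b" if b: "x0 \<le> b" for b
  proof -
    have pos: "0 < b ^ \<gamma> * p b" using b x0 p_pos by simp
    have "V b / (b ^ \<gamma> * p b) \<le> max 1 C" using g_le[OF b] by (simp add: g_def)
    then show ?thesis using pos by (simp add: pos_divide_le_eq mult.assoc)
  qed
  then have "\<forall>\<^sub>F b in at_top. V b \<le> max 1 C * b ^ \<gamma> * p b"
    by (rule eventually_at_top_linorderI)
  then show ?thesis unfolding V_def by (intro exI[of _ "max 1 C"]) simp
qed

text \<open>
  Splitting at \<open>2 b\<close> gives \<open>W b \<le> 2 b p b + W (2 b)\<close> for the moment \<open>W\<close> beyond \<open>b\<close>, and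
  \<open>p (2 b) / p b \<rightarrow> 2\<^sup>-\<^sup>\<alpha> < 1 / 2\<close> makes the iteration a geometric series.
\<close>
lemma tail_moment_bound:
  fixes \<xi> :: "'a \<Rightarrow> real" and p :: "real \<Rightarrow> real" and \<alpha> :: real
  assumes p_def: "\<And>x. p x = prob {\<omega> \<in> space M. x < \<bar>\<xi> \<omega>\<bar>}"
    and \<xi>: "integrable M \<xi>" and p_pos: "\<And>x. 0 < p x"
    and rv: "((\<lambda>x. p (2 * x) / p x) \<longlongrightarrow> 2 powr (- \<alpha>)) at_top" and \<alpha>: "1 < \<alpha>"
  shows "\<exists>C>0. \<forall>\<^sub>F b in at_top.
    expectation (\<lambda>\<omega>. \<bar>\<xi> \<omega>\<bar> * indicator {\<omega>. b < \<bar>\<xi> \<omega>\<bar>} \<omega>) \<le> C * b * p b"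
proof -
  have [measurable]: "\<xi> \<in> borel_measurable M" using \<xi> by simp
  define W where "W b = expectation (\<lambda>\<omega>. \<bar>\<xi> \<omega>\<bar> * indicator {\<omega>. b < \<bar>\<xi> \<omega>\<bar>} \<omega>)" for b
  have int: "integrable M (\<lambda>\<omega>. \<bar>\<xi> \<omega>\<bar> * indicator {\<omega>. b < \<bar>\<xi> \<omega>\<bar>} \<omega>)" for b :: real
    by (rule Bochner_Integration.integrable_bound[OF \<xi>]) (auto intro!: AE_I2 simp: indicator_def)
  have W_step: "W b \<le> 2 * b * p b + W (2 * b)" if "0 \<le> b" for b
  proof -
    have "integrable M (\<lambda>\<omega>. indicator {\<omega> \<in> space M. b < \<bar>\<xi> \<omega>\<bar>} \<omega> :: real)"
      by (rule integrable_const_bound[where B = 1]) (auto simp: indicator_def)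
    then have int': "integrable M (\<lambda>\<omega>. 2 * b * indicator {\<omega> \<in> space M. b < \<bar>\<xi> \<omega>\<bar>} \<omega>)"
      by (rule integrable_mult_right)
    have "W b \<le> expectation (\<lambda>\<omega>. 2 * b * indicator {\<omega> \<in> space M. b < \<bar>\<xi> \<omega>\<bar>} \<omega> +
        \<bar>\<xi> \<omega>\<bar> * indicator {\<omega>. 2 * b < \<bar>\<xi> \<omega>\<bar>} \<omega>)"
      unfolding W_def
      by (rule integral_mono[OF int Bochner_Integration.integrable_add[OF int' int]])
        (use that in \<open>auto simp: indicator_def\<close>)
    also have "\<dots> = 2 * b * p b + W (2 * b)"
      unfolding W_def by (subst Bochner_Integration.integral_add[OF int' int])
        (simp add: p_def Int_def conj_commute)
    finally show ?thesis .
  qed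
  have "2 powr (- \<alpha>) < 2 powr (- 1 :: real)" using \<alpha> by (intro powr_less_mono) auto
  also have "2 powr (- 1 :: real) = 1 / 2" by (simp add: powr_minus_divide)
  finally have "2 powr (- \<alpha>) < 1 / 2" .
  then obtain q where q: "2 powr (- \<alpha>) < q" "q < 1 / 2" using dense by blast
  have "0 < 2 powr (- \<alpha>)" by simp
  then have q0: "0 < q" using q(1) by linarith
  have "\<forall>\<^sub>F x in at_top. p (2 * x) / p x < q" by (rule order_tendstoD(2)[OF rv q(1)])
  then obtain x1 where x1: "\<And>x. x1 \<le> x \<Longrightarrow> p (2 * x) / p x < q"
    by (auto simp: eventually_at_top_linorder)
  define x0 where "x0 = max 1 x1"
  have x0: "0 < x0" "x1 \<le> x0" by (auto simp: x0_def)
  have ratio: "p (2 * x) \<le> q * p x" if "x0 \<le> x" for x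
    using x1[of x] x0(2) that p_pos[of x] by (simp add: pos_divide_less_eq)
  \<comment> \<open>The fixed point of \<open>D \<mapsto> 2 + 2 q D\<close>.\<close>
  define D where "D = 2 / (1 - 2 * q)"
  have D0: "0 < D" and D: "2 + 2 * q * D = D" using q q0 by (auto simp: D_def field_simps)
  have iter: "W b \<le> D * b * p b + W (2 ^ n * b)" if "x0 \<le> b" for b n
    using that
  proof (induction n arbitrary: b)
    case 0
    have "0 \<le> D * b * p b" using 0 x0 D0 p_pos[of b] by (simp add: less_imp_le)
    then show ?case by simp
  next
    case (Suc n)
    have b0: "0 < b" using Suc.prems x0 by linarith
    have "W (2 * b) \<le> D * (2 * b) * p (2 * b) + W (2 ^ n * (2 * b))"
      using Suc.prems b0 by (intro Suc.IH) linarith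
    moreover have "D * (2 * b) * p (2 * b) \<le> D * (2 * b) * (q * p b)"
      using ratio[OF Suc.prems] D0 b0 by (intro mult_left_mono) auto
    moreover have "W b \<le> 2 * b * p b + W (2 * b)" using W_step b0 by simp
    moreover have "D * b * p b = 2 * b * p b + D * (2 * b) * (q * p b)"
      by (subst D[symmetric]) (simp add: algebra_simps)
    moreover have "2 ^ n * (2 * b) = 2 ^ Suc n * b" by simp
    ultimately show ?case by (simp only:) 
  qed
  have "W b \<le> D * b * p b" if b: "x0 \<le> b" for b
  proof -
    have "(\<lambda>n. W (2 ^ n * b)) \<longlonglongrightarrow> expectation (\<lambda>\<omega>. 0)"
      unfolding W_def
    proof (rule integral_dominated_convergence[where w = "\<lambda>\<omega>. \<bar>\<xi> \<omega>\<bar>"])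
      show "integrable M (\<lambda>\<omega>. \<bar>\<xi> \<omega>\<bar>)" using \<xi> by simp
      show "AE \<omega> in M. (\<lambda>n. \<bar>\<xi> \<omega>\<bar> * indicator {\<omega>. 2 ^ n * b < \<bar>\<xi> \<omega>\<bar>} \<omega>) \<longlonglongrightarrow> 0"
      proof (rule AE_I2)
        fix \<omega>
        have b0: "0 < b" using b x0 by linarith
        have "filterlim (\<lambda>n. 2 ^ n * b) at_top sequentially" using b0 by real_asymp
        then have "\<forall>\<^sub>F n in sequentially. \<bar>\<xi> \<omega>\<bar> \<le> 2 ^ n * b" by (simp add: filterlim_at_top)
        then have "\<forall>\<^sub>F n in sequentially. \<bar>\<xi> \<omega>\<bar> * indicator {\<omega>. 2 ^ n * b < \<bar>\<xi> \<omega>\<bar>} \<omega> = 0"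
          by eventually_elim (simp add: indicator_def)
        then show "(\<lambda>n. \<bar>\<xi> \<omega>\<bar> * indicator {\<omega>. 2 ^ n * b < \<bar>\<xi> \<omega>\<bar>} \<omega>) \<longlonglongrightarrow> 0"
          by (rule tendsto_eventually)
      qed
      show "AE \<omega> in M. norm (\<bar>\<xi> \<omega>\<bar> * indicator {\<omega>. 2 ^ n * b < \<bar>\<xi> \<omega>\<bar>} \<omega>) \<le> \<bar>\<xi> \<omega>\<bar>" for n
        by (auto simp: indicator_def)
    qed simp_all
    then have "(\<lambda>n. D * b * p b + W (2 ^ n * b)) \<longlonglongrightarrow> D * b * p b + 0"
      by (intro tendsto_add tendsto_const) simp
    then show ?thesis
      using iter[OF b] by (intro tendsto_lowerbound[of _ "D * b * p b"]) auto
  qed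
  then have "\<forall>\<^sub>F b in at_top. W b \<le> D * b * p b" by (rule eventually_at_top_linorderI)
  then show ?thesis unfolding W_def using D0 by blast
qed


text \<open>
  For \<open>\<alpha> < 1\<close> the truncated first moment is itself of this order, for \<open>\<alpha> > 1\<close> it is minus the moment
  beyond the truncation level because the mean vanishes, and for \<open>\<alpha> = 1\<close> it is zero by symmetry.
\<close>
lemma truncated_mean_bound:
  fixes \<xi> :: "'a \<Rightarrow> real" and p :: "real \<Rightarrow> real" and \<alpha> :: real
  assumes p_def: "\<And>x. p x = prob {\<omega> \<in> space M. x < \<bar>\<xi> \<omega>\<bar>}"
    and \<xi> [measurable]: "\<xi> \<in> borel_measurable M" and p_pos: "\<And>x. 0 < p x"
    and rv: "\<And>c. 0 < c \<Longrightarrow> ((\<lambda>x. p (c * x) / p x) \<longlongrightarrow> c powr (- \<alpha>)) at_top"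
    and centred: "1 < \<alpha> \<Longrightarrow> integrable M \<xi> \<and> expectation \<xi> = 0"
    and symmetric: "\<alpha> = 1 \<Longrightarrow> distr M borel \<xi> = distr M borel (\<lambda>\<omega>. - \<xi> \<omega>)"
  shows "\<exists>C>0. \<forall>\<^sub>F b in at_top.
    \<bar>expectation (\<lambda>\<omega>. \<xi> \<omega> * indicator {\<omega>. \<bar>\<xi> \<omega>\<bar> \<le> b} \<omega>)\<bar> \<le> C * b * p b"
proof -
  have int: "integrable M (\<lambda>\<omega>. \<xi> \<omega> * indicator {\<omega>. \<bar>\<xi> \<omega>\<bar> \<le> b} \<omega>)" for b :: real
    by (rule integrable_const_bound[where B = "max 0 b"], rule AE_I2)
      (auto simp: indicator_def)
  consider "\<alpha> < 1" | "\<alpha> = 1" | "1 < \<alpha>" by linarith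
  then show ?thesis
  proof cases
    case 1
    have "((\<lambda>x. p (x / 2) / p x) \<longlongrightarrow> 2 powr \<alpha>) at_top"
      using rv[of "1 / 2"] by (simp add: powr_minus_divide powr_divide)
    from truncated_moment_bound[where \<gamma> = 1, OF p_def \<xi> p_pos this] 1
    obtain C where C: "0 < C" "\<forall>\<^sub>F b in at_top.
        expectation (\<lambda>\<omega>. \<bar>\<xi> \<omega>\<bar> ^ 1 * indicator {\<omega>. \<bar>\<xi> \<omega>\<bar> \<le> b} \<omega>) \<le> C * b ^ 1 * p b"
      by auto
    show ?thesis
    proof (intro exI[of _ C] conjI C(1) eventually_mono[OF C(2)])
      fix b
      assume b: "expectation (\<lambda>\<omega>. \<bar>\<xi> \<omega>\<bar> ^ 1 * indicator {\<omega>. \<bar>\<xi> \<omega>\<bar> \<le> b} \<omega>) \<le> C * b ^ 1 * p b"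
      have "\<bar>expectation (\<lambda>\<omega>. \<xi> \<omega> * indicator {\<omega>. \<bar>\<xi> \<omega>\<bar> \<le> b} \<omega>)\<bar>
          \<le> expectation (\<lambda>\<omega>. \<bar>\<xi> \<omega> * indicator {\<omega>. \<bar>\<xi> \<omega>\<bar> \<le> b} \<omega>\<bar>)" by (rule integral_abs_bound)
      also have "(\<lambda>\<omega>. \<bar>\<xi> \<omega> * indicator {\<omega>. \<bar>\<xi> \<omega>\<bar> \<le> b} \<omega>\<bar>) = (\<lambda>\<omega>. \<bar>\<xi> \<omega>\<bar> ^ 1 * indicator {\<omega>. \<bar>\<xi> \<omega>\<bar> \<le> b} \<omega>)"
        by (auto simp: indicator_def)
      also note b
      finally show "\<bar>expectation (\<lambda>\<omega>. \<xi> \<omega> * indicator {\<omega>. \<bar>\<xi> \<omega>\<bar> \<le> b} \<omega>)\<bar> \<le> C * b * p b" by simp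
    qed
  next
    case 2
    have zero: "expectation (\<lambda>\<omega>. \<xi> \<omega> * indicator {\<omega>. \<bar>\<xi> \<omega>\<bar> \<le> b} \<omega>) = 0" for b :: real
    proof -
      define h where "h x = x * indicator {-b..b} x" for x :: real
      have [measurable]: "h \<in> borel_measurable borel" unfolding h_def by measurable
      have h: "\<xi> \<omega> * indicator {\<omega>. \<bar>\<xi> \<omega>\<bar> \<le> b} \<omega> = h (\<xi> \<omega>)" for \<omega>
        by (auto simp: h_def indicator_def)
      have "expectation (\<lambda>\<omega>. h (\<xi> \<omega>)) = (\<integral>x. h x \<partial>distr M borel \<xi>)" by (simp add: integral_distr)
      also have "\<dots> = expectation (\<lambda>\<omega>. h (- \<xi> \<omega>))"
        unfolding symmetric[OF 2] by (simp add: integral_distr)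
      also have "(\<lambda>\<omega>. h (- \<xi> \<omega>)) = (\<lambda>\<omega>. - h (\<xi> \<omega>))"
        by (rule ext) (auto simp: h_def indicator_def)
      finally show ?thesis unfolding h by simp
    qed
    show ?thesis
    proof (intro exI[of _ 1] conjI)
      show "\<forall>\<^sub>F b in at_top. \<bar>expectation (\<lambda>\<omega>. \<xi> \<omega> * indicator {\<omega>. \<bar>\<xi> \<omega>\<bar> \<le> b} \<omega>)\<bar> \<le> 1 * b * p b"
        by (rule eventually_mono[OF eventually_ge_at_top[of 0]])
          (use zero p_pos in \<open>simp add: less_imp_le\<close>)
    qed simp
  next
    case 3
    have \<xi>i: "integrable M \<xi>" and mean: "expectation \<xi> = 0" using centred[OF 3] by auto
    obtain C where C: "0 < C" "\<forall>\<^sub>F b in at_top.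
        expectation (\<lambda>\<omega>. \<bar>\<xi> \<omega>\<bar> * indicator {\<omega>. b < \<bar>\<xi> \<omega>\<bar>} \<omega>) \<le> C * b * p b"
      using tail_moment_bound[OF p_def \<xi>i p_pos rv 3] by auto
    show ?thesis
    proof (intro exI[of _ C] conjI C(1) eventually_mono[OF C(2)])
      fix b
      assume b: "expectation (\<lambda>\<omega>. \<bar>\<xi> \<omega>\<bar> * indicator {\<omega>. b < \<bar>\<xi> \<omega>\<bar>} \<omega>) \<le> C * b * p b"
      have int': "integrable M (\<lambda>\<omega>. \<xi> \<omega> * indicator {\<omega>. b < \<bar>\<xi> \<omega>\<bar>} \<omega>)"
        by (rule Bochner_Integration.integrable_bound[OF \<xi>i]) (auto intro!: AE_I2 simp: indicator_def)
      have "0 = expectation (\<lambda>\<omega>. \<xi> \<omega> * indicator {\<omega>. \<bar>\<xi> \<omega>\<bar> \<le> b} \<omega> + \<xi> \<omega> * indicator {\<omega>. b < \<bar>\<xi> \<omega>\<bar>} \<omega>)"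
        by (subst mean[symmetric], rule arg_cong[where f = expectation]) (auto simp: indicator_def)
      also have "\<dots> = expectation (\<lambda>\<omega>. \<xi> \<omega> * indicator {\<omega>. \<bar>\<xi> \<omega>\<bar> \<le> b} \<omega>) +
          expectation (\<lambda>\<omega>. \<xi> \<omega> * indicator {\<omega>. b < \<bar>\<xi> \<omega>\<bar>} \<omega>)"
        by (rule Bochner_Integration.integral_add[OF int int'])
      finally have "\<bar>expectation (\<lambda>\<omega>. \<xi> \<omega> * indicator {\<omega>. \<bar>\<xi> \<omega>\<bar> \<le> b} \<omega>)\<bar>
          = \<bar>expectation (\<lambda>\<omega>. \<xi> \<omega> * indicator {\<omega>. b < \<bar>\<xi> \<omega>\<bar>} \<omega>)\<bar>" by linarith
      also have "\<dots> \<le> expectation (\<lambda>\<omega>. \<bar>\<xi> \<omega> * indicator {\<omega>. b < \<bar>\<xi> \<omega>\<bar>} \<omega>\<bar>)" by (rule integral_abs_bound)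
      also have "(\<lambda>\<omega>. \<bar>\<xi> \<omega> * indicator {\<omega>. b < \<bar>\<xi> \<omega>\<bar>} \<omega>\<bar>) = (\<lambda>\<omega>. \<bar>\<xi> \<omega>\<bar> * indicator {\<omega>. b < \<bar>\<xi> \<omega>\<bar>} \<omega>)"
        by (auto simp: indicator_def)
      also note b
      finally show "\<bar>expectation (\<lambda>\<omega>. \<xi> \<omega> * indicator {\<omega>. \<bar>\<xi> \<omega>\<bar> \<le> b} \<omega>)\<bar> \<le> C * b * p b" .
    qed
  qed
qed

section \<open>The random walk is negligible\<close>

lemma expectation_distr_eq:
  fixes X Y :: "'a \<Rightarrow> real" and h :: "real \<Rightarrow> real"
  assumes [measurable]: "X \<in> borel_measurable M" "Y \<in> borel_measurable M" "h \<in> borel_measurable borel"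
    and law: "distr M borel X = distr M borel Y"
  shows "expectation (\<lambda>\<omega>. h (X \<omega>)) = expectation (\<lambda>\<omega>. h (Y \<omega>))"
proof -
  have "expectation (\<lambda>\<omega>. h (X \<omega>)) = (\<integral>x. h x \<partial>distr M borel X)" by (simp add: integral_distr)
  also have "\<dots> = expectation (\<lambda>\<omega>. h (Y \<omega>))" unfolding law by (simp add: integral_distr)
  finally show ?thesis .
qed

text \<open>
  With high probability no increment exceeds \<open>b n\<close> up to time \<open>n T\<close>; the increments truncated at level
  \<open>x = b n\<close> have means and second moments of order at most \<open>x p x\<close> and \<open>x\<^sup>2 p x\<close>, so that both the drift
  and, by the maximal inequality, the fluctuations of the truncated walk are small relative to \<open>b n\<close>
  because of \<open>n p (b n) \<rightarrow> 0\<close>.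
\<close>
lemma maximal_partial_sum_negligible:
  fixes \<xi> :: "nat \<Rightarrow> 'a \<Rightarrow> real" and p :: "real \<Rightarrow> real" and \<alpha> :: real and b :: "nat \<Rightarrow> real" and T :: nat
  assumes p_def: "\<And>x. p x = prob {\<omega> \<in> space M. x < \<bar>\<xi> 0 \<omega>\<bar>}"
    and indep: "indep_vars (\<lambda>_. borel) \<xi> UNIV"
    and law: "\<And>i. distr M borel (\<xi> i) = distr M borel (\<xi> 0)"
    and p_pos: "\<And>x. 0 < p x"
    and rv: "\<And>c. 0 < c \<Longrightarrow> ((\<lambda>x. p (c * x) / p x) \<longlongrightarrow> c powr (- \<alpha>)) at_top" and \<alpha>: "\<alpha> < 2"
    and centred: "1 < \<alpha> \<Longrightarrow> integrable M (\<xi> 0) \<and> expectation (\<xi> 0) = 0"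
    and symmetric: "\<alpha> = 1 \<Longrightarrow> distr M borel (\<xi> 0) = distr M borel (\<lambda>\<omega>. - \<xi> 0 \<omega>)"
    and b: "filterlim b at_top sequentially" "(\<lambda>n. real n * p (b n)) \<longlonglongrightarrow> 0" and \<delta>: "0 < \<delta>"
  shows "(\<lambda>n. prob {\<omega> \<in> space M. \<exists>k\<le>n * T. \<delta> * b n \<le> \<bar>\<Sum>i=1..k. \<xi> i \<omega>\<bar>}) \<longlonglongrightarrow> 0"
proof -
  have \<xi> [measurable]: "\<xi> i \<in> borel_measurable M" for i
    using indep unfolding indep_vars_def by blast
  have "((\<lambda>x. p (x / 2) / p x) \<longlongrightarrow> 2 powr \<alpha>) at_top"
    using rv[of "1 / 2"] by (simp add: powr_minus_divide powr_divide)
  from truncated_moment_bound[where \<gamma> = 2, OF p_def \<xi> p_pos this] \<alpha>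
  have "\<exists>C>0. \<forall>\<^sub>F x in at_top.
      expectation (\<lambda>\<omega>. \<bar>\<xi> 0 \<omega>\<bar> ^ 2 * indicator {\<omega>. \<bar>\<xi> 0 \<omega>\<bar> \<le> x} \<omega>) \<le> C * x ^ 2 * p x"
    by (simp only: of_nat_numeral zero_less_numeral)
  then obtain C where C: "0 < C" "\<forall>\<^sub>F x in at_top.
      expectation (\<lambda>\<omega>. \<bar>\<xi> 0 \<omega>\<bar> ^ 2 * indicator {\<omega>. \<bar>\<xi> 0 \<omega>\<bar> \<le> x} \<omega>) \<le> C * x ^ 2 * p x"
    by (elim exE conjE) (rule that)
  have "\<exists>D>0. \<forall>\<^sub>F x in at_top.
      \<bar>expectation (\<lambda>\<omega>. \<xi> 0 \<omega> * indicator {\<omega>. \<bar>\<xi> 0 \<omega>\<bar> \<le> x} \<omega>)\<bar> \<le> D * x * p x"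
    by (rule truncated_mean_bound[OF p_def \<xi> p_pos rv centred symmetric])
  then obtain D where D: "0 < D" "\<forall>\<^sub>F x in at_top.
      \<bar>expectation (\<lambda>\<omega>. \<xi> 0 \<omega> * indicator {\<omega>. \<bar>\<xi> 0 \<omega>\<bar> \<le> x} \<omega>)\<bar> \<le> D * x * p x"
    by (elim exE conjE) (rule that)
  \<comment> \<open>One term for a large increment, one for the fluctuations of the truncated walk.\<close>
  define K where "K = real T * (1 + 4 * C / \<delta>\<^sup>2)"
  have bound: "\<forall>\<^sub>F n in sequentially.
      prob {\<omega> \<in> space M. \<exists>k\<le>n * T. \<delta> * b n \<le> \<bar>\<Sum>i=1..k. \<xi> i \<omega>\<bar>} \<le> K * (real n * p (b n))"
  proof -
    have "\<forall>\<^sub>F n in sequentially. real n * p (b n) < \<delta> / (2 * (real T + 1) * D)"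
      by (rule order_tendstoD(2)[OF b(2)]) (use \<delta> D(1) in simp)
    moreover have "\<forall>\<^sub>F n in sequentially. 0 < b n"
      using b(1) by (simp add: filterlim_at_top_dense)
    moreover note filterlim_iff[THEN iffD1, OF b(1), rule_format, OF C(2)]
      filterlim_iff[THEN iffD1, OF b(1), rule_format, OF D(2)]
    ultimately show ?thesis
    proof eventually_elim
      case (elim n)
      define c where "c = b n"
      have c: "0 < c" using elim(2) by (simp add: c_def)
      \<comment> \<open>Truncation at \<open>c = b n\<close>.\<close>
      define h where "h x = x * indicator {-c..c} x" for x :: real
      have h_meas [measurable]: "h \<in> borel_measurable borel" unfolding h_def by measurable
      have hb: "\<bar>h x\<bar> \<le> c" for x using c by (auto simp: h_def indicator_def)
      define m where "m = expectation (\<lambda>\<omega>. h (\<xi> 0 \<omega>))"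
      have m_i: "expectation (\<lambda>\<omega>. h (\<xi> i \<omega>)) = m" for i
        unfolding m_def by (rule expectation_distr_eq[OF \<xi>[of i] \<xi>[of 0] h_meas law[of i]])
      have int_h: "integrable M (\<lambda>\<omega>. h (\<xi> i \<omega>))" for i
        by (rule integrable_const_bound[where B = c]) (use hb in auto)
      have m_le: "\<bar>m\<bar> \<le> D * c * p c"
      proof -
        have "(\<lambda>\<omega>. h (\<xi> 0 \<omega>)) = (\<lambda>\<omega>. \<xi> 0 \<omega> * indicator {\<omega>. \<bar>\<xi> 0 \<omega>\<bar> \<le> c} \<omega>)"
          by (rule ext) (auto simp: h_def indicator_def)
        then show ?thesis using elim(4) by (simp add: m_def c_def)
      qed
      define X where "X i \<omega> = h (\<xi> i \<omega>) - m" for i \<omega>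
      have X_indep: "indep_vars (\<lambda>_. borel) X UNIV"
        unfolding X_def by (rule indep_vars_compose2[OF indep]) measurable
      have Xb: "\<bar>X i \<omega>\<bar> \<le> c + \<bar>m\<bar>" for i \<omega> unfolding X_def using hb[of "\<xi> i \<omega>"] by linarith
      have X_mean: "expectation (X i) = 0" for i
        unfolding X_def using int_h[of i] m_i[of i] by (simp add: prob_space)
      have X_var: "expectation (\<lambda>\<omega>. (X i \<omega>)\<^sup>2) \<le> C * c\<^sup>2 * p c" for i
      proof -
        have int_h2: "integrable M (\<lambda>\<omega>. (h (\<xi> i \<omega>))\<^sup>2)"
        proof (rule integrable_const_bound[where B = "c\<^sup>2"], rule AE_I2)
          show "norm ((h (\<xi> i \<omega>))\<^sup>2) \<le> c\<^sup>2" for \<omega>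
            using power_mono[OF hb[of "\<xi> i \<omega>"] abs_ge_zero, of 2] by simp
        qed measurable
        have "expectation (\<lambda>\<omega>. (X i \<omega>)\<^sup>2) = expectation (\<lambda>\<omega>. (h (\<xi> i \<omega>))\<^sup>2) - m\<^sup>2"
          using variance_eq[OF int_h[of i] int_h2] m_i[of i] by (simp add: X_def)
        also have "\<dots> \<le> expectation (\<lambda>\<omega>. (h (\<xi> i \<omega>))\<^sup>2)" by simp
        also have "\<dots> = expectation (\<lambda>\<omega>. (h (\<xi> 0 \<omega>))\<^sup>2)"
          by (rule expectation_distr_eq[OF \<xi>[of i] \<xi>[of 0] _ law[of i], of "\<lambda>x. (h x)\<^sup>2"]) measurable
        also have "(\<lambda>\<omega>. (h (\<xi> 0 \<omega>))\<^sup>2) = (\<lambda>\<omega>. \<bar>\<xi> 0 \<omega>\<bar> ^ 2 * indicator {\<omega>. \<bar>\<xi> 0 \<omega>\<bar> \<le> c} \<omega>)"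
          by (rule ext) (auto simp: h_def indicator_def power_mult_distrib)
        also have "expectation \<dots> \<le> C * c\<^sup>2 * p c" using elim(3) by (simp only: c_def)
        finally show ?thesis .
      qed
      define E1 where "E1 = {\<omega> \<in> space M. \<exists>i\<in>{1..n * T}. c < \<bar>\<xi> i \<omega>\<bar>}"
      define E2 where "E2 = {\<omega> \<in> space M. \<exists>k\<le>n * T. \<delta> * c / 2 \<le> \<bar>\<Sum>i=1..k. X i \<omega>\<bar>}"
      have [measurable]: "E1 \<in> sets M" unfolding E1_def by measurable
      have [measurable]: "X i \<in> borel_measurable M" for i unfolding X_def by measurable
      have [measurable]: "E2 \<in> sets M" unfolding E2_def by measurable
      \<comment> \<open>The accumulated drift uses up half of \<open>\<delta> c\<close>.\<close>
      have drift: "real k * \<bar>m\<bar> \<le> \<delta> * c / 2" if k: "k \<le> n * T" for k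
      proof -
        have "real k \<le> real (n * T)" using k by (simp only: of_nat_le_iff)
        then have "real k * \<bar>m\<bar> \<le> real (n * T) * (D * c * p c)"
          using m_le by (intro mult_mono) auto
        also have "\<dots> = (D * c * real T) * (real n * p c)" by (simp add: mult_ac)
        also have "\<dots> \<le> (D * c * (real T + 1)) * (\<delta> / (2 * (real T + 1) * D))"
          using elim(1) D(1) c p_pos[of c] by (intro mult_mono) (auto simp: c_def less_imp_le)
        also have "\<dots> = \<delta> * c / 2"
        proof -
          have "D \<noteq> 0" "real T + 1 \<noteq> 0" using D(1) by linarith+
          then show ?thesis by (simp only: times_divide_eq_right) (simp add: mult_ac)
        qed
        finally show ?thesis .
      qed
      have "{\<omega> \<in> space M. \<exists>k\<le>n * T. \<delta> * c \<le> \<bar>\<Sum>i=1..k. \<xi> i \<omega>\<bar>} \<subseteq> E1 \<union> E2"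
      proof
        fix \<omega> assume "\<omega> \<in> {\<omega> \<in> space M. \<exists>k\<le>n * T. \<delta> * c \<le> \<bar>\<Sum>i=1..k. \<xi> i \<omega>\<bar>}"
        then obtain k where k: "\<omega> \<in> space M" "k \<le> n * T" "\<delta> * c \<le> \<bar>\<Sum>i=1..k. \<xi> i \<omega>\<bar>" by blast
        show "\<omega> \<in> E1 \<union> E2"
        proof (cases "\<omega> \<in> E1")
          case False
          have "(\<Sum>i=1..k. X i \<omega>) = (\<Sum>i=1..k. \<xi> i \<omega> - m)"
          proof (rule sum.cong)
            fix i assume "i \<in> {1..k}"
            then have "\<not> c < \<bar>\<xi> i \<omega>\<bar>" using False k(1,2) unfolding E1_def by auto
            then show "X i \<omega> = \<xi> i \<omega> - m" by (auto simp: X_def h_def indicator_def)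
          qed simp
          also have "\<dots> = (\<Sum>i=1..k. \<xi> i \<omega>) - real k * m" by (simp add: sum_subtractf)
          finally have "(\<Sum>i=1..k. X i \<omega>) = (\<Sum>i=1..k. \<xi> i \<omega>) - real k * m" .
          moreover have "\<bar>real k * m\<bar> \<le> \<delta> * c / 2" using drift[OF k(2)] by (simp add: abs_mult)
          ultimately have "\<delta> * c / 2 \<le> \<bar>\<Sum>i=1..k. X i \<omega>\<bar>" using k(3) by linarith
          then show ?thesis using k(1,2) by (auto simp: E2_def)
        qed simp
      qed
      then have "prob {\<omega> \<in> space M. \<exists>k\<le>n * T. \<delta> * c \<le> \<bar>\<Sum>i=1..k. \<xi> i \<omega>\<bar>} \<le> prob (E1 \<union> E2)"
        by (rule finite_measure_mono) measurable
      also have "\<dots> \<le> prob E1 + prob E2" by (rule measure_Un_le) measurable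
      also have "prob E1 \<le> real (n * T) * p c"
      proof -
        have p_i: "prob {\<omega> \<in> space M. c < \<bar>\<xi> i \<omega>\<bar>} = p c" for i
        proof -
          have "prob {\<omega> \<in> space M. c < \<bar>\<xi> i \<omega>\<bar>} = measure (distr M borel (\<xi> i)) {x. c < \<bar>x\<bar>}"
            by (subst measure_distr) (auto simp: vimage_def Int_def conj_commute)
          also have "\<dots> = p c"
            unfolding law[of i] p_def by (subst measure_distr) (auto simp: vimage_def Int_def conj_commute)
          finally show ?thesis .
        qed
        have "E1 = (\<Union>i\<in>{1..n * T}. {\<omega> \<in> space M. c < \<bar>\<xi> i \<omega>\<bar>})" by (auto simp: E1_def)
        then have "prob E1 \<le> (\<Sum>i\<in>{1..n * T}. prob {\<omega> \<in> space M. c < \<bar>\<xi> i \<omega>\<bar>})"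
          by (simp only:) (rule finite_measure_subadditive_finite, auto)
        also have "\<dots> = real (n * T) * p c" by (simp add: p_i)
        finally show ?thesis .
      qed
      also have "prob E2 \<le> real (n * T) * (C * c\<^sup>2 * p c) / (\<delta> * c / 2)\<^sup>2"
        unfolding E2_def
        by (rule kolmogorov_maximal_inequality[OF X_indep Xb X_mean X_var]) (use \<delta> c in simp)
      also have "real (n * T) * p c + real (n * T) * (C * c\<^sup>2 * p c) / (\<delta> * c / 2)\<^sup>2
          = K * (real n * p c)"
        using \<delta> c by (simp add: K_def power_mult_distrib power_divide field_simps)
      finally show ?case by (simp add: c_def)
    qed
  qed
  have "(\<lambda>n. K * (real n * p (b n))) \<longlonglongrightarrow> 0" using tendsto_mult_right_zero[OF b(2), of K] by simp
  then show ?thesis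
    by (rule tendsto_sandwich[OF _ bound tendsto_const, rotated]) (auto intro: always_eventually)
qed

end

section \<open>Running suprema of locally finite configurations\<close>

definition running_sup :: "(real \<times> ereal) set \<Rightarrow> real \<Rightarrow> ereal" where
  "running_sup P t = Sup (insert 0 {j. \<exists>\<theta>\<le>t. (\<theta>, j) \<in> P})"

lemma running_sup_nonneg: "0 \<le> running_sup P t"
  unfolding running_sup_def by (rule Sup_upper) simp

lemma running_sup_upper: "(\<theta>, j) \<in> P \<Longrightarrow> \<theta> \<le> t \<Longrightarrow> j \<le> running_sup P t"
  unfolding running_sup_def by (rule Sup_upper) blast

lemma running_sup_least: "0 \<le> c \<Longrightarrow> (\<And>\<theta> j. (\<theta>, j) \<in> P \<Longrightarrow> \<theta> \<le> t \<Longrightarrow> j \<le> c) \<Longrightarrow> running_sup P t \<le> c"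
  unfolding running_sup_def by (rule Sup_least) auto

text \<open>Above a positive level there are only finitely many points, so the supremum is attained.\<close>
lemma running_sup_attained:
  assumes P: "P \<subseteq> {0..} \<times> {0<..}" and fin: "\<And>T y. 0 < y \<Longrightarrow> finite (P \<inter> {0..T} \<times> {y..})"
    and y: "0 < y"
  shows "y \<le> running_sup P t \<longleftrightarrow> (\<exists>\<theta> j. (\<theta>, j) \<in> P \<and> \<theta> \<le> t \<and> y \<le> j)"
proof
  assume "\<exists>\<theta> j. (\<theta>, j) \<in> P \<and> \<theta> \<le> t \<and> y \<le> j"
  then show "y \<le> running_sup P t" using running_sup_upper order_trans by blast
next
  assume le: "y \<le> running_sup P t"
  show "\<exists>\<theta> j. (\<theta>, j) \<in> P \<and> \<theta> \<le> t \<and> y \<le> j"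
  proof (rule ccontr)
    assume "\<not> ?thesis"
    then have below: "j < y" if "(\<theta>, j) \<in> P" "\<theta> \<le> t" for \<theta> j using that by (meson not_le)
    obtain x where x: "0 < x" "x < y" using dense[OF y] by blast
    define F where "F = insert x (snd ` (P \<inter> {0..t} \<times> {x..}))"
    have finF: "finite F" unfolding F_def using fin[OF x(1)] by simp
    have "Max F \<in> F" by (rule Max_in[OF finF]) (simp add: F_def)
    then have "Max F < y" using x(2) below by (auto simp: F_def)
    moreover have "running_sup P t \<le> Max F"
    proof (rule running_sup_least)
      have "x \<le> Max F" by (rule Max_ge[OF finF]) (simp add: F_def)
      then show "0 \<le> Max F" using x(1) by simp
      fix \<theta> j assume p: "(\<theta>, j) \<in> P" "\<theta> \<le> t"
      show "j \<le> Max F"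
      proof (cases "x \<le> j")
        case True
        have "(\<theta>, j) \<in> P \<inter> {0..t} \<times> {x..}" using p P True by auto
        then have "j \<in> F" unfolding F_def by force
        then show ?thesis by (rule Max_ge[OF finF])
      next
        case False
        then show ?thesis using \<open>x \<le> Max F\<close> by simp
      qed
    qed
    ultimately show False using le by simp
  qed
qed

lemma level_path_running_sup:
  assumes P: "P \<subseteq> {0..} \<times> {0<..}" and fin: "\<And>T y. 0 < y \<Longrightarrow> finite (P \<inter> {0..T} \<times> {y..})"
  shows "level_path (running_sup P)"
  unfolding level_path_def
proof (intro conjI allI impI)
  show "0 \<le> running_sup P t" for t by (rule running_sup_nonneg)
next
  fix y :: ereal assume y: "0 < y"
  note att = running_sup_attained[OF P fin y]
  show "(\<forall>t\<ge>0. running_sup P t < y) \<or> (\<exists>s. passes_at (running_sup P) y s)"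
  proof (cases "\<forall>t\<ge>0. running_sup P t < y")
    case False
    then obtain t where t: "0 \<le> t" "y \<le> running_sup P t" by (meson not_le)
    define F where "F = fst ` (P \<inter> {0..t} \<times> {y..})"
    have finF: "finite F" unfolding F_def using fin[OF y] by simp
    have neF: "F \<noteq> {}" using t att[of t] P by (force simp: F_def)
    have "Min F \<in> F" by (rule Min_in[OF finF neF])
    then obtain j where j: "(Min F, j) \<in> P" "0 \<le> Min F" "Min F \<le> t" "y \<le> j" by (auto simp: F_def)
    have "passes_at (running_sup P) y (Min F)"
      unfolding passes_at_def
    proof (intro conjI allI impI iffI)
      fix r assume "0 \<le> r" "y \<le> running_sup P r"
      then obtain \<theta> i where p: "(\<theta>, i) \<in> P" "\<theta> \<le> r" "y \<le> i" using att by blast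
      show "Min F \<le> r"
      proof (cases "\<theta> \<le> t")
        case True
        then have "\<theta> \<in> F" using p P by (force simp: F_def)
        then have "Min F \<le> \<theta>" by (rule Min_le[OF finF])
        then show ?thesis using p(2) by simp
      next
        case False
        then show ?thesis using p(2) j(3) by simp
      qed
    next
      fix r assume "Min F \<le> r"
      then show "y \<le> running_sup P r" using att j by blast
    qed (rule j(2))
    then show ?thesis by blast
  qed simp
next
  fix T :: real
  define F where "F = real_of_ereal ` snd ` (P \<inter> {0..T} \<times> {1..})"
  have finF: "finite F" unfolding F_def using fin[of 1] by simp
  obtain K :: nat where K: "Max (insert 1 F) \<le> real K" using real_arch_simple by blast
  show "\<exists>K::nat. \<forall>t\<in>{0..T}. running_sup P t \<noteq> \<infinity> \<longrightarrow> running_sup P t \<le> ereal K"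
  proof (intro exI[of _ K] ballI impI)
    fix t assume t: "t \<in> {0..T}" and fin_t: "running_sup P t \<noteq> \<infinity>"
    have K1: "1 \<le> real K" using K finF by simp
    show "running_sup P t \<le> ereal K"
    proof (rule running_sup_least)
      show "0 \<le> ereal (real K)" by simp
      fix \<theta> j assume p: "(\<theta>, j) \<in> P" "\<theta> \<le> t"
      show "j \<le> ereal K"
      proof (cases "1 \<le> j")
        case True
        have "j \<noteq> \<infinity>" using running_sup_upper[OF p] fin_t by auto
        then obtain r where r: "j = ereal r" using True by (cases j) auto
        have "(\<theta>, j) \<in> P \<inter> {0..T} \<times> {1..}" using p P True t by auto
        then have "r \<in> F" unfolding F_def r by force
        then have "r \<le> Max (insert 1 F)" using finF by (intro Max_ge) auto
        then show ?thesis using K r by simp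
      next
        case False
        then have "j \<le> 1" by simp
        also have "1 \<le> ereal (real K)" using K1 by simp
        finally show ?thesis .
      qed
    qed
  qed
qed

section \<open>The atoms of a point measure\<close>

lemma point_measure_atoms:
  fixes m :: "'a::t2_space measure"
  assumes N: "point_measure_on m N" and single: "\<And>p. p \<in> space m \<Longrightarrow> {p} \<in> sets m"
  shows point_measure_null_iff: "\<And>A. A \<in> sets m \<Longrightarrow> emeasure N A = 0 \<longleftrightarrow> atoms N \<inter> A = {}"
    and point_measure_finite: "\<And>K. compact K \<Longrightarrow> K \<in> sets m \<Longrightarrow> finite (atoms N \<inter> K)"
    and atoms_subset: "atoms N \<subseteq> space m"
proof -
  obtain I :: "nat set" and z where z: "z \<in> I \<rightarrow> space m" and N_eq: "N = distr (count_space I) m z"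
    and comp: "\<And>K. compact K \<and> K \<subseteq> space m \<Longrightarrow> emeasure N K < \<infinity>"
    using N unfolding point_measure_on_def by blast
  have z_meas: "z \<in> measurable (count_space I) m" using z by simp
  have em: "emeasure N A = emeasure (count_space I) {i \<in> I. z i \<in> A}" if "A \<in> sets m" for A
  proof -
    have "z -` A \<inter> space (count_space I) = {i \<in> I. z i \<in> A}" by auto
    then show ?thesis unfolding N_eq using emeasure_distr[OF z_meas that] by simp
  qed
  have zero: "emeasure N A = 0 \<longleftrightarrow> (\<forall>i\<in>I. z i \<notin> A)" if "A \<in> sets m" for A
    unfolding em[OF that] by (subst emeasure_count_space_eq_0) auto
  have space_N: "space N = space m" by (simp add: N_eq)
  have atoms_eq: "atoms N = z ` I"
  proof (intro equalityI subsetI)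
    fix p assume "p \<in> atoms N"
    then have "p \<in> space m" "emeasure N {p} \<noteq> 0" by (auto simp: atoms_def space_N)
    then show "p \<in> z ` I" using zero[OF single] by auto
  next
    fix p assume "p \<in> z ` I"
    then obtain i where i: "i \<in> I" "p = z i" by blast
    then have p: "p \<in> space m" using z by auto
    then have "emeasure N {p} \<noteq> 0" using zero[OF single[OF p]] i by auto
    then show "p \<in> atoms N" using p by (simp add: atoms_def space_N)
  qed
  show "emeasure N A = 0 \<longleftrightarrow> atoms N \<inter> A = {}" if "A \<in> sets m" for A
    unfolding zero[OF that] atoms_eq by auto
  show "atoms N \<subseteq> space m" by (auto simp: atoms_def space_N)
  show "finite (atoms N \<inter> K)" if K: "compact K" "K \<in> sets m" for K
  proof -
    have "emeasure N K < \<infinity>" using comp K sets.sets_into_space by blast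
    then have "emeasure (count_space I) {i \<in> I. z i \<in> K} < \<infinity>" using em[OF K(2)] by simp
    then have "finite {i \<in> I. z i \<in> K}" by (subst (asm) emeasure_count_space) (auto split: if_splits)
    then have "finite (z ` {i \<in> I. z i \<in> K})" by simp
    moreover have "atoms N \<inter> K \<subseteq> z ` {i \<in> I. z i \<in> K}" unfolding atoms_eq by auto
    ultimately show ?thesis by (rule finite_subset[rotated])
  qed
qed

section \<open>The Poisson random measure and its extremal process\<close>

locale poisson_extremal =
  fixes Q :: "'b measure" and N :: "'b \<Rightarrow> (real \<times> ereal) measure" and \<mu> :: "ereal measure" and \<beta> :: real
  assumes \<beta>: "0 < \<beta>"
    and sets_\<mu>: "sets \<mu> = sets (restrict_space borel {0<..})"
    and tail_\<mu>: "\<And>x::real. x > 0 \<Longrightarrow> emeasure \<mu> {ereal x<..} = ennreal (x powr (-\<beta>))"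
    and prm: "poisson_random_measure Q N (restrict_space lborel {0..} \<Otimes>\<^sub>M \<mu>)"
begin

sublocale prob_space Q
  using prm by (simp add: poisson_random_measure_def)

abbreviation mean :: "(real \<times> ereal) measure" where
  "mean \<equiv> restrict_space lborel {0..} \<Otimes>\<^sub>M \<mu>"

abbreviation points :: "'b \<Rightarrow> (real \<times> ereal) set" where
  "points \<omega> \<equiv> atoms (N \<omega>)"

lemma space_\<mu>: "space \<mu> = {0<..}"
  using sets_eq_imp_space_eq[OF sets_\<mu>] by (simp add: space_restrict_space)

lemma space_mean: "space mean = {0..} \<times> {0<..}"
  by (simp add: space_pair_measure space_restrict_space space_\<mu>)

lemma in_sets_\<mu>: "B \<in> sets borel \<Longrightarrow> B \<subseteq> {0<..} \<Longrightarrow> B \<in> sets \<mu>"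
  unfolding sets_\<mu> by (subst sets_restrict_space_iff) auto

lemma rectangle_in_sets:
  assumes "A \<in> sets borel" "A \<subseteq> {0..}" "B \<in> sets borel" "B \<subseteq> {0<..}"
  shows "A \<times> B \<in> sets mean"
proof (rule pair_measureI)
  show "A \<in> sets (restrict_space lborel {0..})" using assms(1,2) by (subst sets_restrict_space_iff) auto
  show "B \<in> sets \<mu>" using assms(3,4) by (rule in_sets_\<mu>)
qed

lemma sigma_finite_\<mu>: "sigma_finite_measure \<mu>"
proof
  show "\<exists>A. countable A \<and> A \<subseteq> sets \<mu> \<and> \<Union>A = space \<mu> \<and> (\<forall>a\<in>A. emeasure \<mu> a \<noteq> \<infinity>)"
  proof (intro exI[of _ "range (\<lambda>k::nat. {ereal (1 / Suc k)<..})"] conjI)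
    show "range (\<lambda>k::nat. {ereal (1 / Suc k)<..}) \<subseteq> sets \<mu>"
      by (auto intro!: in_sets_\<mu> less_trans[of 0])
    show "\<Union> (range (\<lambda>k::nat. {ereal (1 / Suc k)<..})) = space \<mu>"
    proof (intro equalityI subsetI)
      fix y assume "y \<in> \<Union> (range (\<lambda>k::nat. {ereal (1 / Suc k)<..}))"
      then obtain k :: nat where "ereal (1 / Suc k) < y" by auto
      moreover have "0 < ereal (1 / Suc k)" by simp
      ultimately have "0 < y" by (rule less_trans[rotated])
      then show "y \<in> space \<mu>" by (simp add: space_\<mu>)
    next
      fix y assume "y \<in> space \<mu>"
      then have "0 < y" by (simp add: space_\<mu>)
      then obtain r where r: "0 < ereal r" "ereal r < y" using ereal_dense2 by blast
      then obtain k :: nat where "1 / real (Suc k) < r"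
        using reals_Archimedean[of r] by (auto simp: inverse_eq_divide)
      then have "ereal (1 / Suc k) < y" using r(2) by (meson ereal_less(2) less_ereal.simps(1) less_trans)
      then show "y \<in> \<Union> (range (\<lambda>k::nat. {ereal (1 / Suc k)<..}))" by auto
    qed
    show "\<forall>a\<in>range (\<lambda>k::nat. {ereal (1 / Suc k)<..}). emeasure \<mu> a \<noteq> \<infinity>"
    proof
      fix a assume "a \<in> range (\<lambda>k::nat. {ereal (1 / Suc k)<..})"
      then obtain k :: nat where "a = {ereal (1 / Suc k)<..}" by blast
      then show "emeasure \<mu> a \<noteq> \<infinity>" using tail_\<mu>[of "1 / Suc k"] by simp
    qed
  qed simp
qed

sublocale \<mu>: sigma_finite_measure \<mu>
  by (rule sigma_finite_\<mu>)

lemma emeasure_rectangle: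
  assumes "A \<in> sets borel" "A \<subseteq> {0..}" "B \<in> sets borel" "B \<subseteq> {0<..}"
  shows "emeasure mean (A \<times> B) = emeasure lborel A * emeasure \<mu> B"
proof -
  have A: "A \<in> sets (restrict_space lborel {0..})"
    using assms(1,2) by (subst sets_restrict_space_iff) auto
  have "emeasure mean (A \<times> B) = emeasure (restrict_space lborel {0..}) A * emeasure \<mu> B"
    by (rule \<mu>.emeasure_pair_measure_Times[OF A in_sets_\<mu>[OF assms(3,4)]])
  also have "emeasure (restrict_space lborel {0..}) A = emeasure lborel A"
    by (rule emeasure_restrict_space) (use assms(2) in auto)
  finally show ?thesis .
qed

lemma \<mu>_total: "emeasure \<mu> {0<..} = \<infinity>"
proof (rule ccontr)
  assume "emeasure \<mu> {0<..} \<noteq> \<infinity>"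
  then obtain r where r: "0 \<le> r" "emeasure \<mu> {0<..} = ennreal r"
    by (cases "emeasure \<mu> {0<..}") (auto simp: top_ennreal_def[symmetric])
  \<comment> \<open>A level whose tail mass is \<open>r + 1\<close>.\<close>
  define x where "x = (r + 1) powr (- 1 / \<beta>)"
  have x: "0 < x" using r(1) by (simp add: x_def)
  have "x powr (- \<beta>) = r + 1" using r(1) \<beta> by (simp add: x_def powr_powr)
  moreover have "emeasure \<mu> {ereal x<..} \<le> emeasure \<mu> {0<..}"
    using x by (intro emeasure_mono in_sets_\<mu>) (auto intro: less_trans)
  ultimately have "ennreal (r + 1) \<le> ennreal r" using tail_\<mu>[OF x] r(2) by simp
  then show False using r(1) by (simp add: ennreal_le_iff)
qed

lemma \<mu>_infinity: "emeasure \<mu> {\<infinity>} = 0"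
proof -
  have "emeasure \<mu> {\<infinity>} \<le> ennreal (x powr (- \<beta>))" if x: "0 < x" for x
  proof -
    have "emeasure \<mu> {\<infinity>} \<le> emeasure \<mu> {ereal x<..}"
      using x by (intro emeasure_mono in_sets_\<mu>) (auto intro: less_trans)
    then show ?thesis using tail_\<mu>[OF x] by simp
  qed
  then have "\<forall>\<^sub>F x in at_top. emeasure \<mu> {\<infinity>} \<le> ennreal (x powr (- \<beta>))"
    by (intro eventually_mono[OF eventually_gt_at_top[of "0::real"]])
  moreover have "((\<lambda>x. ennreal (x powr (- \<beta>))) \<longlongrightarrow> ennreal 0) at_top"
    by (intro tendsto_ennrealI tendsto_neg_powr filterlim_ident) (use \<beta> in auto)
  ultimately have "emeasure \<mu> {\<infinity>} \<le> ennreal 0"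
    by (intro tendsto_lowerbound) auto
  then show ?thesis by simp
qed

lemma points_properties:
  assumes \<omega>: "\<omega> \<in> space Q"
  shows points_null_iff: "\<And>A. A \<in> sets mean \<Longrightarrow> emeasure (N \<omega>) A = 0 \<longleftrightarrow> points \<omega> \<inter> A = {}"
    and points_subset: "points \<omega> \<subseteq> {0..} \<times> {0<..}"
    and points_finite: "\<And>y T. 0 < y \<Longrightarrow> finite (points \<omega> \<inter> {0..T} \<times> {y..})"
proof -
  have pm: "point_measure_on mean (N \<omega>)" using prm \<omega> by (simp add: poisson_random_measure_def)
  have single: "{p} \<in> sets mean" if "p \<in> space mean" for p
  proof -
    have "{fst p} \<times> {snd p} \<in> sets mean"
      using that by (intro rectangle_in_sets) (auto simp: space_mean)
    then show ?thesis by simp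
  qed
  note atoms_facts = point_measure_atoms[OF pm single]
  show "emeasure (N \<omega>) A = 0 \<longleftrightarrow> points \<omega> \<inter> A = {}" if "A \<in> sets mean" for A
    by (rule atoms_facts(1)[OF _ that])
  show "points \<omega> \<subseteq> {0..} \<times> {0<..}" using atoms_facts(3) by (simp only: space_mean)
  show "finite (points \<omega> \<inter> {0..T} \<times> {y..})" if y: "0 < y" for y T
  proof (rule atoms_facts(2))
    have "compact ({y..} \<inter> UNIV)" by (rule closed_Int_compact[OF closed_atLeast compact_UNIV])
    then show "compact ({0..T} \<times> {y..})" by (intro compact_Times compact_Icc) simp
    show "{0..T} \<times> {y..} \<in> sets mean"
      using y by (intro rectangle_in_sets) (auto intro: less_le_trans)
  qed
qed

lemma void_event: "A \<in> sets mean \<Longrightarrow> {\<omega> \<in> space Q. points \<omega> \<inter> A = {}} \<in> sets Q"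
proof -
  assume A: "A \<in> sets mean"
  have "(\<lambda>\<omega>. emeasure (N \<omega>) A) \<in> borel_measurable Q"
    using prm A by (simp add: poisson_random_measure_def)
  then have "(\<lambda>\<omega>. emeasure (N \<omega>) A) -` {0} \<inter> space Q \<in> sets Q" by (rule measurable_sets) simp
  also have "(\<lambda>\<omega>. emeasure (N \<omega>) A) -` {0} \<inter> space Q = {\<omega> \<in> space Q. points \<omega> \<inter> A = {}}"
    using points_null_iff[OF _ A] by auto
  finally show ?thesis .
qed

lemma void_probability:
  assumes A: "A \<in> sets mean" and a: "emeasure mean A = ennreal a" "0 \<le> a"
  shows "prob {\<omega> \<in> space Q. points \<omega> \<inter> A = {}} = exp (- a)"
proof -
  have "\<forall>A\<in>sets mean. emeasure mean A < \<infinity> \<longrightarrow> (\<forall>k::nat. \<P>(\<omega> in Q. emeasure (N \<omega>) A = of_nat k)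
      = exp (- measure mean A) * measure mean A ^ k / fact k)"
    using prm unfolding poisson_random_measure_def by (elim conjE)
  moreover have "emeasure mean A < \<infinity>" using a by simp
  ultimately have "\<P>(\<omega> in Q. emeasure (N \<omega>) A = of_nat 0)
      = exp (- measure mean A) * measure mean A ^ 0 / fact 0"
    using A by blast
  moreover have "measure mean A = a" using a by (simp add: measure_def)
  moreover have "{\<omega> \<in> space Q. emeasure (N \<omega>) A = of_nat 0} = {\<omega> \<in> space Q. points \<omega> \<inter> A = {}}"
    using points_null_iff[OF _ A] by auto
  ultimately show ?thesis by simp
qed

lemma AE_void:
  assumes A: "A \<in> sets mean" and "emeasure mean A = 0"
  shows "AE \<omega> in Q. points \<omega> \<inter> A = {}"
proof -
  have "prob {\<omega> \<in> space Q. points \<omega> \<inter> A = {}} = 1"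
    using void_probability[OF A, of 0] assms by simp
  then show ?thesis using void_event[OF A] by (subst (asm) prob_Collect_eq_1) auto
qed

lemma AE_not_void:
  assumes A: "A \<in> sets mean" and "emeasure mean A = \<infinity>"
  shows "AE \<omega> in Q. points \<omega> \<inter> A \<noteq> {}"
proof -
  have "AE \<omega> in Q. emeasure (N \<omega>) A = \<infinity>" using prm assms by (simp add: poisson_random_measure_def)
  then show ?thesis
  proof (rule AE_mp, intro AE_I2 impI)
    fix \<omega> assume "\<omega> \<in> space Q" "emeasure (N \<omega>) A = \<infinity>"
    then show "points \<omega> \<inter> A \<noteq> {}" using points_null_iff[OF _ A, of \<omega>] by auto
  qed
qed

lemma void_independent:
  fixes A :: "nat \<Rightarrow> (real \<times> ereal) set"
  assumes A: "\<And>i. A i \<in> sets mean" and disj: "disjoint_family_on A {..<n}"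
  shows "prob {\<omega> \<in> space Q. \<forall>i<n. points \<omega> \<inter> A i = {}}
    = (\<Prod>i<n. prob {\<omega> \<in> space Q. points \<omega> \<inter> A i = {}})"
proof (cases "n = 0")
  case False
  have ind: "indep_vars (\<lambda>_. borel) (\<lambda>i \<omega>. emeasure (N \<omega>) (A i)) {..<n}"
    using prm A disj by (simp add: poisson_random_measure_def)
  have void: "(\<lambda>\<omega>. emeasure (N \<omega>) (A i)) -` {0} \<inter> space Q = {\<omega> \<in> space Q. points \<omega> \<inter> A i = {}}" for i
    using points_null_iff[OF _ A[of i]] by auto
  have "prob (\<Inter>i\<in>{..<n}. (\<lambda>\<omega>. emeasure (N \<omega>) (A i)) -` {0} \<inter> space Q)
      = (\<Prod>i\<in>{..<n}. prob ((\<lambda>\<omega>. emeasure (N \<omega>) (A i)) -` {0} \<inter> space Q))"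
    by (rule indep_varsD_finite[OF ind]) (use False in auto)
  moreover have "(\<Inter>i\<in>{..<n}. {\<omega> \<in> space Q. points \<omega> \<inter> A i = {}})
      = {\<omega> \<in> space Q. \<forall>i<n. points \<omega> \<inter> A i = {}}" using False by auto
  ultimately show ?thesis unfolding void by simp
qed (simp add: prob_space)

lemma level_path_points: "\<omega> \<in> space Q \<Longrightarrow> level_path (running_sup (points \<omega>))"
  by (rule level_path_running_sup[OF points_subset points_finite])

lemma extremal_process_eq: "extremal_process N \<omega> = real_path (running_sup (points \<omega>))"
  by (simp add: extremal_process_def real_path_def running_sup_def)

lemma extremal_process_measurable:
  "extremal_process N \<in> measurable Q (borel_algebra_of skorokhod_J1)"
proof -
  have "(\<lambda>\<omega>. real_path (running_sup (points \<omega>))) \<in> measurable Q (borel_algebra_of skorokhod_J1)"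
  proof (rule level_paths_measurable[OF level_path_points])
    fix y :: ereal and t :: real assume y: "0 < y" and t: "0 \<le> t"
    have A: "{0..t} \<times> {y..} \<in> sets mean"
      using y by (intro rectangle_in_sets) (auto intro: less_le_trans)
    have "{\<omega> \<in> space Q. y \<le> running_sup (points \<omega>) t} = space Q - {\<omega> \<in> space Q. points \<omega> \<inter> {0..t} \<times> {y..} = {}}"
    proof (rule Collect_eqI[THEN trans])
      fix \<omega>
      show "(\<omega> \<in> space Q \<and> y \<le> running_sup (points \<omega>) t) =
        (\<omega> \<in> space Q \<and> \<not> points \<omega> \<inter> {0..t} \<times> {y..} = {})"
      proof (rule conj_cong[OF refl])
        assume \<omega>: "\<omega> \<in> space Q"
        have "y \<le> running_sup (points \<omega>) t \<longleftrightarrow> (\<exists>\<theta> j. (\<theta>, j) \<in> points \<omega> \<and> \<theta> \<le> t \<and> y \<le> j)"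
          by (rule running_sup_attained[OF points_subset[OF \<omega>] points_finite[OF \<omega>] y])
        also have "\<dots> \<longleftrightarrow> \<not> points \<omega> \<inter> {0..t} \<times> {y..} = {}"
          using points_subset[OF \<omega>] by fastforce
        finally show "y \<le> running_sup (points \<omega>) t \<longleftrightarrow> \<not> points \<omega> \<inter> {0..t} \<times> {y..} = {}" .
      qed
    qed auto
    also have "\<dots> \<in> sets Q" using void_event[OF A] by auto
    finally show "{\<omega> \<in> space Q. y \<le> running_sup (points \<omega>) t} \<in> sets Q" .
  qed
  then show ?thesis by (simp add: extremal_process_eq[abs_def])
qed

subsection \<open>Maxima over time strips\<close>

definition strip :: "nat \<Rightarrow> nat \<Rightarrow> real set" where
  "strip n k = {real k / real n<..(real k + 1) / real n}"

definition strip_max :: "nat \<Rightarrow> nat \<Rightarrow> 'b \<Rightarrow> ereal" where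
  "strip_max n k \<omega> = running_sup (points \<omega> \<inter> strip n k \<times> UNIV) ((real k + 1) / real n)"

lemma strip_nonneg: "strip n k \<subseteq> {0..}"
proof
  fix t assume "t \<in> strip n k"
  then have "real k / real n < t" by (simp add: strip_def)
  moreover have "0 \<le> real k / real n" by simp
  ultimately have "0 \<le> t" by linarith
  then show "t \<in> {0..}" by simp
qed

lemma strip_borel: "strip n k \<in> sets borel"
  by (simp add: strip_def)

lemma strip_disjoint: "i < k \<Longrightarrow> strip n i \<inter> strip n k = {}"
proof -
  assume "i < k"
  then have "(real i + 1) / real n \<le> real k / real n" by (intro divide_right_mono) auto
  then show ?thesis by (auto simp: strip_def)
qed

lemma emeasure_strip: "0 < n \<Longrightarrow> emeasure lborel (strip n k) = ennreal (1 / real n)"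
  by (simp add: strip_def divide_right_mono diff_divide_distrib[symmetric])

lemma strip_max_le_iff:
  assumes "0 \<le> c"
  shows "strip_max n k \<omega> \<le> c \<longleftrightarrow> points \<omega> \<inter> strip n k \<times> {c<..} = {}"
proof
  assume le: "strip_max n k \<omega> \<le> c"
  show "points \<omega> \<inter> strip n k \<times> {c<..} = {}"
  proof (rule ccontr)
    assume "points \<omega> \<inter> strip n k \<times> {c<..} \<noteq> {}"
    then obtain \<theta> j where p: "(\<theta>, j) \<in> points \<omega>" "\<theta> \<in> strip n k" "c < j" by auto
    then have "j \<le> strip_max n k \<omega>"
      unfolding strip_max_def by (intro running_sup_upper[of \<theta>]) (auto simp: strip_def)
    then show False using le p(3) by simp
  qed
next
  assume empty: "points \<omega> \<inter> strip n k \<times> {c<..} = {}"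
  show "strip_max n k \<omega> \<le> c"
    unfolding strip_max_def
  proof (rule running_sup_least[OF assms])
    fix \<theta> j assume "(\<theta>, j) \<in> points \<omega> \<inter> strip n k \<times> UNIV"
    then show "j \<le> c" using empty by (auto simp: not_less[symmetric])
  qed
qed

lemma strip_max_measurable: "strip_max n k \<in> borel_measurable Q"
proof (rule borel_measurableI_greater)
  fix c :: ereal
  show "{\<omega> \<in> space Q. c < strip_max n k \<omega>} \<in> sets Q"
  proof (cases "0 \<le> c")
    case True
    have "{\<omega> \<in> space Q. c < strip_max n k \<omega>}
        = space Q - {\<omega> \<in> space Q. points \<omega> \<inter> strip n k \<times> {c<..} = {}}"
      using strip_max_le_iff[OF True] by (auto simp: not_le[symmetric])
    moreover have "strip n k \<times> {c<..} \<in> sets mean"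
      using True by (intro rectangle_in_sets strip_borel strip_nonneg) auto
    ultimately show ?thesis using void_event by auto
  next
    case False
    then have "c < strip_max n k \<omega>" for \<omega>
      unfolding strip_max_def using running_sup_nonneg by (meson not_le order_less_le_trans)
    then show ?thesis by simp
  qed
qed

text \<open>
  These properties hold almost surely: time zero and height \<open>\<infinity>\<close> carry no intensity, and the intensity
  of small points in a strip is infinite.
\<close>
definition regular :: "'b \<Rightarrow> bool" where
  "regular \<omega> \<longleftrightarrow> points \<omega> \<inter> {0} \<times> {0<..} = {} \<and> points \<omega> \<inter> {0..} \<times> {\<infinity>} = {} \<and>
     (\<forall>n k. 0 < n \<longrightarrow> points \<omega> \<inter> strip n k \<times> {0<..} \<noteq> {})"

lemma AE_regular: "AE \<omega> in Q. regular \<omega>"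
  unfolding regular_def
proof (intro AE_conjI)
  show "AE \<omega> in Q. points \<omega> \<inter> {0} \<times> {0<..} = {}"
    by (rule AE_void) (auto intro!: rectangle_in_sets simp: emeasure_rectangle)
  show "AE \<omega> in Q. points \<omega> \<inter> {0..} \<times> {\<infinity>} = {}"
    by (rule AE_void) (auto intro!: rectangle_in_sets simp: emeasure_rectangle \<mu>_infinity)
  have "AE \<omega> in Q. 0 < n \<longrightarrow> points \<omega> \<inter> strip n k \<times> {0<..} \<noteq> {}" for n k
  proof (cases "0 < n")
    case True
    have "AE \<omega> in Q. points \<omega> \<inter> strip n k \<times> {0<..} \<noteq> {}"
    proof (rule AE_not_void)
      show "strip n k \<times> {0<..} \<in> sets mean"
        by (intro rectangle_in_sets strip_borel strip_nonneg) auto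
      have "emeasure mean (strip n k \<times> {0<..}) = ennreal (1 / real n) * \<infinity>"
        by (subst emeasure_rectangle[OF strip_borel strip_nonneg])
          (use True in \<open>auto simp: \<mu>_total emeasure_strip\<close>)
      then show "emeasure mean (strip n k \<times> {0<..}) = \<infinity>"
        using True by (simp add: ennreal_mult_top)
    qed
    then show ?thesis by simp
  qed simp
  then show "AE \<omega> in Q. \<forall>n k. 0 < n \<longrightarrow> points \<omega> \<inter> strip n k \<times> {0<..} \<noteq> {}"
    by (simp add: AE_all_countable)
qed

lemma strip_max_pos:
  assumes "regular \<omega>" "0 < n"
  shows "0 < strip_max n k \<omega>"
proof (rule ccontr)
  assume "\<not> 0 < strip_max n k \<omega>"
  then have "strip_max n k \<omega> \<le> 0" by simp
  then show False using assms by (subst (asm) strip_max_le_iff) (auto simp: regular_def)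
qed

lemma regular_running_sup_finite:
  assumes "\<omega> \<in> space Q" "regular \<omega>"
  shows "running_sup (points \<omega>) t \<noteq> \<infinity>"
proof
  assume "running_sup (points \<omega>) t = \<infinity>"
  then have "\<infinity> \<le> running_sup (points \<omega>) t" by simp
  then obtain \<theta> j where p: "(\<theta>, j) \<in> points \<omega>" "\<infinity> \<le> j"
    using running_sup_attained[OF points_subset[OF assms(1)] points_finite[OF assms(1)], of \<infinity> t] by auto
  then have "(\<theta>, j) \<in> points \<omega> \<inter> {0..} \<times> {\<infinity>}" using points_subset[OF assms(1)] by auto
  then show False using assms(2) by (auto simp: regular_def)
qed

lemma strip_max_le_running_sup:
  assumes "i \<le> k"
  shows "strip_max n i \<omega> \<le> running_sup (points \<omega>) ((real k + 1) / real n)"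
  unfolding strip_max_def
proof (rule running_sup_least[OF running_sup_nonneg])
  fix \<theta> j assume p: "(\<theta>, j) \<in> points \<omega> \<inter> strip n i \<times> UNIV" "\<theta> \<le> (real i + 1) / real n"
  have "(real i + 1) / real n \<le> (real k + 1) / real n" using assms by (intro divide_right_mono) auto
  with p show "j \<le> running_sup (points \<omega>) ((real k + 1) / real n)"
    by (intro running_sup_upper[of \<theta>]) auto
qed

lemma running_sup_eq_strip_max:
  assumes \<omega>: "\<omega> \<in> space Q" "regular \<omega>" and n: "0 < n"
  obtains i where "i \<le> k" "strip_max n i \<omega> = running_sup (points \<omega>) ((real k + 1) / real n)"
proof -
  let ?t = "(real k + 1) / real n"
  have n': "0 < real n" using n by simp
  have "0 < running_sup (points \<omega>) ?t"
    using strip_max_pos[OF \<omega>(2) n, of k] strip_max_le_running_sup[of k k n \<omega>] by (simp add: less_le_trans)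
  from running_sup_attained[OF points_subset[OF \<omega>(1)] points_finite[OF \<omega>(1)] this, of ?t]
  obtain \<theta> j where p: "(\<theta>, j) \<in> points \<omega>" "\<theta> \<le> ?t" "running_sup (points \<omega>) ?t \<le> j" by auto
  have "\<theta> \<noteq> 0" "0 \<le> \<theta>" using p(1) \<omega>(2) points_subset[OF \<omega>(1)] by (auto simp: regular_def)
  then have \<theta>: "0 < \<theta>" by simp
  \<comment> \<open>The strip containing \<open>\<theta>\<close>; strips are open on the left.\<close>
  define i where "i = nat (\<lceil>real n * \<theta>\<rceil> - 1)"
  have "0 < real n * \<theta>" using n' \<theta> by simp
  then have i: "real i < real n * \<theta>" "real n * \<theta> \<le> real i + 1" unfolding i_def by linarith+
  have "real n * \<theta> \<le> real k + 1" using p(2) n' by (simp add: pos_le_divide_eq mult.commute)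
  then have ik: "i \<le> k" using i(1) by linarith
  have "\<theta> \<in> strip n i"
    using i n' by (simp add: strip_def pos_le_divide_eq pos_divide_less_eq mult.commute)
  then have "j \<le> strip_max n i \<omega>"
    unfolding strip_max_def using p(1) by (intro running_sup_upper[of \<theta>]) (auto simp: strip_def)
  then have "strip_max n i \<omega> = running_sup (points \<omega>) ?t"
    using p(3) strip_max_le_running_sup[OF ik, of n \<omega>] by (intro antisym) auto
  then show thesis using that ik by blast
qed

end

section \<open>Transport of the jumps\<close>

definition quantile :: "real measure \<Rightarrow> real \<Rightarrow> real" where
  "quantile D u = Inf {x. u \<le> cdf D x}"

lemma quantile_le_iff:
  assumes "real_distribution D" "0 < u" "u < 1"
  shows "quantile D u \<le> x \<longleftrightarrow> u \<le> cdf D x"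
proof -
  interpret cdf_distribution D using assms(1) by (simp add: cdf_distribution_def)
  show ?thesis unfolding quantile_def by (rule pseudoinverse[OF assms(2,3), symmetric])
qed

text \<open>
  The maximum over a strip of length \<open>1 / n\<close> has the Frechet distribution function
  \<open>exp (- y\<^sup>-\<^sup>\<beta> / n)\<close>.  The map below carries this law to \<open>D\<close>; being nondecreasing, it commutes
  with taking maxima.
\<close>
definition transport :: "real measure \<Rightarrow> real \<Rightarrow> nat \<Rightarrow> real \<Rightarrow> real" where
  "transport D \<beta> n y = (if 0 < y then quantile D (exp (- (y powr - \<beta>) / real n)) else 0)"

lemma transport_le_iff:
  assumes "real_distribution D" "0 < y" "0 < n"
  shows "transport D \<beta> n y \<le> x \<longleftrightarrow> exp (- (y powr - \<beta>) / real n) \<le> cdf D x"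
  using assms unfolding transport_def by (simp add: quantile_le_iff)

lemma transport_mono:
  assumes D: "real_distribution D" and \<beta>: "0 < \<beta>" and n: "0 < n" and y: "0 < y" "y \<le> y'"
  shows "transport D \<beta> n y \<le> transport D \<beta> n y'"
proof -
  have "exp (- (y' powr - \<beta>) / real n) \<le> cdf D (transport D \<beta> n y')"
    using transport_le_iff[OF D _ n, of y'] y by auto
  moreover have "y' powr - \<beta> \<le> y powr - \<beta>" using y \<beta> by (intro powr_mono2') auto
  then have "exp (- (y powr - \<beta>) / real n) \<le> exp (- (y' powr - \<beta>) / real n)"
    by (simp add: divide_right_mono)
  ultimately show ?thesis using transport_le_iff[OF D y(1) n] by (meson order_trans)
qed

lemma transport_measurable:
  assumes D: "real_distribution D" and \<beta>: "0 < \<beta>" and n: "0 < n"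
  shows "transport D \<beta> n \<in> borel_measurable borel"
proof -
  have "mono_on {0<..} (transport D \<beta> n)"
    by (rule mono_onI) (rule transport_mono[OF D \<beta> n], auto)
  then have "transport D \<beta> n \<in> borel_measurable (restrict_space borel {0<..})"
    by (rule borel_measurable_mono_on_fnc)
  moreover have "(\<lambda>y. indicator {0<..} y *\<^sub>R transport D \<beta> n y) = transport D \<beta> n"
    by (rule ext) (simp add: transport_def indicator_def)
  ultimately show ?thesis
    by (subst (asm) borel_measurable_restrict_space_iff) simp_all
qed

lemma neg_divide_le_iff:
  fixes w L r :: real
  assumes "0 < r"
  shows "- w / r \<le> L \<longleftrightarrow> - r * L \<le> w"
proof -
  have "- w / r \<le> L \<longleftrightarrow> - w \<le> L * r" by (rule pos_divide_le_eq[OF assms])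
  also have "\<dots> \<longleftrightarrow> - r * L \<le> w" by (simp add: mult.commute) linarith
  finally show ?thesis .
qed

lemma transport_le_iff_le:
  assumes D: "real_distribution D" and \<beta>: "0 < \<beta>" and n: "0 < n" and y: "0 < y"
    and G: "0 < cdf D x" "cdf D x < 1"
  shows "transport D \<beta> n y \<le> x \<longleftrightarrow> y \<le> (- real n * ln (cdf D x)) powr (- 1 / \<beta>)"
proof -
  define a where "a = - real n * ln (cdf D x)"
  have a: "0 < a" using n G by (simp add: a_def ln_less_zero mult_pos_neg)
  have "transport D \<beta> n y \<le> x \<longleftrightarrow> - (y powr - \<beta>) / real n \<le> ln (cdf D x)"
    using transport_le_iff[OF D y n] G(1) by (simp add: ln_ge_iff)
  also have "\<dots> \<longleftrightarrow> a \<le> y powr - \<beta>"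
    unfolding a_def by (rule neg_divide_le_iff) (use n in simp)
  also have "\<dots> \<longleftrightarrow> y \<le> a powr (- 1 / \<beta>)"
  proof
    assume "a \<le> y powr - \<beta>"
    then have "(y powr - \<beta>) powr (- 1 / \<beta>) \<le> a powr (- 1 / \<beta>)"
      using a \<beta> by (intro powr_mono2') auto
    then show "y \<le> a powr (- 1 / \<beta>)" using y \<beta> by (simp add: powr_powr)
  next
    assume "y \<le> a powr (- 1 / \<beta>)"
    then have "(a powr (- 1 / \<beta>)) powr - \<beta> \<le> y powr - \<beta>"
      using y \<beta> by (intro powr_mono2') auto
    then show "a \<le> y powr - \<beta>" using a \<beta> by (simp add: powr_powr)
  qed
  finally show ?thesis by (simp only: a_def)
qed

lemma ln_one_minus_scaling:
  fixes p :: "nat \<Rightarrow> real"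
  assumes lim: "(\<lambda>n. real n * p n) \<longlonglongrightarrow> a" and p: "\<And>n. 0 \<le> p n" "\<And>n. p n \<le> 1"
  shows "(\<lambda>n. - real n * ln (1 - p n)) \<longlonglongrightarrow> a" and "\<forall>\<^sub>F n in sequentially. p n < 1"
proof -
  have "(\<lambda>n. real n * p n * (1 / real n)) \<longlonglongrightarrow> a * 0"
    by (rule tendsto_mult[OF lim]) real_asymp
  moreover have "\<forall>\<^sub>F n in sequentially. real n * p n * (1 / real n) = p n"
    using eventually_gt_at_top[of "0::nat"] by eventually_elim simp
  ultimately have p0: "p \<longlonglongrightarrow> 0" using Lim_transform_eventually by fastforce
  then show lt: "\<forall>\<^sub>F n in sequentially. p n < 1" by (rule order_tendstoD(2)) simp
  have "(\<lambda>n. real n * p n / (1 - p n)) \<longlonglongrightarrow> a / (1 - 0)"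
    by (intro tendsto_divide lim tendsto_diff tendsto_const p0) simp
  then have up: "(\<lambda>n. real n * p n / (1 - p n)) \<longlonglongrightarrow> a" by simp
  show "(\<lambda>n. - real n * ln (1 - p n)) \<longlonglongrightarrow> a"
  proof (rule tendsto_sandwich[OF _ _ lim up])
    show "\<forall>\<^sub>F n in sequentially. real n * p n \<le> - real n * ln (1 - p n)"
      using lt
    proof eventually_elim
      case (elim n)
      then have "ln (1 - p n) \<le> - p n" using ln_le_minus_one[of "1 - p n"] by simp
      then have "real n * ln (1 - p n) \<le> real n * - p n" by (rule mult_left_mono) simp
      then show ?case by simp
    qed
    show "\<forall>\<^sub>F n in sequentially. - real n * ln (1 - p n) \<le> real n * p n / (1 - p n)"
      using lt
    proof eventually_elim
      case (elim n)
      then have "ln (1 / (1 - p n)) \<le> 1 / (1 - p n) - 1" by (intro ln_le_minus_one) simp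
      also have "1 / (1 - p n) - 1 = p n / (1 - p n)" using elim by (simp add: field_simps)
      also have "ln (1 / (1 - p n)) = - ln (1 - p n)" using elim by (simp add: ln_div)
      finally have "real n * - ln (1 - p n) \<le> real n * (p n / (1 - p n))" by (rule mult_left_mono) simp
      then show ?case by simp
    qed
  qed
qed

text \<open>After scaling the transport is asymptotically the identity; this is where the tail of \<open>D\<close> enters.\<close>
lemma transport_scaled_tendsto:
  assumes D: "real_distribution D" and \<beta>: "0 < \<beta>" and b: "\<And>n. 0 < n \<Longrightarrow> 0 < b n"
    and tail: "\<And>x. 0 < x \<Longrightarrow> (\<lambda>n. real n * (1 - cdf D (x * b n))) \<longlonglongrightarrow> x powr - \<beta>"
    and lt1: "\<And>x. cdf D x < 1" and y: "0 < y"
  shows "(\<lambda>n. transport D \<beta> n y / b n) \<longlonglongrightarrow> y"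
proof -
  interpret real_distribution D by (rule D)
  have key: "\<forall>\<^sub>F n in sequentially. (transport D \<beta> n y / b n \<le> x \<longleftrightarrow> - real n * ln (cdf D (x * b n)) \<le> y powr - \<beta>)"
    and lim: "(\<lambda>n. - real n * ln (cdf D (x * b n))) \<longlonglongrightarrow> x powr - \<beta>" if x: "0 < x" for x
  proof -
    define p where "p n = 1 - cdf D (x * b n)" for n
    have p: "0 \<le> p n" "p n \<le> 1" for n
      using cdf_nonneg[of "x * b n"] cdf_bounded_prob[of "x * b n"] by (auto simp: p_def)
    note scal = ln_one_minus_scaling[of p "x powr - \<beta>", OF _ p]
    have "(\<lambda>n. real n * p n) \<longlonglongrightarrow> x powr - \<beta>" using tail[OF x] by (simp add: p_def)
    from scal[OF this] show "(\<lambda>n. - real n * ln (cdf D (x * b n))) \<longlonglongrightarrow> x powr - \<beta>"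
      by (simp add: p_def)
    from scal(2)[OF \<open>(\<lambda>n. real n * p n) \<longlonglongrightarrow> x powr - \<beta>\<close>] eventually_gt_at_top[of "0::nat"]
    show "\<forall>\<^sub>F n in sequentially. (transport D \<beta> n y / b n \<le> x \<longleftrightarrow> - real n * ln (cdf D (x * b n)) \<le> y powr - \<beta>)"
    proof eventually_elim
      case (elim n)
      have G: "0 < cdf D (x * b n)" using elim(1) by (simp add: p_def)
      have "transport D \<beta> n y / b n \<le> x \<longleftrightarrow> transport D \<beta> n y \<le> x * b n"
        using b[OF elim(2)] by (simp add: pos_divide_le_eq)
      also have "\<dots> \<longleftrightarrow> - (y powr - \<beta>) / real n \<le> ln (cdf D (x * b n))"
        using transport_le_iff[OF D y elim(2)] G by (simp add: ln_ge_iff)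
      also have "\<dots> \<longleftrightarrow> - real n * ln (cdf D (x * b n)) \<le> y powr - \<beta>"
        by (rule neg_divide_le_iff) (use elim(2) in simp)
      finally show ?case .
    qed
  qed
  show ?thesis
  proof (rule order_tendstoI)
    fix a assume "y < a"
    then obtain x where x: "y < x" "x < a" using dense by blast
    then have x0: "0 < x" using y by simp
    have "x powr - \<beta> < y powr - \<beta>" using x y \<beta> by (intro powr_less_mono2_neg) auto
    from key[OF x0] order_tendstoD(2)[OF lim[OF x0] this]
    show "\<forall>\<^sub>F n in sequentially. transport D \<beta> n y / b n < a"
      by eventually_elim (use x(2) in auto)
  next
    fix a assume "a < y"
    then obtain x where x: "max a 0 < x" "x < y" using y dense[of "max a 0" y] by auto
    then have x0: "0 < x" by simp
    have "y powr - \<beta> < x powr - \<beta>" using x x0 \<beta> by (intro powr_less_mono2_neg) auto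
    from key[OF x0] order_tendstoD(1)[OF lim[OF x0] this]
    show "\<forall>\<^sub>F n in sequentially. a < transport D \<beta> n y / b n"
      by eventually_elim (use x(1) in auto)
  qed
qed

text \<open>
  Monotonicity traps \<open>h n y\<close> between the values at two neighbouring points of a fine grid, and on
  \<open>(0,C]\<close> only finitely many grid points matter.
\<close>
lemma monotone_tendsto_id_uniform:
  fixes h :: "nat \<Rightarrow> real \<Rightarrow> real"
  assumes mono: "\<And>n y y'. 0 < n \<Longrightarrow> 0 < y \<Longrightarrow> y \<le> y' \<Longrightarrow> h n y \<le> h n y'"
    and lim: "\<And>y. 0 < y \<Longrightarrow> (\<lambda>n. h n y) \<longlonglongrightarrow> y" and \<epsilon>: "0 < \<epsilon>"
  shows "\<forall>\<^sub>F n in sequentially. \<forall>y. 0 < y \<longrightarrow> y \<le> C \<longrightarrow> \<bar>max 0 (h n y) - y\<bar> \<le> \<epsilon>"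
proof -
  \<comment> \<open>Compare with the grid of width \<open>e\<close>; below \<open>e\<close> the positive part replaces the lower bound.\<close>
  define e where "e = \<epsilon> / 2"
  have e: "0 < e" using \<epsilon> by (simp add: e_def)
  obtain K :: nat where K: "C / e \<le> real K" using real_arch_simple by blast
  have "\<forall>\<^sub>F n in sequentially. \<forall>i\<in>{1..K + 1}. dist (h n (real i * e)) (real i * e) < e"
    using e by (intro eventually_ball_finite ballI tendstoD[OF lim]) auto
  with eventually_gt_at_top[of "0::nat"] show ?thesis
  proof eventually_elim
    case (elim n)
    have grid: "\<bar>h n (real i * e) - real i * e\<bar> < e" if "1 \<le> i" "i \<le> K + 1" for i
      using elim(2) that by (auto simp: dist_real_def)
    show ?case
    proof (intro allI impI)
      fix y assume y: "0 < y" "y \<le> C"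
      define i where "i = nat \<lfloor>y / e\<rfloor>"
      have "0 < y / e" using y e by simp
      then have i: "real i \<le> y / e" "y / e < real i + 1" unfolding i_def by linarith+
      have "y / e \<le> real K" using K y e by (meson divide_right_mono less_imp_le order_trans)
      then have iK: "i \<le> K" using i(1) by linarith
      have iy: "real i * e \<le> y" "y < (real i + 1) * e"
        using i e by (simp_all add: pos_le_divide_eq pos_divide_less_eq)
      have "h n y \<le> h n (real (i + 1) * e)" by (rule mono[OF elim(1) y(1)]) (use iy(2) in \<open>simp add: add.commute\<close>)
      moreover have "\<bar>h n (real (i + 1) * e) - real (i + 1) * e\<bar> < e" by (rule grid) (use iK in auto)
      moreover have "real (i + 1) * e = real i * e + e" by (simp add: algebra_simps)
      ultimately have upper: "h n y < y + 2 * e" using iy by linarith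
      have lower: "y - 2 * e < max 0 (h n y)"
      proof (cases "i = 0")
        case True
        then have "y < e" using iy(2) by simp
        then show ?thesis using e by simp
      next
        case False
        have "h n (real i * e) \<le> h n y" using False e iy by (intro mono[OF elim(1)]) auto
        moreover have "\<bar>h n (real i * e) - real i * e\<bar> < e" by (rule grid) (use False iK in auto)
        moreover have "(real i + 1) * e = real i * e + e" by (simp add: algebra_simps)
        ultimately show ?thesis using iy by linarith
      qed
      show "\<bar>max 0 (h n y) - y\<bar> \<le> \<epsilon>" using upper lower y(1) e by (simp add: e_def abs_le_iff max_def)
    qed
  qed
qed

section \<open>Coupling on the space of the Poisson random measure\<close>

context poisson_extremal
begin

text \<open>
  A function of the Poisson points in the strip with index \<open>k\<close>; for fixed \<open>n\<close> these variables will
  turn out to be independent with law \<open>D\<close>.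
\<close>
definition copy :: "real measure \<Rightarrow> nat \<Rightarrow> nat \<Rightarrow> 'b \<Rightarrow> real" where
  "copy D n k \<omega> = transport D \<beta> n (real_of_ereal (strip_max n k \<omega>))"

lemma copy_measurable:
  assumes "real_distribution D" "0 < n"
  shows "copy D n k \<in> borel_measurable Q"
  unfolding copy_def
  by (rule measurable_compose[OF borel_measurable_real_of_ereal[OF strip_max_measurable]
        transport_measurable[OF assms(1) \<beta> assms(2)]])

lemma strip_max_real:
  assumes "\<omega> \<in> space Q" "regular \<omega>" "0 < n"
  shows "strip_max n k \<omega> = ereal (real_of_ereal (strip_max n k \<omega>))" "0 < real_of_ereal (strip_max n k \<omega>)"
proof -
  have "strip_max n k \<omega> \<noteq> \<infinity>"
    using strip_max_le_running_sup[of k k n \<omega>] regular_running_sup_finite[OF assms(1,2)] by auto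
  then show "strip_max n k \<omega> = ereal (real_of_ereal (strip_max n k \<omega>))" "0 < real_of_ereal (strip_max n k \<omega>)"
    using strip_max_pos[OF assms(2,3), of k] by (cases "strip_max n k \<omega>"; simp)+
qed

text \<open>
  Transport being monotone, an upper bound for the copy is an upper bound for the strip maximum, and
  this says that the part of the strip above some level is void.
\<close>
lemma copy_le_iff_void:
  assumes D: "real_distribution D" and n: "0 < n" and lt1: "cdf D x < 1"
  shows "\<exists>c::real. 0 \<le> c \<and> (\<forall>\<omega>\<in>space Q. regular \<omega> \<longrightarrow>
      (copy D n k \<omega> \<le> x \<longleftrightarrow> points \<omega> \<inter> strip n k \<times> {ereal c<..} = {})) \<and>
    prob {\<omega> \<in> space Q. points \<omega> \<inter> strip n k \<times> {ereal c<..} = {}} = cdf D x"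
proof -
  interpret D: real_distribution D by (rule D)
  have sets: "strip n k \<times> {ereal c<..} \<in> sets mean" if "0 \<le> c" for c
    using that by (intro rectangle_in_sets strip_borel strip_nonneg) (auto intro: le_less_trans)
  show ?thesis
  \<comment> \<open>If \<open>D\<close> puts no mass below \<open>x\<close> then level 0 serves, as no strip is void.\<close>
  proof (cases "cdf D x = 0")
    case True
    show ?thesis
    proof (intro exI[of _ 0] conjI ballI impI)
      fix \<omega> assume \<omega>: "\<omega> \<in> space Q" "regular \<omega>"
      have "\<not> exp (- (real_of_ereal (strip_max n k \<omega>) powr - \<beta>) / real n) \<le> 0" by (simp add: not_le)
      then have "\<not> copy D n k \<omega> \<le> x"
        unfolding copy_def transport_le_iff[OF D strip_max_real(2)[OF \<omega> n] n] True .
      moreover have "points \<omega> \<inter> strip n k \<times> {ereal 0<..} \<noteq> {}"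
        using \<omega>(2) n by (simp add: regular_def zero_ereal_def[symmetric])
      ultimately show "copy D n k \<omega> \<le> x \<longleftrightarrow> points \<omega> \<inter> strip n k \<times> {ereal 0<..} = {}" by simp
    next
      have "AE \<omega> in Q. \<not> points \<omega> \<inter> strip n k \<times> {ereal 0<..} = {}"
        using AE_regular by (rule eventually_mono) (use n in \<open>simp add: regular_def zero_ereal_def[symmetric]\<close>)
      then have "prob {\<omega> \<in> space Q. points \<omega> \<inter> strip n k \<times> {ereal 0<..} = {}} = 0"
        using void_event[OF sets[of 0]] by (subst prob_Collect_eq_0) auto
      then show "prob {\<omega> \<in> space Q. points \<omega> \<inter> strip n k \<times> {ereal 0<..} = {}} = cdf D x"
        using True by simp
    qed simp
  next
    case False
    then have G: "0 < cdf D x" using D.cdf_nonneg[of x] by simp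
    define a where "a = - real n * ln (cdf D x)"
    have a: "0 < a" using n G lt1 by (simp add: a_def ln_less_zero mult_pos_neg)
    define c where "c = a powr (- 1 / \<beta>)"
    have c: "0 < c" using a by (simp add: c_def)
    show ?thesis
    proof (intro exI[of _ c] conjI ballI impI)
      fix \<omega> assume \<omega>: "\<omega> \<in> space Q" "regular \<omega>"
      have "copy D n k \<omega> \<le> x \<longleftrightarrow> real_of_ereal (strip_max n k \<omega>) \<le> c"
        unfolding copy_def c_def a_def by (rule transport_le_iff_le[OF D \<beta> n strip_max_real(2)[OF \<omega> n] G lt1])
      also have "\<dots> \<longleftrightarrow> strip_max n k \<omega> \<le> ereal c"
        by (subst (2) strip_max_real(1)[OF \<omega> n]) simp
      also have "\<dots> \<longleftrightarrow> points \<omega> \<inter> strip n k \<times> {ereal c<..} = {}"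
        by (rule strip_max_le_iff) (use c in simp)
      finally show "copy D n k \<omega> \<le> x \<longleftrightarrow> points \<omega> \<inter> strip n k \<times> {ereal c<..} = {}" .
    next
      have "emeasure mean (strip n k \<times> {ereal c<..}) = ennreal (1 / real n) * ennreal (c powr - \<beta>)"
        using c n by (subst emeasure_rectangle[OF strip_borel strip_nonneg])
          (auto simp: emeasure_strip tail_\<mu> intro: less_trans)
      also have "\<dots> = ennreal (1 / real n * c powr - \<beta>)" by (rule ennreal_mult[symmetric]) auto
      also have "1 / real n * c powr - \<beta> = - ln (cdf D x)"
        using a \<beta> n by (simp add: c_def powr_powr) (simp add: a_def)
      finally have "prob {\<omega> \<in> space Q. points \<omega> \<inter> strip n k \<times> {ereal c<..} = {}} = exp (- (- ln (cdf D x)))"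
        using G lt1 c by (intro void_probability sets) (auto simp: ln_le_zero_iff)
      then show "prob {\<omega> \<in> space Q. points \<omega> \<inter> strip n k \<times> {ereal c<..} = {}} = cdf D x"
        using G by simp
    qed (use c in simp)
  qed
qed

lemma copy_distribution:
  assumes D: "real_distribution D" and n: "0 < n" and lt1: "\<And>x. cdf D x < 1"
  shows "distr Q borel (copy D n k) = D"
proof (rule cdf_unique[OF _ D])
  note [measurable] = copy_measurable[OF D n]
  show "real_distribution (distr Q borel (copy D n k))" by (rule real_distribution_distr) measurable
  show "cdf (distr Q borel (copy D n k)) = cdf D"
  proof
    fix x
    obtain c where c: "0 \<le> c" "\<And>\<omega>. \<omega> \<in> space Q \<Longrightarrow> regular \<omega> \<Longrightarrow>
        copy D n k \<omega> \<le> x \<longleftrightarrow> points \<omega> \<inter> strip n k \<times> {ereal c<..} = {}"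
      "prob {\<omega> \<in> space Q. points \<omega> \<inter> strip n k \<times> {ereal c<..} = {}} = cdf D x"
      using copy_le_iff_void[OF D n lt1, of k x] by blast
    have sets: "strip n k \<times> {ereal c<..} \<in> sets mean"
      using c(1) by (intro rectangle_in_sets strip_borel strip_nonneg) (auto intro: le_less_trans)
    have "cdf (distr Q borel (copy D n k)) x = prob {\<omega> \<in> space Q. copy D n k \<omega> \<le> x}"
      unfolding cdf_def2 by (subst measure_distr) (auto simp: vimage_def Int_def conj_commute)
    also have "\<dots> = prob {\<omega> \<in> space Q. points \<omega> \<inter> strip n k \<times> {ereal c<..} = {}}"
    proof (rule finite_measure_eq_AE)
      show "AE \<omega> in Q. (\<omega> \<in> {\<omega> \<in> space Q. copy D n k \<omega> \<le> x}) =
          (\<omega> \<in> {\<omega> \<in> space Q. points \<omega> \<inter> strip n k \<times> {ereal c<..} = {}})"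
        using AE_regular by (rule AE_mp) (intro AE_I2, use c(2) in simp)
      show "{\<omega> \<in> space Q. points \<omega> \<inter> strip n k \<times> {ereal c<..} = {}} \<in> sets Q" by (rule void_event[OF sets])
    qed measurable
    finally show "cdf (distr Q borel (copy D n k)) x = cdf D x" using c(3) by simp
  qed
qed

text \<open>Disjoint strips make the copies independent: the events are reduced to absence of points.\<close>
lemma copy_independent:
  assumes D: "real_distribution D" and n: "0 < n" and lt1: "\<And>x. cdf D x < 1"
  shows "indep_vars (\<lambda>_. borel) (copy D n) UNIV"
proof -
  note [measurable] = copy_measurable[OF D n]
  \<comment> \<open>Half-lines, and the whole line as a generator of the Borel sets that contains the space.\<close>
  define E where "E = insert UNIV (range (atMost :: real \<Rightarrow> real set))"
  have finite_indep: "indep_vars (\<lambda>_. borel) (copy D n) {..<K}" if K: "0 < K" for K :: nat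
  proof (subst indep_vars_finite[where E = "\<lambda>_. E"])
    show "sets borel = sigma_sets (space borel) E"
    proof -
      have "sets borel = sigma_sets UNIV (range (atMost :: real \<Rightarrow> real set))"
        by (subst borel_eq_atMost) (simp add: atMost_def)
      also have "\<dots> = sigma_sets UNIV E"
      proof (rule sigma_sets_eqI)
        fix A assume "A \<in> E"
        then show "A \<in> sigma_sets UNIV (range atMost)" unfolding E_def by (auto intro: sigma_sets_top)
      qed (auto simp: E_def)
      finally show ?thesis by simp
    qed
    show "Int_stable E"
    proof (rule Int_stableI)
      fix A B assume "A \<in> E" "B \<in> E"
      then consider "A = UNIV" | "B = UNIV" | x y where "A = {..x}" "B = {..y}" unfolding E_def by blast
      then show "A \<inter> B \<in> E"
      proof cases
        case (3 x y)
        then have "A \<inter> B = {..min x y}" by auto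
        then show ?thesis by (simp add: E_def)
      qed (use \<open>A \<in> E\<close> \<open>B \<in> E\<close> in auto)
    qed
    show "\<forall>A\<in>{..<K} \<rightarrow> E. prob (\<Inter>j\<in>{..<K}. copy D n j -` A j \<inter> space Q) =
        (\<Prod>j\<in>{..<K}. prob (copy D n j -` A j \<inter> space Q))"
    proof
      fix A assume A: "A \<in> {..<K} \<rightarrow> E"
      have "\<exists>B. B \<in> sets mean \<and> B \<subseteq> strip n j \<times> UNIV \<and>
          (j < K \<longrightarrow> (\<forall>\<omega>. \<omega> \<in> space Q \<longrightarrow> regular \<omega> \<longrightarrow> (copy D n j \<omega> \<in> A j \<longleftrightarrow> points \<omega> \<inter> B = {})))" for j
      proof (cases "j < K \<and> A j \<noteq> UNIV")
        case True
        then obtain x where x: "A j = {..x}" using A unfolding E_def by blast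
        obtain c where c: "0 \<le> c" "\<And>\<omega>. \<omega> \<in> space Q \<Longrightarrow> regular \<omega> \<Longrightarrow>
            copy D n j \<omega> \<le> x \<longleftrightarrow> points \<omega> \<inter> strip n j \<times> {ereal c<..} = {}"
          using copy_le_iff_void[OF D n lt1, of j x] by blast
        have "strip n j \<times> {ereal c<..} \<in> sets mean"
          using c(1) by (intro rectangle_in_sets strip_borel strip_nonneg) (auto intro: le_less_trans)
        then show ?thesis using c(2) x by (intro exI[of _ "strip n j \<times> {ereal c<..}"]) auto
      next
        case False
        then show ?thesis by (intro exI[of _ "{}"]) auto
      qed
      then obtain B where B: "\<And>j. B j \<in> sets mean" "\<And>j. B j \<subseteq> strip n j \<times> UNIV"
        "\<And>j \<omega>. j < K \<Longrightarrow> \<omega> \<in> space Q \<Longrightarrow> regular \<omega> \<Longrightarrow> copy D n j \<omega> \<in> A j \<longleftrightarrow> points \<omega> \<inter> B j = {}"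
        by metis
      have Aj: "A j \<in> sets borel" if "j < K" for j
      proof -
        have "A j \<in> E" using A that by auto
        then show ?thesis unfolding E_def by auto
      qed
      have disj: "disjoint_family_on B {..<K}"
        unfolding disjoint_family_on_def
      proof (intro ballI impI)
        fix i j :: nat assume "i \<noteq> j"
        then consider "i < j" | "j < i" by linarith
        then have "strip n i \<inter> strip n j = {}" using strip_disjoint[of i j n] strip_disjoint[of j i n] by cases auto
        then show "B i \<inter> B j = {}" using B(2)[of i] B(2)[of j] by blast
      qed
      have void: "{\<omega> \<in> space Q. points \<omega> \<inter> B j = {}} \<in> sets Q" for j by (rule void_event[OF B(1)])
      have single: "prob (copy D n j -` A j \<inter> space Q) = prob {\<omega> \<in> space Q. points \<omega> \<inter> B j = {}}"
        if j: "j < K" for j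
      proof (rule finite_measure_eq_AE)
        show "AE \<omega> in Q. (\<omega> \<in> copy D n j -` A j \<inter> space Q) = (\<omega> \<in> {\<omega> \<in> space Q. points \<omega> \<inter> B j = {}})"
          using AE_regular by (rule AE_mp) (intro AE_I2, use B(3) j in auto)
        show "copy D n j -` A j \<inter> space Q \<in> sets Q"
          by (rule measurable_sets[OF copy_measurable[OF D n] Aj[OF j]])
      qed (rule void)
      have "prob (\<Inter>j\<in>{..<K}. copy D n j -` A j \<inter> space Q) = prob {\<omega> \<in> space Q. \<forall>j<K. points \<omega> \<inter> B j = {}}"
      proof (rule finite_measure_eq_AE)
        show "AE \<omega> in Q. (\<omega> \<in> (\<Inter>j\<in>{..<K}. copy D n j -` A j \<inter> space Q)) =
            (\<omega> \<in> {\<omega> \<in> space Q. \<forall>j<K. points \<omega> \<inter> B j = {}})"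
          using AE_regular by (rule AE_mp) (intro AE_I2, use B(3) K in auto)
        show "(\<Inter>j\<in>{..<K}. copy D n j -` A j \<inter> space Q) \<in> sets Q"
          by (rule sets.finite_INT)
            (use K in \<open>auto intro!: measurable_sets[OF copy_measurable[OF D n] Aj]\<close>)
        have "{\<omega> \<in> space Q. \<forall>j<K. points \<omega> \<inter> B j = {}} = (\<Inter>j\<in>{..<K}. {\<omega> \<in> space Q. points \<omega> \<inter> B j = {}})"
          using K by auto
        also have "\<dots> \<in> sets Q" by (rule sets.finite_INT) (use K void in auto)
        finally show "{\<omega> \<in> space Q. \<forall>j<K. points \<omega> \<inter> B j = {}} \<in> sets Q" .
      qed
      also have "\<dots> = (\<Prod>j\<in>{..<K}. prob {\<omega> \<in> space Q. points \<omega> \<inter> B j = {}})"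
        by (rule void_independent[OF B(1) disj])
      also have "\<dots> = (\<Prod>j\<in>{..<K}. prob (copy D n j -` A j \<inter> space Q))"
        by (rule prod.cong) (simp_all add: single)
      finally show "prob (\<Inter>j\<in>{..<K}. copy D n j -` A j \<inter> space Q) =
        (\<Prod>j\<in>{..<K}. prob (copy D n j -` A j \<inter> space Q))" .
    qed
  qed (use K in \<open>auto simp: E_def\<close>)
  have "indep_sets (\<lambda>i. sigma_sets (space Q) {copy D n i -` A \<inter> space Q | A. A \<in> sets borel}) UNIV"
  proof (subst indep_sets_finite_index_sets, intro allI impI)
    fix J :: "nat set" assume J: "J \<noteq> {}" "finite J"
    define K where "K = Suc (Max J)"
    have "J \<subseteq> {..<K}" using J Max_ge by (auto simp: K_def less_Suc_eq_le)
    then have "indep_vars (\<lambda>_. borel) (copy D n) J"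
      using indep_vars_subset[OF finite_indep[of K]] by (simp add: K_def)
    then show "indep_sets (\<lambda>i. sigma_sets (space Q) {copy D n i -` A \<inter> space Q | A. A \<in> sets borel}) J"
      unfolding indep_vars_def by simp
  qed
  then show ?thesis unfolding indep_vars_def by simp
qed

text \<open>
  The running maximum of the copies is the transported value of the extremal process at the right end
  point of the strip, so its paths are small perturbations of a sampled extremal process.
\<close>
lemma copy_max:
  assumes D: "real_distribution D" and n: "0 < n" and \<omega>: "\<omega> \<in> space Q" "regular \<omega>"
  shows "Max ((\<lambda>i. copy D n i \<omega>) ` {0..k})
    = transport D \<beta> n (real_of_ereal (running_sup (points \<omega>) ((real k + 1) / real n)))"
proof -
  obtain i where i: "i \<le> k" "strip_max n i \<omega> = running_sup (points \<omega>) ((real k + 1) / real n)"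
    by (rule running_sup_eq_strip_max[OF \<omega> n])
  show ?thesis
  proof (rule Max_eqI)
    show "transport D \<beta> n (real_of_ereal (running_sup (points \<omega>) ((real k + 1) / real n)))
        \<in> (\<lambda>i. copy D n i \<omega>) ` {0..k}"
      by (rule image_eqI[of _ _ i]) (use i in \<open>simp_all add: copy_def\<close>)
    fix y assume "y \<in> (\<lambda>i. copy D n i \<omega>) ` {0..k}"
    then obtain j where j: "j \<le> k" "y = copy D n j \<omega>" by auto
    have "strip_max n j \<omega> \<le> strip_max n i \<omega>" using strip_max_le_running_sup[OF j(1)] i(2) by simp
    then have "real_of_ereal (strip_max n j \<omega>) \<le> real_of_ereal (strip_max n i \<omega>)"
      by (subst (asm) (1 2) strip_max_real(1)[OF \<omega> n]) simp
    then show "y \<le> transport D \<beta> n (real_of_ereal (running_sup (points \<omega>) ((real k + 1) / real n)))"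
      unfolding j(2) copy_def i(2)[symmetric]
      by (rule transport_mono[OF D \<beta> n strip_max_real(2)[OF \<omega> n]])
  qed simp
qed

lemma copy_paths_J1_converge:
  assumes D: "real_distribution D" and b: "\<And>n. 0 < n \<Longrightarrow> 0 < b n"
    and tail: "\<And>x. 0 < x \<Longrightarrow> (\<lambda>n. real n * (1 - cdf D (x * b n))) \<longlonglongrightarrow> x powr - \<beta>"
    and lt1: "\<And>x. cdf D x < 1" and \<omega>: "\<omega> \<in> space Q" "regular \<omega>"
  shows "J1_converges (\<lambda>n. step_path n (\<lambda>k. max 0 (Max ((\<lambda>i. copy D n i \<omega>) ` {0..k}) / b n)))
      (extremal_process N \<omega>)"
  unfolding extremal_process_eq
proof (rule J1_converges_perturbation[OF sampled_paths_J1_converge[OF level_path_points[OF \<omega>(1)]]])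
  fix \<epsilon> T :: real assume \<epsilon>: "0 < \<epsilon>" and T: "0 \<le> T"
  let ?z = "running_sup (points \<omega>)"
  define h where "h n y = transport D \<beta> n y / b n" for n y
  have z_fin: "?z t \<noteq> \<infinity>" for t by (rule regular_running_sup_finite[OF \<omega>])
  obtain K :: nat where K: "\<And>t. 0 \<le> t \<Longrightarrow> t \<le> T + 1 \<Longrightarrow> ?z t < ereal K"
    using level_path_bounded[OF level_path_points[OF \<omega>(1)], of "T + 1"] z_fin by metis
  have "\<forall>\<^sub>F n in sequentially. \<forall>y. 0 < y \<longrightarrow> y \<le> real K \<longrightarrow> \<bar>max 0 (h n y) - y\<bar> \<le> \<epsilon>"
  proof (rule monotone_tendsto_id_uniform[OF _ _ \<epsilon>])
    show "h n y \<le> h n y'" if "0 < n" "0 < y" "y \<le> y'" for n y y'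
      unfolding h_def using transport_mono[OF D \<beta> that] b[OF that(1)] by (intro divide_right_mono) auto
    show "(\<lambda>n. h n y) \<longlonglongrightarrow> y" if "0 < y" for y
      unfolding h_def by (rule transport_scaled_tendsto[OF D \<beta> b tail lt1 that])
  qed
  with eventually_gt_at_top[of "0::nat"]
  show "\<forall>\<^sub>F n in sequentially. \<forall>t\<in>{0..T}.
      \<bar>step_path n (\<lambda>k. max 0 (Max ((\<lambda>i. copy D n i \<omega>) ` {0..k}) / b n)) t -
       real_path (\<lambda>t. ?z ((real (nat \<lfloor>real n * t\<rfloor>) + 1) / real n)) t\<bar> \<le> \<epsilon>"
  proof eventually_elim
    case (elim n)
    show ?case
    proof
      fix t assume t: "t \<in> {0..T}"
      have n: "0 < real n" using elim(1) by simp
      define k where "k = nat \<lfloor>real n * t\<rfloor>"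
      define s where "s = (real k + 1) / real n"
      define y where "y = real_of_ereal (?z s)"
      obtain i where "strip_max n i \<omega> = ?z s"
        using running_sup_eq_strip_max[OF \<omega> elim(1), of k] unfolding s_def by metis
      then have y: "?z s = ereal y" "0 < y"
        using strip_max_real[OF \<omega> elim(1), of i] by (simp_all add: y_def)
      have "0 \<le> real n * t" using t by simp
      then have "real k \<le> real n * t" unfolding k_def by linarith
      also have "\<dots> \<le> real n * T" using t by (simp add: mult_left_mono)
      finally have "s \<le> (real n * T + 1) / real n" unfolding s_def using n by (intro divide_right_mono) auto
      also have "\<dots> = T + 1 / real n" using n by (simp add: add_divide_distrib)
      also have "\<dots> \<le> T + 1" using elim(1) by simp
      finally have "s \<le> T + 1" .
      moreover have "0 \<le> s" by (simp add: s_def)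
      ultimately have "y \<le> real K" using K[of s] y(1) by simp
      then have "\<bar>max 0 (h n y) - y\<bar> \<le> \<epsilon>" using elim(2) y(2) by blast
      moreover have "step_path n (\<lambda>k. max 0 (Max ((\<lambda>i. copy D n i \<omega>) ` {0..k}) / b n)) t = max 0 (h n y)"
        using t copy_max[OF D elim(1) \<omega>, of k]
        by (simp add: step_path_def k_def[symmetric] h_def y_def s_def)
      moreover have "real_path (\<lambda>t. ?z ((real (nat \<lfloor>real n * t\<rfloor>) + 1) / real n)) t = y"
        using t by (simp add: real_path_def k_def[symmetric] y_def s_def)
      ultimately show "\<bar>step_path n (\<lambda>k. max 0 (Max ((\<lambda>i. copy D n i \<omega>) ` {0..k}) / b n)) t -
       real_path (\<lambda>t. ?z ((real (nat \<lfloor>real n * t\<rfloor>) + 1) / real n)) t\<bar> \<le> \<epsilon>" by simp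
    qed
  qed
qed

end

section \<open>Norming sequences\<close>

lemma tail_ratio_of_asymp_equiv:
  fixes f l :: "real \<Rightarrow> real"
  assumes equiv: "f \<sim>[at_top] (\<lambda>x. x powr (- \<alpha>) * l x)" and l: "slowly_varying l"
  shows "\<And>c. 0 < c \<Longrightarrow> ((\<lambda>x. f (c * x) / f x) \<longlongrightarrow> c powr (- \<alpha>)) at_top"
    and "\<forall>\<^sub>F x in at_top. 0 < f x"
proof -
  define g where "g x = x powr (- \<alpha>) * l x" for x
  obtain a where a: "\<And>x. a \<le> x \<Longrightarrow> 0 < l x" using l unfolding regularly_varying_def by blast
  have g_pos: "\<forall>\<^sub>F x in at_top. 0 < g x"
    using eventually_ge_at_top[of a] eventually_gt_at_top[of "0::real"]
    by eventually_elim (simp add: g_def a)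
  have fg: "((\<lambda>x. f x / g x) \<longlongrightarrow> 1) at_top"
    by (rule asymp_equivD_strong[OF equiv[folded g_def]], rule eventually_mono[OF g_pos]) simp
  show f_pos: "\<forall>\<^sub>F x in at_top. 0 < f x"
    using g_pos order_tendstoD(1)[OF fg zero_less_one]
    by eventually_elim (simp add: zero_less_divide_iff)
  fix c :: real assume c: "0 < c"
  have scale: "filterlim (\<lambda>x. c * x) at_top at_top"
    using c by (intro filterlim_tendsto_pos_mult_at_top[OF tendsto_const _ filterlim_ident])
  have "((\<lambda>x. l (c * x) / l x) \<longlongrightarrow> c powr 0) at_top"
    using l c unfolding regularly_varying_def by blast
  then have "((\<lambda>x. (f (c * x) / g (c * x)) * (c powr (- \<alpha>) * (l (c * x) / l x)) / (f x / g x))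
      \<longlongrightarrow> 1 * (c powr (- \<alpha>) * c powr 0) / 1) at_top"
    by (intro tendsto_divide tendsto_mult tendsto_const fg filterlim_compose[OF fg scale]) simp_all
  moreover have "\<forall>\<^sub>F x in at_top. (f (c * x) / g (c * x)) * (c powr (- \<alpha>) * (l (c * x) / l x)) / (f x / g x)
      = f (c * x) / f x"
    using g_pos f_pos filterlim_iff[THEN iffD1, OF scale, rule_format, OF g_pos]
      eventually_gt_at_top[of "0::real"]
  proof eventually_elim
    case (elim x)
    have "g (c * x) = c powr (- \<alpha>) * x powr (- \<alpha>) * l (c * x)"
      using c elim(4) by (simp add: g_def powr_mult)
    moreover have "0 < l x" "0 < x powr (- \<alpha>)" using elim(1,4) by (auto simp: g_def zero_less_mult_iff)
    moreover have "0 < c powr (- \<alpha>)" using c by simp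
    moreover have "l (c * x) \<noteq> 0" using elim(3) by (auto simp: g_def)
    ultimately show ?case using elim(2) by (simp add: g_def[of x] field_simps)
  qed
  ultimately show "((\<lambda>x. f (c * x) / f x) \<longlongrightarrow> c powr (- \<alpha>)) at_top"
    using c by (auto intro: Lim_transform_eventually)
qed

lemma antitone_pos:
  fixes f :: "real \<Rightarrow> real"
  assumes "antimono f" "\<forall>\<^sub>F x in at_top. 0 < f x"
  shows "0 < f x"
proof -
  obtain a where "\<And>y. a \<le> y \<Longrightarrow> 0 < f y" using assms(2) by (auto simp: eventually_at_top_linorder)
  then have "0 < f (max a x)" by simp
  also have "\<dots> \<le> f x" by (rule antimonoD[OF assms(1)]) simp
  finally show ?thesis .
qed

text \<open>At the scale \<open>b\<close> prescribed by the heavier tail \<open>R\<close>, exceedances of the lighter tail \<open>p\<close> disappear.\<close>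
lemma norming_sequence:
  fixes R p :: "real \<Rightarrow> real" and b :: "real \<Rightarrow> real"
  assumes R: "antimono R" "\<And>x. 0 < R x"
    and b: "((\<lambda>x. x * R (b x)) \<longlongrightarrow> 1) at_top"
  shows norming_at_top: "filterlim (\<lambda>n. b (real n)) at_top sequentially"
    and norming_scaled: "\<And>x \<beta>. ((\<lambda>y. R (x * y) / R y) \<longlongrightarrow> x powr (- \<beta>)) at_top \<Longrightarrow>
      (\<lambda>n. real n * R (x * b (real n))) \<longlonglongrightarrow> x powr (- \<beta>)"
    and norming_lighter: "filterlim (\<lambda>x. R x / p x) at_top at_top \<Longrightarrow>
      (\<lambda>n. real n * p (b (real n))) \<longlonglongrightarrow> 0"
proof -
  have nR: "(\<lambda>n. real n * R (b (real n))) \<longlonglongrightarrow> 1"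
    by (rule filterlim_compose[OF b filterlim_real_sequentially])
  have "(\<lambda>n. real n * R (b (real n)) * (1 / real n)) \<longlonglongrightarrow> 1 * 0"
    by (rule tendsto_mult[OF nR]) real_asymp
  moreover have "\<forall>\<^sub>F n in sequentially. real n * R (b (real n)) * (1 / real n) = R (b (real n))"
    using eventually_gt_at_top[of "0::nat"] by eventually_elim simp
  ultimately have R0: "(\<lambda>n. R (b (real n))) \<longlonglongrightarrow> 0" using Lim_transform_eventually by fastforce
  show top: "filterlim (\<lambda>n. b (real n)) at_top sequentially"
    unfolding filterlim_at_top
  proof
    fix C :: real
    from order_tendstoD(2)[OF R0 R(2)[of C]]
    show "\<forall>\<^sub>F n in sequentially. C \<le> b (real n)"
    proof eventually_elim
      case (elim n)
      show ?case
      proof (rule ccontr)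
        assume "\<not> C \<le> b (real n)"
        then have "R C \<le> R (b (real n))" by (intro antimonoD[OF R(1)]) simp
        then show False using elim by simp
      qed
    qed
  qed
  show "(\<lambda>n. real n * R (x * b (real n))) \<longlonglongrightarrow> x powr (- \<beta>)"
    if "((\<lambda>y. R (x * y) / R y) \<longlongrightarrow> x powr (- \<beta>)) at_top" for x \<beta>
  proof -
    have "(\<lambda>n. real n * R (b (real n)) * (R (x * b (real n)) / R (b (real n)))) \<longlonglongrightarrow> 1 * x powr (- \<beta>)"
      by (intro tendsto_mult nR filterlim_compose[OF that top])
    moreover have "real n * R (b (real n)) * (R (x * b (real n)) / R (b (real n))) = real n * R (x * b (real n))" for n
      using R(2)[of "b (real n)"] by simp
    ultimately show ?thesis by simp
  qed
  show "(\<lambda>n. real n * p (b (real n))) \<longlonglongrightarrow> 0" if ratio: "filterlim (\<lambda>x. R x / p x) at_top at_top"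
  proof -
    have "(\<lambda>n. real n * R (b (real n)) / (R (b (real n)) / p (b (real n)))) \<longlonglongrightarrow> 0"
      by (rule tendsto_divide_0[OF nR filterlim_at_top_imp_at_infinity[OF filterlim_compose[OF ratio top]]])
    moreover have "real n * R (b (real n)) / (R (b (real n)) / p (b (real n))) = real n * p (b (real n))" for n
      using R(2)[of "b (real n)"] by simp
    ultimately show ?thesis by simp
  qed
qed

lemma (in prob_space) exceedance_tendsto_0:
  fixes X :: "'a \<Rightarrow> real" and c :: "nat \<Rightarrow> real"
  assumes [measurable]: "X \<in> borel_measurable M" and c: "filterlim c at_top sequentially"
  shows "(\<lambda>n. prob {\<omega> \<in> space M. c n \<le> \<bar>X \<omega>\<bar>}) \<longlonglongrightarrow> 0"
proof -
  have "(\<lambda>n. expectation (indicator {\<omega> \<in> space M. c n \<le> \<bar>X \<omega>\<bar>})) \<longlonglongrightarrow> expectation (\<lambda>\<omega>. 0::real)"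
  proof (rule integral_dominated_convergence[where w = "\<lambda>_. 1"])
    show "AE \<omega> in M. (\<lambda>n. indicator {\<omega> \<in> space M. c n \<le> \<bar>X \<omega>\<bar>} \<omega> :: real) \<longlonglongrightarrow> 0"
    proof (rule AE_I2)
      fix \<omega>
      have "\<forall>\<^sub>F n in sequentially. \<bar>X \<omega>\<bar> < c n" using c by (simp add: filterlim_at_top_dense)
      then have "\<forall>\<^sub>F n in sequentially. indicator {\<omega> \<in> space M. c n \<le> \<bar>X \<omega>\<bar>} \<omega> = (0::real)"
        by eventually_elim simp
      then show "(\<lambda>n. indicator {\<omega> \<in> space M. c n \<le> \<bar>X \<omega>\<bar>} \<omega> :: real) \<longlonglongrightarrow> 0"
        by (rule tendsto_eventually)
    qed
  qed (auto simp: indicator_def)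
  then show ?thesis by (simp add: Int_def conj_commute)
qed

section \<open>Laws of independent sequences\<close>

lemma (in prob_space) distr_iid_sequence:
  fixes X :: "nat \<Rightarrow> 'a \<Rightarrow> real"
  assumes indep: "indep_vars (\<lambda>_. borel) X UNIV" and law: "\<And>k. distr M borel (X k) = D"
  shows "distr M borel (\<lambda>\<omega> k. X k \<omega>) = distr (PiM UNIV (\<lambda>_. D)) borel (\<lambda>a. a)"
proof -
  have X: "X k \<in> borel_measurable M" for k using indep unfolding indep_vars_def by blast
  have "distr M (PiM UNIV (\<lambda>_. borel)) (\<lambda>\<omega>. \<lambda>k\<in>UNIV. X k \<omega>) = PiM UNIV (\<lambda>k. distr M borel (X k))"
    using indep by (subst (asm) indep_vars_iff_distr_eq_PiM) (auto intro: X)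
  then have PiM: "distr M (PiM UNIV (\<lambda>_. borel)) (\<lambda>\<omega> k. X k \<omega>) = PiM UNIV (\<lambda>_. D)"
    by (simp add: law restrict_def)
  have "distr (PiM UNIV (\<lambda>_. D)) borel (\<lambda>a. a)
      = distr (distr M (PiM UNIV (\<lambda>_. borel)) (\<lambda>\<omega> k. X k \<omega>)) borel (\<lambda>a. a)"
    by (simp only: PiM)
  also have "\<dots> = distr M borel ((\<lambda>a. a) \<circ> (\<lambda>\<omega> k. X k \<omega>))"
  proof (rule distr_distr)
    show "(\<lambda>a. a) \<in> measurable (PiM UNIV (\<lambda>_. borel)) (borel :: (nat \<Rightarrow> real) measure)"
      using measurable_ident_sets[OF sets_PiM_equal_borel] by simp
    show "(\<lambda>\<omega> k. X k \<omega>) \<in> measurable M (PiM UNIV (\<lambda>_. borel))"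
      by (rule measurable_PiM_single') (auto intro: X)
  qed
  finally show ?thesis by (simp add: comp_def)
qed

lemma (in prob_space) indep_vars_shift:
  fixes X :: "nat \<Rightarrow> 'a \<Rightarrow> real"
  assumes indep: "indep_vars (\<lambda>_. borel) X UNIV"
  shows "indep_vars (\<lambda>_. borel) (\<lambda>k. X (Suc k)) UNIV"
proof -
  have X [measurable]: "X k \<in> borel_measurable M" for k using indep unfolding indep_vars_def by blast
  let ?P = "PiM UNIV (\<lambda>_. borel) :: (nat \<Rightarrow> real) measure"
  have PiM: "distr M ?P (\<lambda>\<omega>. \<lambda>k\<in>UNIV. X k \<omega>) = PiM UNIV (\<lambda>k. distr M borel (X k))"
    using indep by (subst (asm) indep_vars_iff_distr_eq_PiM) (auto intro: X)
  have "distr M ?P (\<lambda>\<omega>. \<lambda>k\<in>UNIV. X (Suc k) \<omega>)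
      = distr (distr M ?P (\<lambda>\<omega>. \<lambda>k\<in>UNIV. X k \<omega>)) ?P (\<lambda>a. \<lambda>k\<in>UNIV. a (Suc k))"
    by (subst distr_distr) (auto simp: comp_def intro!: measurable_PiM_single')
  also have "\<dots> = distr (PiM UNIV (\<lambda>k. distr M borel (X k)))
      (PiM UNIV (\<lambda>k. distr M borel (X (Suc k)))) (\<lambda>a. \<lambda>k\<in>UNIV. a (Suc k))"
    unfolding PiM by (rule distr_cong) (auto intro!: sets_PiM_cong)
  also have "\<dots> = PiM UNIV (\<lambda>k. distr M borel (X (Suc k)))"
    by (rule distr_PiM_reindex) (auto intro!: prob_space_distr)
  finally show ?thesis
    by (subst indep_vars_iff_distr_eq_PiM) (auto intro: X)
qed

section \<open>The functional limit theorem\<close>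

definition scaled_max :: "real \<Rightarrow> (nat \<Rightarrow> real) \<Rightarrow> nat \<Rightarrow> real" where
  "scaled_max c a k = Max (a ` {0..k}) / c"

lemma scaled_max_measurable:
  assumes "\<And>k. (\<lambda>\<omega>. a \<omega> k) \<in> borel_measurable M"
  shows "(\<lambda>\<omega>. scaled_max c (a \<omega>)) \<in> borel_measurable M"
proof (rule measurable_coordinatewise_then_product)
  fix k
  show "(\<lambda>\<omega>. scaled_max c (a \<omega>) k) \<in> borel_measurable M"
    unfolding scaled_max_def
    by (intro borel_measurable_divide borel_measurable_const borel_measurable_Max assms) auto
qed

text \<open>
  Passing to the positive part changes little, because the maximum is bounded below by its first term
  \<open>e 0 / c\<close>.
\<close>
lemma scaled_max_perturbation:
  assumes c: "0 < c" and s: "\<And>i. i \<le> k \<Longrightarrow> \<bar>s i\<bar> < \<delta> / 2 * c" and e0: "\<bar>e 0\<bar> < \<delta> / 2 * c"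
  shows "\<bar>max 0 (scaled_max c e k) - scaled_max c (\<lambda>i. s i + e i) k\<bar> < \<delta>"
proof -
  have mem: "\<exists>i\<le>k. scaled_max c a k = a i / c" for a :: "nat \<Rightarrow> real"
  proof -
    have "Max (a ` {0..k}) \<in> a ` {0..k}" by (rule Max_in) auto
    then obtain i where "Max (a ` {0..k}) = a i" "i \<in> {0..k}" by (rule imageE)
    then show ?thesis by (auto simp: scaled_max_def)
  qed
  have ub: "a i / c \<le> scaled_max c a k" if "i \<le> k" for a i
    unfolding scaled_max_def using that c by (intro divide_right_mono Max_ge) auto
  have s': "\<bar>s i / c\<bar> < \<delta> / 2" if "i \<le> k" for i
    using s[OF that] c by (simp add: abs_divide pos_divide_less_eq)
  have e0': "\<bar>e 0 / c\<bar> < \<delta> / 2" using e0 c by (simp add: abs_divide pos_divide_less_eq)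
  obtain i where i: "i \<le> k" "scaled_max c (\<lambda>i. s i + e i) k = (s i + e i) / c"
    using mem[of "\<lambda>i. s i + e i"] by blast
  obtain j where j: "j \<le> k" "scaled_max c e k = e j / c" using mem by blast
  have "(s i + e i) / c = s i / c + e i / c" "(s j + e j) / c = s j / c + e j / c"
    "(s 0 + e 0) / c = s 0 / c + e 0 / c" by (simp_all add: add_divide_distrib)
  moreover have "e i / c \<le> scaled_max c e k" by (rule ub[OF i(1)])
  moreover have "(s j + e j) / c \<le> scaled_max c (\<lambda>i. s i + e i) k" by (rule ub[OF j(1)])
  moreover have "(s 0 + e 0) / c \<le> scaled_max c (\<lambda>i. s i + e i) k" by (rule ub) simp
  moreover have "\<bar>s 0 / c\<bar> < \<delta> / 2" by (rule s') simp
  ultimately show ?thesis using s'[OF i(1)] s'[OF j(1)] e0' i(2) j(2) by linarith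
qed

(* The index 0 carries the generic pair: (\<xi> 0, \<eta> 0) stands for (\<xi>,\<eta>), and (\<xi> k, \<eta> k), k \<ge> 1,
   for (\<xi>_k,\<eta>_k). *)
theorem proposition1p8:
  fixes M :: "'a measure" and \<xi> \<eta> :: "nat \<Rightarrow> 'a \<Rightarrow> real"
    and \<alpha> \<beta> c1 c2 :: real and \<l> b :: "real \<Rightarrow> real"
    and Q :: "'b measure" and N :: "'b \<Rightarrow> (real \<times> ereal) measure" and \<mu> :: "ereal measure"
  assumes "prob_space M"
    and "prob_space.indep_vars M (\<lambda>_. borel) (\<lambda>k \<omega>. (\<xi> k \<omega>, \<eta> k \<omega>)) UNIV"
    and "\<And>k. distr M borel (\<lambda>\<omega>. (\<xi> k \<omega>, \<eta> k \<omega>)) = distr M borel (\<lambda>\<omega>. (\<xi> 0 \<omega>, \<eta> 0 \<omega>))"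
    and "0 < \<alpha>" and "\<alpha> < 2"
    and "slowly_varying \<l>"
    and "c1 \<ge> 0" and "c2 \<ge> 0" and "c1 + c2 = 1"
    and "(\<lambda>x. \<P>(\<omega> in M. \<bar>\<xi> 0 \<omega>\<bar> > x)) \<sim>[at_top] (\<lambda>x. x powr (-\<alpha>) * \<l> x)"
    and "((\<lambda>x. \<P>(\<omega> in M. \<xi> 0 \<omega> > x) / \<P>(\<omega> in M. \<bar>\<xi> 0 \<omega>\<bar> > x)) \<longlongrightarrow> c1) at_top"
    and "((\<lambda>x. \<P>(\<omega> in M. - \<xi> 0 \<omega> > x) / \<P>(\<omega> in M. \<bar>\<xi> 0 \<omega>\<bar> > x)) \<longlongrightarrow> c2) at_top"
    and "1 < \<alpha> \<Longrightarrow> integrable M (\<xi> 0) \<and> (\<integral>\<omega>. \<xi> 0 \<omega> \<partial>M) = 0"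
    and "\<alpha> = 1 \<Longrightarrow> distr M borel (\<xi> 0) = distr M borel (\<lambda>\<omega>. - \<xi> 0 \<omega>)"
    and "filterlim (\<lambda>x. \<P>(\<omega> in M. \<eta> 0 \<omega> > x) / \<P>(\<omega> in M. \<bar>\<xi> 0 \<omega>\<bar> > x)) at_top at_top"
    and "0 < \<beta>" and "\<beta> \<le> \<alpha>"
    and "regularly_varying (\<lambda>x. \<P>(\<omega> in M. \<eta> 0 \<omega> > x)) (-\<beta>)"
    and "\<And>x. x > 0 \<Longrightarrow> b x > 0"
    and "((\<lambda>x. x * \<P>(\<omega> in M. \<eta> 0 \<omega> > b x)) \<longlongrightarrow> 1) at_top"
    and "sets \<mu> = sets (restrict_space borel {0<..})"
    and "\<And>x::real. x > 0 \<Longrightarrow> emeasure \<mu> {ereal x<..} = ennreal (x powr (-\<beta>))"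
    and "poisson_random_measure Q N (restrict_space lborel {0..} \<Otimes>\<^sub>M \<mu>)"
  shows "converges_in_distribution skorokhod_J1
           M (perturbed_walk_max \<xi> \<eta> b) Q (extremal_process N)"
proof -
  define p where "p x = measure M {\<omega> \<in> space M. x < \<bar>\<xi> 0 \<omega>\<bar>}" for x
  define R where "R x = measure M {\<omega> \<in> space M. x < \<eta> 0 \<omega>}" for x
  define c where "c n = b (real n)" for n
  define D where "D = distr M borel (\<eta> 0)"
  note M = assms(1) and indep = assms(2) and ident = assms(3)
  interpret M: prob_space M by (rule M)
  interpret P: poisson_extremal Q N \<mu> \<beta>
    by unfold_locales (use assms in auto)
  have pair: "(\<lambda>\<omega>. (\<xi> k \<omega>, \<eta> k \<omega>)) \<in> borel_measurable M" for k
    using indep unfolding M.indep_vars_def by blast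
  have fst_meas: "(fst :: real \<times> real \<Rightarrow> real) \<in> borel_measurable borel"
    by (rule borel_measurable_continuous_onI) (intro continuous_intros)
  have snd_meas: "(snd :: real \<times> real \<Rightarrow> real) \<in> borel_measurable borel"
    by (rule borel_measurable_continuous_onI) (intro continuous_intros)
  have \<xi> [measurable]: "\<xi> k \<in> borel_measurable M" for k
    using measurable_compose[OF pair fst_meas] by simp
  have \<eta> [measurable]: "\<eta> k \<in> borel_measurable M" for k
    using measurable_compose[OF pair snd_meas] by simp
  have \<xi>_indep: "M.indep_vars (\<lambda>_. borel) \<xi> UNIV"
    using M.indep_vars_compose2[OF indep fst_meas] by simp
  have \<eta>_indep: "M.indep_vars (\<lambda>_. borel) \<eta> UNIV"
    using M.indep_vars_compose2[OF indep snd_meas] by simp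
  have \<xi>_law: "distr M borel (\<xi> k) = distr M borel (\<xi> 0)" for k
  proof -
    have "distr M borel (\<xi> k) = distr (distr M borel (\<lambda>\<omega>. (\<xi> k \<omega>, \<eta> k \<omega>))) borel fst"
      by (subst distr_distr[OF fst_meas pair]) (simp add: comp_def)
    also have "\<dots> = distr M borel (\<xi> 0)"
      unfolding ident[of k] by (subst distr_distr[OF fst_meas pair]) (simp add: comp_def)
    finally show ?thesis .
  qed
  have \<eta>_law: "distr M borel (\<eta> k) = D" for k
  proof -
    have "distr M borel (\<eta> k) = distr (distr M borel (\<lambda>\<omega>. (\<xi> k \<omega>, \<eta> k \<omega>))) borel snd"
      by (subst distr_distr[OF snd_meas pair]) (simp add: comp_def)
    also have "\<dots> = D"
      unfolding ident[of k] D_def by (subst distr_distr[OF snd_meas pair]) (simp add: comp_def)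
    finally show ?thesis .
  qed
  have D: "real_distribution D" unfolding D_def by (rule M.real_distribution_distr) measurable

  have p_anti: "antimono p"
    unfolding p_def by (intro antimonoI M.finite_measure_mono) (auto intro: le_less_trans)
  have R_anti: "antimono R"
    unfolding R_def by (intro antimonoI M.finite_measure_mono) (auto intro: le_less_trans)
  have p_equiv: "p \<sim>[at_top] (\<lambda>x. x powr (- \<alpha>) * \<l> x)" using assms(10) unfolding p_def[abs_def] .
  note p_ratio = tail_ratio_of_asymp_equiv[OF p_equiv assms(6)]
  have p_pos: "0 < p x" for x by (rule antitone_pos[OF p_anti p_ratio(2)])
  have R_rv: "regularly_varying R (- \<beta>)" using assms(18) unfolding R_def[abs_def] .
  then obtain a where "\<And>x. a \<le> x \<Longrightarrow> 0 < R x" unfolding regularly_varying_def by blast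
  then have "\<forall>\<^sub>F x in at_top. 0 < R x" by (rule eventually_at_top_linorderI)
  then have R_pos: "0 < R x" for x by (rule antitone_pos[OF R_anti])
  have R_cdf: "1 - cdf D x = R x" for x
  proof -
    have "cdf D x = M.prob {\<omega> \<in> space M. \<eta> 0 \<omega> \<le> x}"
      unfolding cdf_def2 D_def by (subst measure_distr) (auto simp: vimage_def Int_def conj_commute)
    moreover have "R x = 1 - M.prob {\<omega> \<in> space M. \<eta> 0 \<omega> \<le> x}"
    proof -
      have "{\<omega> \<in> space M. x < \<eta> 0 \<omega>} = space M - {\<omega> \<in> space M. \<eta> 0 \<omega> \<le> x}" by auto
      then show ?thesis unfolding R_def by (simp only:) (rule M.prob_compl, measurable)
    qed
    ultimately show ?thesis by simp
  qed
  have lt1: "cdf D x < 1" for x using R_cdf[of x] R_pos[of x] by simp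
  have b_lim: "((\<lambda>x. x * R (b x)) \<longlongrightarrow> 1) at_top" using assms(20) by (simp only: R_def)
  note norming = norming_sequence[OF R_anti R_pos b_lim]
  have c_top: "filterlim c at_top sequentially" using norming(1) by (simp only: c_def[abs_def])
  have c_pos: "0 < c n" if "0 < n" for n using assms(19)[of "real n"] that by (simp add: c_def)
  have tail: "(\<lambda>n. real n * (1 - cdf D (x * c n))) \<longlonglongrightarrow> x powr - \<beta>" if x: "0 < x" for x
    unfolding R_cdf c_def
    by (rule norming(2)) (use R_rv x in \<open>simp add: regularly_varying_def\<close>)
  have "filterlim (\<lambda>x. R x / p x) at_top at_top" using assms(15) by (simp only: R_def p_def)
  from norming(3)[OF this] have np: "(\<lambda>n. real n * p (c n)) \<longlonglongrightarrow> 0" by (simp only: c_def)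

  define v where "v n \<omega> = scaled_max (c n) (\<lambda>k. (\<Sum>i=1..k. \<xi> i \<omega>) + \<eta> (Suc k) \<omega>)" for n \<omega>
  define pos where "pos a k = max 0 (a k)" for a :: "nat \<Rightarrow> real" and k :: nat
  define u where "u n \<omega> = pos (scaled_max (c n) (\<lambda>k. \<eta> (Suc k) \<omega>))" for n \<omega>
  \<comment> \<open>The value for \<open>n = 0\<close>, where there are no strips, is a placeholder.\<close>
  define u' where "u' n \<omega> = (if n = 0 then (\<lambda>_. 0) else pos (scaled_max (c n) (\<lambda>k. P.copy D n k \<omega>)))" for n \<omega>
  have X_eq: "perturbed_walk_max \<xi> \<eta> b n \<omega> = step_path n (v n \<omega>)" for n \<omega>
    by (simp add: perturbed_walk_max_def step_path_def v_def scaled_max_def c_def)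
  have pos_meas: "(\<lambda>\<omega>. pos (w \<omega>)) \<in> borel_measurable S" if w: "w \<in> borel_measurable S"
    for w :: "'c \<Rightarrow> nat \<Rightarrow> real" and S
  proof (rule measurable_coordinatewise_then_product)
    fix k
    have "(\<lambda>\<omega>. w \<omega> k) \<in> borel_measurable S"
      by (rule measurable_compose[OF w borel_measurable_continuous_onI[OF continuous_on_product_coordinates]])
    then show "(\<lambda>\<omega>. pos (w \<omega>) k) \<in> borel_measurable S" unfolding pos_def by measurable
  qed
  have v_meas: "v n \<in> borel_measurable M" for n
    unfolding v_def by (rule scaled_max_measurable) measurable
  have u_meas: "u n \<in> borel_measurable M" for n
    unfolding u_def by (intro pos_meas scaled_max_measurable) measurable
  have u'_meas: "u' n \<in> borel_measurable Q" for n
  proof (cases "n = 0")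
    case False
    then show ?thesis
      unfolding u'_def using P.copy_measurable[OF D] by (simp add: pos_meas scaled_max_measurable)
  qed (simp add: u'_def[abs_def])
  have law: "distr M borel (u n) = distr Q borel (u' n)" if n: "0 < n" for n
  proof -
    define f where "f a = pos (scaled_max (c n) a)" for a
    have f: "f \<in> borel_measurable borel"
      unfolding f_def
      by (intro pos_meas scaled_max_measurable borel_measurable_continuous_onI continuous_on_product_coordinates)
    have seq1: "(\<lambda>\<omega> k. \<eta> (Suc k) \<omega>) \<in> borel_measurable M"
      by (rule measurable_coordinatewise_then_product) measurable
    have seq2: "(\<lambda>\<omega> k. P.copy D n k \<omega>) \<in> borel_measurable Q"
      by (rule measurable_coordinatewise_then_product) (rule P.copy_measurable[OF D n])
    have "distr M borel (u n) = distr (distr M borel (\<lambda>\<omega> k. \<eta> (Suc k) \<omega>)) borel f"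
      by (subst distr_distr[OF f seq1]) (simp add: comp_def f_def u_def[abs_def])
    also have "distr M borel (\<lambda>\<omega> k. \<eta> (Suc k) \<omega>) = distr Q borel (\<lambda>\<omega> k. P.copy D n k \<omega>)"
      using M.distr_iid_sequence[OF M.indep_vars_shift[OF \<eta>_indep] \<eta>_law]
        P.distr_iid_sequence[OF P.copy_independent[OF D n lt1] P.copy_distribution[OF D n lt1]] by simp
    also have "distr (distr Q borel (\<lambda>\<omega> k. P.copy D n k \<omega>)) borel f = distr Q borel (u' n)"
      using n by (subst distr_distr[OF f seq2]) (simp add: comp_def f_def u'_def[abs_def])
    finally show ?thesis .
  qed
  have conv: "AE \<omega> in Q. J1_converges (\<lambda>n. step_path n (u' n \<omega>)) (extremal_process N \<omega>)"
    using P.AE_regular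
  proof (rule AE_mp, intro AE_I2 impI)
    fix \<omega> assume \<omega>: "\<omega> \<in> space Q" "P.regular \<omega>"
    from P.copy_paths_J1_converge[OF D c_pos tail lt1 \<omega>]
    show "J1_converges (\<lambda>n. step_path n (u' n \<omega>)) (extremal_process N \<omega>)"
    proof (rule J1_converges_perturbation)
      fix \<epsilon> T :: real assume \<epsilon>: "0 < \<epsilon>"
      show "\<forall>\<^sub>F n in sequentially. \<forall>t\<in>{0..T}. \<bar>step_path n (u' n \<omega>) t -
          step_path n (\<lambda>k. max 0 (Max ((\<lambda>i. P.copy D n i \<omega>) ` {0..k}) / c n)) t\<bar> \<le> \<epsilon>"
        using eventually_gt_at_top[of "0::nat"]
      proof eventually_elim
        case (elim n)
        then have "u' n \<omega> = (\<lambda>k. max 0 (Max ((\<lambda>i. P.copy D n i \<omega>) ` {0..k}) / c n))"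
          by (simp add: u'_def pos_def[abs_def] scaled_max_def)
        then show ?case using \<epsilon> by simp
      qed
    qed
  qed
  have close: "(\<lambda>n. measure M {\<omega> \<in> space M. \<exists>k\<le>n * T. \<delta> \<le> \<bar>u n \<omega> k - v n \<omega> k\<bar>}) \<longlonglongrightarrow> 0"
    if \<delta>: "0 < \<delta>" for \<delta> :: real and T :: nat
  proof -
    \<comment> \<open>Either the walk or the first perturbation \<open>\<eta>\<^sub>1\<close> has to be large.\<close>
    let ?S = "\<lambda>n. {\<omega> \<in> space M. \<exists>k\<le>n * T. \<delta> / 2 * c n \<le> \<bar>\<Sum>i=1..k. \<xi> i \<omega>\<bar>}"
    let ?E = "\<lambda>n. {\<omega> \<in> space M. \<delta> / 2 * c n \<le> \<bar>\<eta> 1 \<omega>\<bar>}"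
    have "(\<lambda>n. measure M (?S n)) \<longlonglongrightarrow> 0"
      by (rule M.maximal_partial_sum_negligible[OF p_def \<xi>_indep \<xi>_law p_pos p_ratio(1) assms(5) assms(13)
            assms(14) c_top np]) (use \<delta> in auto)
    moreover have "filterlim (\<lambda>n. \<delta> / 2 * c n) at_top sequentially"
      using \<delta> by (intro filterlim_tendsto_pos_mult_at_top[OF tendsto_const _ c_top]) simp
    then have "(\<lambda>n. measure M (?E n)) \<longlonglongrightarrow> 0" by (rule M.exceedance_tendsto_0[OF \<eta>])
    ultimately have lim: "(\<lambda>n. measure M (?S n) + measure M (?E n)) \<longlonglongrightarrow> 0"
      using tendsto_add by fastforce
    have "\<forall>\<^sub>F n in sequentially. measure M {\<omega> \<in> space M. \<exists>k\<le>n * T. \<delta> \<le> \<bar>u n \<omega> k - v n \<omega> k\<bar>}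
        \<le> measure M (?S n) + measure M (?E n)"
      using eventually_gt_at_top[of "0::nat"]
    proof eventually_elim
      case (elim n)
      have "{\<omega> \<in> space M. \<exists>k\<le>n * T. \<delta> \<le> \<bar>u n \<omega> k - v n \<omega> k\<bar>} \<subseteq> ?S n \<union> ?E n"
      proof
        fix \<omega> assume "\<omega> \<in> {\<omega> \<in> space M. \<exists>k\<le>n * T. \<delta> \<le> \<bar>u n \<omega> k - v n \<omega> k\<bar>}"
        then obtain k where k: "\<omega> \<in> space M" "k \<le> n * T" "\<delta> \<le> \<bar>u n \<omega> k - v n \<omega> k\<bar>" by blast
        show "\<omega> \<in> ?S n \<union> ?E n"
        proof (rule ccontr)
          assume notin: "\<omega> \<notin> ?S n \<union> ?E n"
          have "\<bar>\<Sum>i=1..j. \<xi> i \<omega>\<bar> < \<delta> / 2 * c n" if "j \<le> n * T" for j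
          proof (rule ccontr)
            assume "\<not> ?thesis"
            then have large: "\<delta> / 2 * c n \<le> \<bar>\<Sum>i=1..j. \<xi> i \<omega>\<bar>" by (simp only: not_less)
            have "\<omega> \<in> ?S n"
              by (rule CollectI, rule conjI[OF k(1)], rule exI[of _ j], rule conjI[OF that large])
            then show False using notin by blast
          qed
          then have "\<bar>\<Sum>i=1..j. \<xi> i \<omega>\<bar> < \<delta> / 2 * c n" if "j \<le> k" for j
            using k(2) that by simp
          moreover have "\<bar>\<eta> (Suc 0) \<omega>\<bar> < \<delta> / 2 * c n"
            using notin k(1) by (auto simp: not_le)
          ultimately have "\<bar>u n \<omega> k - v n \<omega> k\<bar> < \<delta>"
            unfolding u_def v_def pos_def by (intro scaled_max_perturbation c_pos elim)
          then show False using k(3) by simp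
        qed
      qed
      then have "measure M {\<omega> \<in> space M. \<exists>k\<le>n * T. \<delta> \<le> \<bar>u n \<omega> k - v n \<omega> k\<bar>} \<le> measure M (?S n \<union> ?E n)"
        by (rule M.finite_measure_mono) measurable
      also have "\<dots> \<le> measure M (?S n) + measure M (?E n)" by (rule measure_Un_le) measurable
      finally show ?case .
    qed
    then show ?thesis
      by (rule tendsto_sandwich[OF _ _ tendsto_const lim, rotated]) (auto intro: always_eventually)
  qed
  show ?thesis
    unfolding converges_in_distribution_def
  proof (intro conjI allI impI)
    show "perturbed_walk_max \<xi> \<eta> b n \<in> measurable M (borel_algebra_of skorokhod_J1)" for n
      using step_path_measurable[OF v_meas, of n n] by (simp add: X_eq[abs_def])
    show "extremal_process N \<in> measurable Q (borel_algebra_of skorokhod_J1)"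
      by (rule P.extremal_process_measurable)
    fix F :: "(real \<Rightarrow> real) \<Rightarrow> real"
    assume F: "continuous_map skorokhod_J1 euclideanreal F \<and> bounded (F ` topspace skorokhod_J1)"
    show "(\<lambda>n. \<integral>\<omega>. F (perturbed_walk_max \<xi> \<eta> b n \<omega>) \<partial>M) \<longlonglongrightarrow> (\<integral>\<omega>. F (extremal_process N \<omega>) \<partial>Q)"
      unfolding X_eq
      by (rule step_paths_integral_tendsto[OF M P.prob_space_axioms _ _ u_meas v_meas u'_meas law
            P.extremal_process_measurable conv close])
        (use F in \<open>simp_all add: topspace_skorokhod_J1\<close>)
  qed
qed

end
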